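(* Let $m\geq 1$ be an integer, and let $\Sigma$ be an open Riemann surface with the conformal metric $$ds^2=(1+|g|^2)^m|\omega|^2,$$ where $\omega$ is a holomorphic $1$-form on $\Sigma$ and $g$ is a meromorphic function on $\Sigma$. If the metric $ds^2$ is complete and $g$ is nonconstant, then $g$ can omit at most $m+2$ distinct values in $\mathbf{C}\cup\{\infty\}$.
   Context: An open Riemann surface is a connected non-compact Riemann surface. A meromorphic function $g$ is regarded as a holomorphic map $\Sigma\to\mathbf{C}\cup\{\infty\}$, and it omits a value $\alpha\in\mathbf{C}\cup\{\infty\}$ if $\alpha\notin g(\Sigma)$. The expression $(1+|g|^2)^m|\omega|^2$ is assumed to define a (positive definite, smooth) conformal Riemannian metric on all of $\Sigma$, including (after continuous extension) at the poles of $g$. *)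

theory Defs
  imports "HOL-Complex_Analysis.Complex_Analysis"
begin

section \<open>Riemann surfaces\<close>

text \<open>
  A chart is a pair of its domain and its coordinate function; the coordinate function is
  irrelevant outside the domain.
\<close>

type_synonym 'a chart = "'a set \<times> ('a \<Rightarrow> complex)"

definition chart_of :: "'a topology \<Rightarrow> 'a chart \<Rightarrow> bool" where
  "chart_of X c \<longleftrightarrow> (case c of (U, \<phi>) \<Rightarrow>
     openin X U \<and> open (\<phi> ` U) \<and>
     homeomorphic_map (subtopology X U) (top_of_set (\<phi> ` U)) \<phi>)"

definition chart_inv :: "'a chart \<Rightarrow> complex \<Rightarrow> 'a" where
  "chart_inv c = inv_into (fst c) (snd c)"

text \<open>The coordinate change from \<open>c\<close> to \<open>c'\<close>, meaningful on the \<open>c\<close>-image of the overlap.\<close>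

definition transition :: "'a chart \<Rightarrow> 'a chart \<Rightarrow> complex \<Rightarrow> complex" where
  "transition c c' = snd c' \<circ> chart_inv c"

text \<open>
  The atlas need not be maximal. Second countability is not required, as it is automatic for
  connected Riemann surfaces by Rado's theorem.
\<close>

definition riemann_surface :: "'a topology \<Rightarrow> 'a chart set \<Rightarrow> bool" where
  "riemann_surface X A \<longleftrightarrow>
     Hausdorff_space X \<and>
     (\<forall>c\<in>A. chart_of X c) \<and>
     (\<Union>c\<in>A. fst c) = topspace X \<and>
     (\<forall>c\<in>A. \<forall>c'\<in>A. transition c c' holomorphic_on (snd c ` (fst c \<inter> fst c')))"

definition open_riemann_surface :: "'a topology \<Rightarrow> 'a chart set \<Rightarrow> bool" where
  "open_riemann_surface X A \<longleftrightarrow>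
     riemann_surface X A \<and> connected_space X \<and> \<not> compact_space X"

definition holomorphic_map ::
  "'a topology \<Rightarrow> 'a chart set \<Rightarrow> 'b topology \<Rightarrow> 'b chart set \<Rightarrow> ('a \<Rightarrow> 'b) \<Rightarrow> bool" where
  "holomorphic_map X A Y B f \<longleftrightarrow>
     continuous_map X Y f \<and>
     (\<forall>c\<in>A. \<forall>c'\<in>B. (snd c' \<circ> f \<circ> chart_inv c) holomorphic_on
                     (snd c ` {p \<in> fst c. f p \<in> fst c'}))"


section \<open>Meromorphic functions and holomorphic 1-forms\<close>

text \<open>The Riemann sphere is the one-point compactification, with \<open>None\<close> as the point at infinity.\<close>

definition sphere_topology :: "complex option topology" where
  "sphere_topology = Alexandroff_compactification euclidean"

definition sphere_atlas :: "complex option chart set" where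
  "sphere_atlas =
     {(range Some, the),
      (UNIV - {Some 0}, \<lambda>w. case w of None \<Rightarrow> 0 | Some z \<Rightarrow> inverse z)}"

text \<open>
  The constant map to infinity is not a meromorphic function (on a connected surface).
\<close>

definition meromorphic_function ::
  "'a topology \<Rightarrow> 'a chart set \<Rightarrow> ('a \<Rightarrow> complex option) \<Rightarrow> bool" where
  "meromorphic_function X A g \<longleftrightarrow>
     holomorphic_map X A sphere_topology sphere_atlas g \<and> (\<exists>p\<in>topspace X. g p \<noteq> None)"

text \<open>
  A 1-form of type (1,0) is given by its local coefficients: in the chart \<open>c\<close> with coordinate \<open>z\<close>
  it reads \<open>\<omega> c z dz\<close>.
\<close>

definition holomorphic_one_form ::
  "'a chart set \<Rightarrow> ('a chart \<Rightarrow> complex \<Rightarrow> complex) \<Rightarrow> bool" where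
  "holomorphic_one_form A \<omega> \<longleftrightarrow>
     (\<forall>c\<in>A. \<omega> c holomorphic_on (snd c ` fst c)) \<and>
     (\<forall>c\<in>A. \<forall>c'\<in>A. \<forall>z \<in> snd c ` (fst c \<inter> fst c').
        \<omega> c z = \<omega> c' (transition c c' z) * deriv (transition c c') z)"


section \<open>Conformal metrics\<close>

fun Ck_on :: "nat \<Rightarrow> ('a::real_normed_vector \<Rightarrow> 'b::real_normed_vector) \<Rightarrow> 'a set \<Rightarrow> bool" where
  "Ck_on 0 f S \<longleftrightarrow> continuous_on S f"
| "Ck_on (Suc k) f S \<longleftrightarrow>
     (\<forall>x\<in>S. f differentiable (at x)) \<and>
     (\<forall>v. Ck_on k (\<lambda>x. frechet_derivative f (at x) v) S)"

text \<open>Real smoothness; intended for open \<open>S\<close> in a finite-dimensional space.\<close>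

definition smooth_on ::
  "('a::real_normed_vector \<Rightarrow> 'b::real_normed_vector) \<Rightarrow> 'a set \<Rightarrow> bool" where
  "smooth_on f S \<longleftrightarrow> (\<forall>k. Ck_on k f S)"

text \<open>
  A conformal metric is given by its local densities: in the chart \<open>c\<close> with coordinate \<open>z\<close> it
  reads \<open>ds\<^sup>2 = \<rho> c z |dz|\<^sup>2\<close>.
\<close>

definition conformal_metric ::
  "'a chart set \<Rightarrow> ('a chart \<Rightarrow> complex \<Rightarrow> real) \<Rightarrow> bool" where
  "conformal_metric A \<rho> \<longleftrightarrow>
     (\<forall>c\<in>A. smooth_on (\<rho> c) (snd c ` fst c) \<and> (\<forall>z \<in> snd c ` fst c. \<rho> c z > 0)) \<and>
     (\<forall>c\<in>A. \<forall>c'\<in>A. \<forall>z \<in> snd c ` (fst c \<inter> fst c').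
        \<rho> c z = \<rho> c' (transition c c' z) * (cmod (deriv (transition c c') z))\<^sup>2)"

text \<open>
  The density of \<open>(1 + |g|\<^sup>2)\<^sup>m |\<omega>|\<^sup>2\<close>. At a pole of \<open>g\<close> it is the limit of the values at nearby
  points, which are not poles. If that limit does not exist, then the value is unspecified, but
  no value makes the density continuous, so it is not a \<^const>\<open>conformal_metric\<close>.
\<close>

definition metric_formula ::
  "nat \<Rightarrow> ('a \<Rightarrow> complex option) \<Rightarrow> ('a chart \<Rightarrow> complex \<Rightarrow> complex) \<Rightarrow> 'a chart \<Rightarrow> complex \<Rightarrow> real" where
  "metric_formula m g \<omega> c z =
     (1 + (cmod (the (g (chart_inv c z))))\<^sup>2) ^ m * (cmod (\<omega> c z))\<^sup>2"

definition metric_density ::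
  "nat \<Rightarrow> ('a \<Rightarrow> complex option) \<Rightarrow> ('a chart \<Rightarrow> complex \<Rightarrow> complex) \<Rightarrow> 'a chart \<Rightarrow> complex \<Rightarrow> real" where
  "metric_density m g \<omega> c z =
     (if g (chart_inv c z) = None then Lim (at z) (metric_formula m g \<omega> c)
      else metric_formula m g \<omega> c z)"


section \<open>Completeness\<close>

definition piecewise_C1_path ::
  "'a topology \<Rightarrow> 'a chart set \<Rightarrow> (real \<Rightarrow> 'a) \<Rightarrow> bool" where
  "piecewise_C1_path X A \<gamma> \<longleftrightarrow>
     pathin X \<gamma> \<and>
     (\<forall>c\<in>A. \<forall>a b. 0 \<le> a \<and> b \<le> 1 \<and> \<gamma> ` {a..b} \<subseteq> fst c \<longrightarrow>
        (snd c \<circ> \<gamma>) piecewise_C1_differentiable_on {a..b})"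

text \<open>
  By the transformation rule for the densities, the speed does not depend on the choice of the
  chart around \<open>\<gamma> t\<close>, except possibly at the finitely many times where \<open>\<gamma>\<close> is not differentiable.
\<close>

definition speed ::
  "'a chart set \<Rightarrow> ('a chart \<Rightarrow> complex \<Rightarrow> real) \<Rightarrow> (real \<Rightarrow> 'a) \<Rightarrow> real \<Rightarrow> real" where
  "speed A \<rho> \<gamma> t =
     (let c = (SOME c. c \<in> A \<and> \<gamma> t \<in> fst c)
      in sqrt (\<rho> c (snd c (\<gamma> t))) * cmod (vector_derivative (snd c \<circ> \<gamma>) (at t)))"

text \<open>
  The length takes values in \<^typ>\<open>ennreal\<close>, because the library notion
  \<open>piecewise_C1_differentiable_on\<close> allows unbounded derivatives near the exceptional points and
  hence paths of infinite length.
\<close>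

definition path_len ::
  "'a chart set \<Rightarrow> ('a chart \<Rightarrow> complex \<Rightarrow> real) \<Rightarrow> (real \<Rightarrow> 'a) \<Rightarrow> ennreal" where
  "path_len A \<rho> \<gamma> = (\<integral>\<^sup>+t\<in>{0..1}. ennreal (speed A \<rho> \<gamma> t) \<partial>lborel)"

definition metric_dist ::
  "'a topology \<Rightarrow> 'a chart set \<Rightarrow> ('a chart \<Rightarrow> complex \<Rightarrow> real) \<Rightarrow> 'a \<Rightarrow> 'a \<Rightarrow> real" where
  "metric_dist X A \<rho> p q =
     enn2real (INF \<gamma> \<in> {\<gamma>. piecewise_C1_path X A \<gamma> \<and> \<gamma> 0 = p \<and> \<gamma> 1 = q}. path_len A \<rho> \<gamma>)"

text \<open>
  For a conformal metric on a connected Riemann surface, \<^const>\<open>metric_dist\<close> is a distance function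
  inducing the topology of the surface.
\<close>

definition complete_metric ::
  "'a topology \<Rightarrow> 'a chart set \<Rightarrow> ('a chart \<Rightarrow> complex \<Rightarrow> real) \<Rightarrow> bool" where
  "complete_metric X A \<rho> \<longleftrightarrow> Metric_space.mcomplete (topspace X) (metric_dist X A \<rho>)"

end

theory Submission
  imports Defs
begin

text \<open>
  Suppose that \<open>g\<close> omits \<open>m + 3\<close> values. A rotation of the Riemann sphere changes \<open>1 + |g|\<^sup>2\<close> only by
  a factor that can be absorbed into \<open>\<omega>\<close>, so one of the omitted values may be taken to be infinity.
  Then the metric is \<open>\<kappa> (1 + |G|\<^sup>2)\<^sup>m |W|\<^sup>2\<close>, where \<open>G\<close> is a holomorphic function, \<open>W\<close> is a nowhere
  vanishing holomorphic 1-form, and \<open>G\<close> omits a set \<open>S\<close> of \<open>m + 2\<close> complex numbers. The claim becomes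
  that \<open>G\<close> is constant if the metric is complete.

  Put \<open>N = 2 m + 3\<close> and \<open>P(x) = \<Prod>\<alpha>\<in>S. (x - \<alpha>)\<close>. The 1-form \<open>W^(N+1) P(G)^(N-1) / (dG)^N\<close> has poles at
  the critical points of \<open>G\<close> and no zeros. Its dual is therefore a holomorphic vector field \<open>V\<close> on the
  whole surface. Let \<open>\<Phi>\<close> be an integral curve of \<open>V\<close> in complex time, defined for \<open>|w| < R\<close>, and put
  \<open>f = G \<circ> \<Phi>\<close>. In the coordinate \<open>w\<close> the 1-form is \<open>dw\<close>, and so the line element of the metric satisfies
  \<open>(ds/|dw|)^(N+1) = const * (1 + |f|^2)^(m(m+2)) |f'|^N / |P(f)|^(N-1)\<close>.

  The right-hand side is at most \<open>C / (R - |w|)^N\<close> (\<open>deriv_bound_omit_finite_set\<close>), because \<open>f\<close> omits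
  \<open>S\<close>. This is where the number \<open>m + 2\<close> enters: with that many omitted values the two sides balance at
  infinity. The source of the bound is Schottky's theorem, which controls the derivative of a function that omits 0
  and 1; applied to an \<open>N\<close>-th root of such a function, it gives the decay that is needed when the
  function comes close to an omitted value.

  Since \<open>N / (N + 1) < 1\<close>, the images under \<open>\<Phi>\<close> of the radii of the disc have finite length
  (\<open>flow_rays_converge\<close>). By completeness they converge on the surface, hence \<open>\<Phi>\<close> extends past every
  boundary point of the disc, hence to a larger disc (\<open>flow_exists_on_all_balls\<close>). So the flow exists on
  discs of every radius \<open>R\<close>, and the bound at the centre, for \<open>R\<close> tending to infinity, shows that
  \<open>f'(0) = 0\<close>. As \<open>f'\<close> is \<open>(dG)^(N+1)\<close> up to a nonzero factor, \<open>dG\<close> vanishes everywhere.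

  To apply completeness, one has to know that the distance function of the metric makes the surface a
  metric space and that convergence in it is convergence in the topology of the surface. This is proved
  in the section on the distance of a conformal metric.
\<close>

section \<open>Holomorphic functions on a disc that omit a finite set\<close>

text \<open>
  Schottky's theorem bounds \<open>f\<close> on a smaller disc in terms of \<open>r\<close> alone, and Cauchy's inequality turns
  this into a bound for the derivative. Schottky's theorem speaks of the closed disc, hence the passage
  to \<open>f (z / 2)\<close>.
\<close>

lemma deriv_bound_omit_0_1:
  fixes r :: real
  obtains C where "C > 0"
    "\<And>f. f holomorphic_on ball 0 1 \<Longrightarrow> (\<And>z. z \<in> ball 0 1 \<Longrightarrow> f z \<noteq> 0 \<and> f z \<noteq> 1) \<Longrightarrow>
         cmod (f 0) \<le> r \<Longrightarrow> cmod (deriv f 0) \<le> C"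
proof -
  define B where "B = exp(pi * exp(pi * (2 + 2 * r + 12 * (1/2) / (1 - 1/2))))"
  have "cmod (deriv f 0) \<le> 4 * B"
    if hol: "f holomorphic_on ball 0 1"
      and omit: "\<And>z. z \<in> ball 0 1 \<Longrightarrow> f z \<noteq> 0 \<and> f z \<noteq> 1"
      and r: "cmod (f 0) \<le> r" for f
  proof -
    define h where "h z = f (z / 2)" for z
    have sub: "(\<lambda>z. z / 2) ` cball 0 1 \<subseteq> ball (0::complex) 1"
      by (auto simp: norm_divide)
    have holh: "h holomorphic_on cball 0 1"
      unfolding h_def
      by (intro holomorphic_on_compose_gen[OF _ hol sub, unfolded o_def] holomorphic_intros) auto
    have hB: "cmod (h z) \<le> B" if "cmod z \<le> 1/2" for z
      unfolding B_def
    proof (rule Schottky[OF holh])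
      show "cmod (h 0) \<le> r" using r by (simp add: h_def)
      show "\<not> (h z = 0 \<or> h z = 1)" if "z \<in> cball 0 1" for z
        using omit[of "z/2"] that by (auto simp: h_def norm_divide)
    qed (use that in auto)
    have fB: "cmod (f z) \<le> B" if "cmod z \<le> 1/4" for z
      using hB[of "2*z"] that by (simp add: h_def norm_mult)
    have "cmod ((deriv ^^ 1) f 0) \<le> fact 1 * B / (1/4) ^ 1"
    proof (rule Cauchy_inequality)
      show "f holomorphic_on ball 0 (1/4)"
        using hol by (rule holomorphic_on_subset) auto
      show "continuous_on (cball 0 (1/4)) f"
        by (rule continuous_on_subset[OF holomorphic_on_imp_continuous_on[OF hol]]) auto
    qed (use fB in auto)
    then show ?thesis by simp
  qed
  moreover have "4 * B > 0" by (simp add: B_def)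
  ultimately show ?thesis using that by blast
qed

text \<open>
  A nowhere vanishing function on the disc has a holomorphic \<open>N\<close>-th root \<open>F\<close>, which omits 0 and 1 as
  well. The bound for \<open>F'\<close> from Schottky's theorem gives \<open>|f'| = N |F|^(N-1) |F'| = O(|f|^(1-1/N))\<close>. For large
  \<open>N\<close> this comes close to the optimal order \<open>|f| log (1 / |f|)\<close> given by the hyperbolic metric.
\<close>

lemma deriv_power_bound_near_0:
  fixes r :: real and N :: nat
  assumes "N > 0"
  obtains C where "C > 0"
    "\<And>f. f holomorphic_on ball 0 1 \<Longrightarrow> (\<And>z. z \<in> ball 0 1 \<Longrightarrow> f z \<noteq> 0 \<and> f z \<noteq> 1) \<Longrightarrow>
         cmod (f 0) \<le> r \<Longrightarrow> cmod (deriv f 0) ^ N \<le> C * cmod (f 0) ^ (N - 1)"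
proof -
  obtain C where C: "C > 0"
    "\<And>f. f holomorphic_on ball 0 1 \<Longrightarrow> (\<And>z. z \<in> ball 0 1 \<Longrightarrow> f z \<noteq> 0 \<and> f z \<noteq> 1) \<Longrightarrow>
         cmod (f 0) \<le> max 1 r \<Longrightarrow> cmod (deriv f 0) \<le> C"
    using deriv_bound_omit_0_1[of "max 1 r"] by blast
  have "cmod (deriv f 0) ^ N \<le> (real N * C) ^ N * cmod (f 0) ^ (N - 1)"
    if hol: "f holomorphic_on ball 0 1"
      and omit: "\<And>z. z \<in> ball 0 1 \<Longrightarrow> f z \<noteq> 0 \<and> f z \<noteq> 1"
      and r: "cmod (f 0) \<le> r" for f
  proof -
    obtain h where h: "h holomorphic_on ball 0 1" "\<And>z. z \<in> ball 0 1 \<Longrightarrow> f z = exp (h z)"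
      using contractible_imp_holomorphic_log[OF hol convex_imp_contractible[OF convex_ball]] omit
      by metis
    define F where "F z = exp (h z / of_nat N)" for z
    have holF: "F holomorphic_on ball 0 1"
      unfolding F_def using h(1) assms by (intro holomorphic_intros) auto
    have fF: "f z = F z ^ N" if "z \<in> ball 0 1" for z
      using h(2)[OF that] assms by (simp add: F_def flip: exp_of_nat_mult)
    have omF: "F z \<noteq> 0 \<and> F z \<noteq> 1" if "z \<in> ball 0 1" for z
      using omit[OF that] fF[OF that] by (auto simp: F_def)
    have F0: "cmod (F 0) ^ N = cmod (f 0)"
      using fF[of 0] by (simp add: norm_power)
    have "cmod (F 0) \<le> max 1 r"
    proof (cases "cmod (F 0) \<le> 1")
      case False
      then have "cmod (F 0) ^ 1 \<le> cmod (F 0) ^ N"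
        using assms by (intro power_increasing) auto
      then show ?thesis using F0 r by simp
    qed auto
    then have dF: "cmod (deriv F 0) \<le> C" using C(2) holF omF by blast
    have "((\<lambda>z. F z ^ N) has_field_derivative of_nat N * (deriv F 0 * F 0 ^ (N - Suc 0))) (at 0)"
      using DERIV_power[OF holomorphic_derivI[OF holF open_ball, of 0], of N] by simp
    then have "(f has_field_derivative of_nat N * (deriv F 0 * F 0 ^ (N - Suc 0))) (at 0)"
      by (rule has_field_derivative_transform_within_open[where S="ball 0 1"]) (use fF in auto)
    then have "deriv f 0 = of_nat N * (deriv F 0 * F 0 ^ (N - Suc 0))"
      by (rule DERIV_imp_deriv)
    then have "cmod (deriv f 0) ^ N = (real N * cmod (deriv F 0)) ^ N * (cmod (F 0) ^ N) ^ (N - 1)"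
      by (simp add: norm_mult norm_power power_mult_distrib mult.commute flip: power_mult)
    also have "\<dots> \<le> (real N * C) ^ N * cmod (f 0) ^ (N - 1)"
      unfolding F0 using dF by (intro mult_right_mono power_mono mult_left_mono) auto
    finally show ?thesis .
  qed
  moreover have "(real N * C) ^ N > 0" using C(1) assms by simp
  ultimately show ?thesis using that by blast
qed

text \<open>
  The case of large values follows from the case of bounded values by passing to \<open>1 / f\<close>.
\<close>

lemma deriv_power_bound_near_infinity:
  fixes r :: real and N :: nat
  assumes "N > 0" "r > 0"
  obtains C where "C > 0"
    "\<And>f. f holomorphic_on ball 0 1 \<Longrightarrow> (\<And>z. z \<in> ball 0 1 \<Longrightarrow> f z \<noteq> 0 \<and> f z \<noteq> 1) \<Longrightarrow>
         1 / r \<le> cmod (f 0) \<Longrightarrow> cmod (deriv f 0) ^ N \<le> C * cmod (f 0) ^ (N + 1)"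
proof -
  obtain C where C: "C > 0"
    "\<And>f. f holomorphic_on ball 0 1 \<Longrightarrow> (\<And>z. z \<in> ball 0 1 \<Longrightarrow> f z \<noteq> 0 \<and> f z \<noteq> 1) \<Longrightarrow>
         cmod (f 0) \<le> r \<Longrightarrow> cmod (deriv f 0) ^ N \<le> C * cmod (f 0) ^ (N - 1)"
    using deriv_power_bound_near_0[OF assms(1), of r] by blast
  have "cmod (deriv f 0) ^ N \<le> C * cmod (f 0) ^ (N + 1)"
    if hol: "f holomorphic_on ball 0 1"
      and omit: "\<And>z. z \<in> ball 0 1 \<Longrightarrow> f z \<noteq> 0 \<and> f z \<noteq> 1"
      and r: "1 / r \<le> cmod (f 0)" for f
  proof -
    define h where "h z = inverse (f z)" for z
    have f0: "f 0 \<noteq> 0" using omit[of 0] by simp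
    have "(h has_field_derivative - (inverse (f 0) * deriv f 0 * inverse (f 0))) (at 0)"
      unfolding h_def using holomorphic_derivI[OF hol open_ball, of 0] f0
      by (intro DERIV_inverse') auto
    then have dh: "deriv h 0 = - (inverse (f 0) * deriv f 0 * inverse (f 0))"
      by (rule DERIV_imp_deriv)
    have "cmod (deriv h 0) ^ N \<le> C * cmod (h 0) ^ (N - 1)"
    proof (rule C(2))
      show "h holomorphic_on ball 0 1"
        unfolding h_def using hol omit by (intro holomorphic_intros) auto
      show "h z \<noteq> 0 \<and> h z \<noteq> 1" if "z \<in> ball 0 1" for z
        using omit[OF that] by (auto simp: h_def)
      show "cmod (h 0) \<le> r"
        using r f0 \<open>r > 0\<close> by (simp add: h_def norm_divide field_simps)
    qed
    then have "cmod (deriv f 0) ^ N / cmod (f 0) ^ (2 * N) \<le> C / cmod (f 0) ^ (N - 1)"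
      unfolding mult_2 power_add
      by (simp add: dh h_def norm_mult norm_inverse power_mult_distrib power_inverse divide_inverse
            mult_ac)
    then have "cmod (deriv f 0) ^ N \<le> C / cmod (f 0) ^ (N - 1) * cmod (f 0) ^ (2 * N)"
      using f0 by (simp add: pos_divide_le_eq)
    also have "2 * N = (N - 1) + (N + 1)" using assms(1) by simp
    also have "C / cmod (f 0) ^ (N - 1) * cmod (f 0) ^ ((N - 1) + (N + 1)) = C * cmod (f 0) ^ (N + 1)"
      using f0 by (simp only: power_add) simp
    finally show ?thesis .
  qed
  then show ?thesis using that C(1) by blast
qed

lemma deriv_affine_image:
  assumes "f holomorphic_on ball 0 1" "\<beta> \<noteq> \<alpha>"
  shows "deriv (\<lambda>z. (f z - \<alpha>) / (\<beta> - \<alpha>)) 0 = deriv f 0 / (\<beta> - \<alpha>)"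
proof -
  have "((\<lambda>z. (f z - \<alpha>) / (\<beta> - \<alpha>)) has_field_derivative deriv f 0 / (\<beta> - \<alpha>)) (at 0)"
    using holomorphic_derivI[OF assms(1) open_ball, of 0] assms(2)
    by (auto intro!: derivative_eq_intros)
  then show ?thesis by (rule DERIV_imp_deriv)
qed

text \<open>
  The affine map that takes \<open>\<alpha>\<close> to 0 and \<open>\<beta>\<close> to 1 reduces two arbitrary omitted values to 0 and 1.
\<close>

lemma deriv_power_bound_near_omitted_value:
  fixes \<rho> :: real and \<alpha> \<beta> :: complex and N :: nat
  assumes "N > 0" "\<beta> \<noteq> \<alpha>"
  shows "\<exists>C>0. \<forall>f. f holomorphic_on ball 0 1 \<longrightarrow> \<alpha> \<notin> f ` ball 0 1 \<longrightarrow> \<beta> \<notin> f ` ball 0 1 \<longrightarrow>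
         cmod (f 0) \<le> \<rho> \<longrightarrow> cmod (deriv f 0) ^ N \<le> C * cmod (f 0 - \<alpha>) ^ (N - 1)"
proof -
  let ?d = "cmod (\<beta> - \<alpha>)"
  obtain C where C: "C > 0"
    "\<And>f. f holomorphic_on ball 0 1 \<Longrightarrow> (\<And>z. z \<in> ball 0 1 \<Longrightarrow> f z \<noteq> 0 \<and> f z \<noteq> 1) \<Longrightarrow>
         cmod (f 0) \<le> (\<rho> + cmod \<alpha>) / ?d \<Longrightarrow> cmod (deriv f 0) ^ N \<le> C * cmod (f 0) ^ (N - 1)"
    using deriv_power_bound_near_0[OF assms(1), of "(\<rho> + cmod \<alpha>) / ?d"] by blast
  have d: "?d > 0" using assms by simp
  have "cmod (deriv f 0) ^ N \<le> (C * ?d) * cmod (f 0 - \<alpha>) ^ (N - 1)"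
    if hol: "f holomorphic_on ball 0 1" and om: "\<alpha> \<notin> f ` ball 0 1" "\<beta> \<notin> f ` ball 0 1"
      and r: "cmod (f 0) \<le> \<rho>" for f
  proof -
    have "cmod (deriv (\<lambda>z. (f z - \<alpha>) / (\<beta> - \<alpha>)) 0) ^ N \<le> C * cmod ((f 0 - \<alpha>) / (\<beta> - \<alpha>)) ^ (N - 1)"
    proof (rule C(2))
      show "(\<lambda>z. (f z - \<alpha>) / (\<beta> - \<alpha>)) holomorphic_on ball 0 1"
        using hol assms by (intro holomorphic_intros) auto
      show "(f z - \<alpha>) / (\<beta> - \<alpha>) \<noteq> 0 \<and> (f z - \<alpha>) / (\<beta> - \<alpha>) \<noteq> 1" if "z \<in> ball 0 1" for z
        using om that assms by auto
      show "cmod ((f 0 - \<alpha>) / (\<beta> - \<alpha>)) \<le> (\<rho> + cmod \<alpha>) / ?d"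
        using r norm_triangle_ineq4[of "f 0" \<alpha>] by (simp add: norm_divide divide_right_mono)
    qed
    then have "cmod (deriv f 0) ^ N / ?d ^ N \<le> C * cmod (f 0 - \<alpha>) ^ (N - 1) / ?d ^ (N - 1)"
      by (simp add: deriv_affine_image[OF hol assms(2)] norm_divide power_divide)
    then have "cmod (deriv f 0) ^ N \<le> C * cmod (f 0 - \<alpha>) ^ (N - 1) / ?d ^ (N - 1) * ?d ^ N"
      using d by (simp add: pos_divide_le_eq)
    also have "?d ^ N = ?d ^ (N - 1) * ?d" using assms(1) by (cases N) auto
    finally show ?thesis using d by (simp add: mult_ac)
  qed
  then show ?thesis using C(1) d by (intro exI[of _ "C * ?d"]) simp
qed

lemma deriv_power_bound_near_infinity_omitting:
  fixes \<alpha> \<beta> :: complex and N :: nat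
  assumes "N > 0" "\<beta> \<noteq> \<alpha>"
  shows "\<exists>C>0. \<forall>f. f holomorphic_on ball 0 1 \<longrightarrow> \<alpha> \<notin> f ` ball 0 1 \<longrightarrow> \<beta> \<notin> f ` ball 0 1 \<longrightarrow>
         1 \<le> cmod (f 0) \<longrightarrow> 2 * cmod \<alpha> \<le> cmod (f 0) \<longrightarrow>
         cmod (deriv f 0) ^ N \<le> C * cmod (f 0) ^ (N + 1)"
proof -
  let ?d = "cmod (\<beta> - \<alpha>)"
  have d: "?d > 0" using assms by simp
  obtain C where C: "C > 0"
    "\<And>f. f holomorphic_on ball 0 1 \<Longrightarrow> (\<And>z. z \<in> ball 0 1 \<Longrightarrow> f z \<noteq> 0 \<and> f z \<noteq> 1) \<Longrightarrow>
         1 / (2 * ?d) \<le> cmod (f 0) \<Longrightarrow> cmod (deriv f 0) ^ N \<le> C * cmod (f 0) ^ (N + 1)"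
    by (rule deriv_power_bound_near_infinity[OF assms(1), of "2 * ?d"]) (use d in auto)
  have "cmod (deriv f 0) ^ N \<le> (C * 2 ^ (N + 1) / ?d) * cmod (f 0) ^ (N + 1)"
    if hol: "f holomorphic_on ball 0 1" and om: "\<alpha> \<notin> f ` ball 0 1" "\<beta> \<notin> f ` ball 0 1"
      and r: "1 \<le> cmod (f 0)" "2 * cmod \<alpha> \<le> cmod (f 0)" for f
  proof -
    have "cmod (deriv (\<lambda>z. (f z - \<alpha>) / (\<beta> - \<alpha>)) 0) ^ N \<le> C * cmod ((f 0 - \<alpha>) / (\<beta> - \<alpha>)) ^ (N + 1)"
    proof (rule C(2))
      show "(\<lambda>z. (f z - \<alpha>) / (\<beta> - \<alpha>)) holomorphic_on ball 0 1"
        using hol assms by (intro holomorphic_intros) auto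
      show "(f z - \<alpha>) / (\<beta> - \<alpha>) \<noteq> 0 \<and> (f z - \<alpha>) / (\<beta> - \<alpha>) \<noteq> 1" if "z \<in> ball 0 1" for z
        using om that assms by auto
      have "1 / 2 \<le> cmod (f 0 - \<alpha>)"
        using r norm_triangle_ineq2[of "f 0" \<alpha>] by linarith
      then show "1 / (2 * ?d) \<le> cmod ((f 0 - \<alpha>) / (\<beta> - \<alpha>))"
        using d by (simp add: norm_divide field_simps)
    qed
    then have "cmod (deriv f 0) ^ N / ?d ^ N \<le> C * cmod (f 0 - \<alpha>) ^ (N + 1) / ?d ^ (N + 1)"
      by (simp add: deriv_affine_image[OF hol assms(2)] norm_divide power_divide)
    then have "cmod (deriv f 0) ^ N \<le> C * cmod (f 0 - \<alpha>) ^ (N + 1) / ?d ^ (N + 1) * ?d ^ N"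
      using d by (simp add: pos_divide_le_eq)
    also have "\<dots> = C * cmod (f 0 - \<alpha>) ^ (N + 1) / ?d"
      using d by simp
    also have "\<dots> \<le> C * (2 * cmod (f 0)) ^ (N + 1) / ?d"
      using r C(1) norm_triangle_ineq4[of "f 0" \<alpha>]
      by (intro divide_right_mono mult_left_mono power_mono) auto
    finally show ?thesis by (simp add: power_mult_distrib mult_ac)
  qed
  then show ?thesis using C(1) d by (intro exI[of _ "C * 2 ^ (N + 1) / ?d"]) simp
qed

text \<open>
  For bounded \<open>f 0\<close>, all factors of the product except the one of the nearest omitted value are bounded
  below, and the factor \<open>|f 0 - \<alpha>|^(N-1)\<close> of that value dominates \<open>|f' 0|^N\<close>. For large \<open>f 0\<close>, the
  left-hand side is of order \<open>|f 0|^(N+1+2M)\<close> at most, and the right-hand side has order \<open>|f 0|\<close> to the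
  power \<open>card S * (N - 1)\<close>; the hypothesis on the exponents says that these agree.
\<close>

lemma deriv_bound_unit_ball_omit_finite_set:
  fixes S :: "complex set" and N M :: nat
  assumes fin: "finite S" and card: "card S \<ge> 2" and N: "N > 0"
    and NM: "2 * M + N + 1 = card S * (N - 1)"
  shows "\<exists>C>0. \<forall>f. f holomorphic_on ball 0 1 \<longrightarrow> f ` ball 0 1 \<inter> S = {} \<longrightarrow>
       cmod (deriv f 0) ^ N * (1 + (cmod (f 0))\<^sup>2) ^ M \<le> C * (\<Prod>\<alpha>\<in>S. cmod (f 0 - \<alpha>)) ^ (N - 1)"
proof -
  define \<rho> where "\<rho> = 1 + 2 * (\<Sum>\<alpha>\<in>S. cmod \<alpha>)"
  have \<rho>1: "\<rho> \<ge> 1" by (simp add: \<rho>_def sum_nonneg)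
  have \<rho>2: "2 * cmod \<alpha> \<le> \<rho>" if "\<alpha> \<in> S" for \<alpha>
    using member_le_sum[OF that, of cmod] fin by (simp add: \<rho>_def)
  have other: "\<exists>\<beta>\<in>S. \<beta> \<noteq> \<alpha>" for \<alpha>
  proof (rule ccontr)
    assume "\<not> ?thesis"
    then have "S \<subseteq> {\<alpha>}" by auto
    then have "card S \<le> card {\<alpha>}" by (intro card_mono) auto
    then show False using card by simp
  qed
  have "\<forall>\<alpha>\<in>S. \<exists>C>0. \<forall>f. f holomorphic_on ball 0 1 \<longrightarrow> f ` ball 0 1 \<inter> S = {} \<longrightarrow>
         cmod (f 0) \<le> \<rho> \<longrightarrow> cmod (deriv f 0) ^ N \<le> C * cmod (f 0 - \<alpha>) ^ (N - 1)"
  proof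
    fix \<alpha> assume "\<alpha> \<in> S"
    obtain \<beta> where "\<beta> \<in> S" "\<beta> \<noteq> \<alpha>" using other by blast
    from deriv_power_bound_near_omitted_value[OF N this(2), of \<rho>] this \<open>\<alpha> \<in> S\<close>
    show "\<exists>C>0. \<forall>f. f holomorphic_on ball 0 1 \<longrightarrow> f ` ball 0 1 \<inter> S = {} \<longrightarrow>
         cmod (f 0) \<le> \<rho> \<longrightarrow> cmod (deriv f 0) ^ N \<le> C * cmod (f 0 - \<alpha>) ^ (N - 1)"
      by (metis disjoint_iff)
  qed
  then obtain c where c: "\<And>\<alpha>. \<alpha> \<in> S \<Longrightarrow> c \<alpha> > 0"
    "\<And>\<alpha> f. \<alpha> \<in> S \<Longrightarrow> f holomorphic_on ball 0 1 \<Longrightarrow> f ` ball 0 1 \<inter> S = {} \<Longrightarrow>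
         cmod (f 0) \<le> \<rho> \<Longrightarrow> cmod (deriv f 0) ^ N \<le> c \<alpha> * cmod (f 0 - \<alpha>) ^ (N - 1)"
    by metis
  define C1 where "C1 = (\<Sum>\<alpha>\<in>S. c \<alpha>)"
  have cC1: "c \<alpha> \<le> C1" if "\<alpha> \<in> S" for \<alpha>
    unfolding C1_def using fin that c(1) by (intro member_le_sum) (auto intro: less_imp_le)
  obtain \<alpha>0 where \<alpha>0: "\<alpha>0 \<in> S" using other by blast
  have C1: "C1 > 0" using cC1[OF \<alpha>0] c(1)[OF \<alpha>0] by simp
  obtain \<beta>0 where \<beta>0: "\<beta>0 \<in> S" "\<beta>0 \<noteq> \<alpha>0" using other by blast
  obtain C2 where C2: "C2 > 0"
    "\<And>f. f holomorphic_on ball 0 1 \<Longrightarrow> f ` ball 0 1 \<inter> S = {} \<Longrightarrow> \<rho> \<le> cmod (f 0) \<Longrightarrow>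
         cmod (deriv f 0) ^ N \<le> C2 * cmod (f 0) ^ (N + 1)"
  proof -
    obtain C where C: "C > 0"
      "\<And>f. f holomorphic_on ball 0 1 \<Longrightarrow> \<alpha>0 \<notin> f ` ball 0 1 \<Longrightarrow> \<beta>0 \<notin> f ` ball 0 1 \<Longrightarrow>
         1 \<le> cmod (f 0) \<Longrightarrow> 2 * cmod \<alpha>0 \<le> cmod (f 0) \<Longrightarrow>
         cmod (deriv f 0) ^ N \<le> C * cmod (f 0) ^ (N + 1)"
      using deriv_power_bound_near_infinity_omitting[OF N \<beta>0(2)] by blast
    show thesis
    proof (rule that[OF C(1)])
      fix f assume f: "f holomorphic_on ball 0 1" "f ` ball 0 1 \<inter> S = {}" "\<rho> \<le> cmod (f 0)"
      then show "cmod (deriv f 0) ^ N \<le> C * cmod (f 0) ^ (N + 1)"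
        using \<alpha>0 \<beta>0(1) \<rho>1 \<rho>2[OF \<alpha>0] by (intro C(2)) auto
    qed
  qed
  \<comment> \<open>Any two of the omitted values are at least \<open>2 * \<delta>\<close> apart.\<close>
  define \<delta> where "\<delta> = Min (insert 1 ((\<lambda>(\<alpha>, \<beta>). cmod (\<alpha> - \<beta>) / 2) ` {(\<alpha>, \<beta>) \<in> S \<times> S. \<alpha> \<noteq> \<beta>}))"
  have fin2: "finite ((\<lambda>(\<alpha>, \<beta>). cmod (\<alpha> - \<beta>) / 2) ` {(\<alpha>, \<beta>) \<in> S \<times> S. \<alpha> \<noteq> \<beta>})"
    by (intro finite_imageI finite_subset[OF _ finite_cartesian_product[OF fin fin]]) auto
  have \<delta>: "\<delta> > 0" "\<delta> \<le> 1" unfolding \<delta>_def using fin2 by (auto simp: Min_gr_iff)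
  have sep: "2 * \<delta> \<le> cmod (\<alpha> - \<beta>)" if "\<alpha> \<in> S" "\<beta> \<in> S" "\<alpha> \<noteq> \<beta>" for \<alpha> \<beta>
  proof -
    have "\<delta> \<le> cmod (\<alpha> - \<beta>) / 2"
      unfolding \<delta>_def using fin2 that by (intro Min_le) (auto intro!: rev_image_eqI[of "(\<alpha>, \<beta>)"])
    then show ?thesis by simp
  qed
  \<comment> \<open>\<open>K1\<close> serves for \<open>|f 0| \<le> \<rho>\<close>, and \<open>K2\<close> for \<open>|f 0| > \<rho>\<close>.\<close>
  define K1 where "K1 = C1 * (1 + \<rho>\<^sup>2) ^ M / (\<delta> ^ (card S - 1)) ^ (N - 1)"
  define K2 where "K2 = C2 * 2 ^ M * 2 ^ (card S * (N - 1))"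
  have K: "K1 > 0" "K2 > 0"
  proof -
    have "1 + \<rho>\<^sup>2 > 0" using zero_le_power2[of \<rho>] by linarith
    then show "K1 > 0" using C1 \<delta> by (simp add: K1_def)
  qed (use C2 in \<open>simp add: K2_def\<close>)
  show ?thesis
  proof (intro exI[of _ "K1 + K2"] conjI allI impI)
    show "K1 + K2 > 0" using K by simp
    fix f assume hol: "f holomorphic_on ball 0 1" and om: "f ` ball 0 1 \<inter> S = {}"
    define x where "x = f 0"
    let ?P = "(\<Prod>\<alpha>\<in>S. cmod (x - \<alpha>)) ^ (N - 1)"
    have P0: "?P \<ge> 0" by (simp add: prod_nonneg)
    have "cmod (deriv f 0) ^ N * (1 + (cmod x)\<^sup>2) ^ M \<le> (K1 + K2) * ?P"
    proof (cases "cmod x \<le> \<rho>")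
      case True
      obtain \<alpha> where \<alpha>: "\<alpha> \<in> S" "\<And>\<beta>. \<beta> \<in> S \<Longrightarrow> cmod (x - \<alpha>) \<le> cmod (x - \<beta>)"
        using ex_min_if_finite[of "(\<lambda>\<beta>. cmod (x - \<beta>)) ` S"] fin \<alpha>0
        by (metis (no_types, lifting) arg_min_if_finite(1) arg_min_least empty_iff)
      have far: "\<delta> \<le> cmod (x - \<beta>)" if "\<beta> \<in> S - {\<alpha>}" for \<beta>
      proof -
        have "2 * \<delta> \<le> cmod (\<alpha> - \<beta>)" using that \<alpha>(1) by (intro sep) auto
        also have "\<dots> \<le> cmod (x - \<beta>) + cmod (x - \<alpha>)"
          using norm_triangle_ineq4[of "x - \<beta>" "x - \<alpha>"] by simp
        also have "\<dots> \<le> 2 * cmod (x - \<beta>)" using \<alpha>(2)[of \<beta>] that by simp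
        finally show ?thesis by simp
      qed
      have "cmod (x - \<alpha>) * \<delta> ^ (card S - 1) = cmod (x - \<alpha>) * (\<Prod>\<beta>\<in>S - {\<alpha>}. \<delta>)"
        using \<alpha>(1) fin by simp
      also have "\<dots> \<le> cmod (x - \<alpha>) * (\<Prod>\<beta>\<in>S - {\<alpha>}. cmod (x - \<beta>))"
        using far \<delta> by (intro mult_left_mono prod_mono) auto
      also have "\<dots> = (\<Prod>\<alpha>\<in>S. cmod (x - \<alpha>))"
        using prod.remove[OF fin \<alpha>(1), of "\<lambda>\<alpha>. cmod (x - \<alpha>)"] by simp
      finally have "(cmod (x - \<alpha>) * \<delta> ^ (card S - 1)) ^ (N - 1) \<le> ?P"
        using \<delta> by (intro power_mono) auto
      then have *: "cmod (x - \<alpha>) ^ (N - 1) \<le> ?P / (\<delta> ^ (card S - 1)) ^ (N - 1)"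
        using \<delta> by (simp add: power_mult_distrib pos_le_divide_eq)
      have "cmod (deriv f 0) ^ N \<le> c \<alpha> * cmod (x - \<alpha>) ^ (N - 1)"
        unfolding x_def using True hol om \<alpha>(1) by (intro c(2)) (auto simp: x_def)
      also have "\<dots> \<le> C1 * (?P / (\<delta> ^ (card S - 1)) ^ (N - 1))"
        using cC1[OF \<alpha>(1)] C1 * by (intro mult_mono) auto
      finally have "cmod (deriv f 0) ^ N * (1 + (cmod x)\<^sup>2) ^ M
          \<le> C1 * (?P / (\<delta> ^ (card S - 1)) ^ (N - 1)) * (1 + \<rho>\<^sup>2) ^ M"
        using True C1 P0 \<delta> by (intro mult_mono power_mono add_left_mono) auto
      also have "\<dots> = K1 * ?P" by (simp add: K1_def)
      also have "\<dots> \<le> (K1 + K2) * ?P" using K P0 by (intro mult_right_mono) auto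
      finally show ?thesis .
    next
      case False
      then have x1: "cmod x \<ge> 1" using \<rho>1 by simp
      have "(cmod x / 2) ^ card S = (\<Prod>\<alpha>\<in>S. cmod x / 2)" by simp
      also have "\<dots> \<le> (\<Prod>\<alpha>\<in>S. cmod (x - \<alpha>))"
      proof (intro prod_mono conjI)
        fix \<alpha> assume "\<alpha> \<in> S"
        then show "cmod x / 2 \<le> cmod (x - \<alpha>)"
          using \<rho>2[of \<alpha>] False norm_triangle_ineq2[of x \<alpha>] by simp
      qed simp
      finally have P1: "((cmod x / 2) ^ card S) ^ (N - 1) \<le> ?P" by (intro power_mono) auto
      have "cmod (deriv f 0) ^ N \<le> C2 * cmod x ^ (N + 1)"
        using C2(2)[OF hol om] False by (simp add: x_def)
      moreover have "1 + (cmod x)\<^sup>2 \<le> 2 * (cmod x)\<^sup>2" using x1 by simp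
      ultimately have "cmod (deriv f 0) ^ N * (1 + (cmod x)\<^sup>2) ^ M
          \<le> C2 * cmod x ^ (N + 1) * (2 * (cmod x)\<^sup>2) ^ M"
        using C2(1) by (intro mult_mono power_mono) auto
      also have "\<dots> = C2 * 2 ^ M * cmod x ^ (2 * M + N + 1)"
        by (simp add: power_mult_distrib power_add flip: power_mult)
      also have "\<dots> = K2 * ((cmod x / 2) ^ card S) ^ (N - 1)"
        unfolding NM K2_def by (simp add: power_divide flip: power_mult)
      also have "\<dots> \<le> K2 * ?P" using P1 K by (intro mult_left_mono) auto
      also have "\<dots> \<le> (K1 + K2) * ?P" using K P0 by (intro mult_right_mono) auto
      finally show ?thesis .
    qed
    then show "cmod (deriv f 0) ^ N * (1 + (cmod (f 0))\<^sup>2) ^ M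
        \<le> (K1 + K2) * (\<Prod>\<alpha>\<in>S. cmod (f 0 - \<alpha>)) ^ (N - 1)"
      by (simp add: x_def)
  qed
qed

text \<open>
  An estimate of Ahlfors-Schwarz type: it compares the pull-back under \<open>f\<close> of a metric on the complement
  of \<open>S\<close> with \<open>1 / (R - |w|)\<close>. The disc of radius \<open>R - |w|\<close> around \<open>w\<close> is rescaled to the unit disc.
\<close>

lemma deriv_bound_omit_finite_set:
  fixes S :: "complex set" and N M :: nat
  assumes "finite S" "card S \<ge> 2" "N > 0" "2 * M + N + 1 = card S * (N - 1)"
  obtains C where "C > 0"
    "\<And>f R w. f holomorphic_on ball 0 R \<Longrightarrow> f ` ball 0 R \<inter> S = {} \<Longrightarrow> w \<in> ball 0 R \<Longrightarrow>
       cmod (deriv f w) ^ N * (R - cmod w) ^ N * (1 + (cmod (f w))\<^sup>2) ^ M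
         \<le> C * (\<Prod>\<alpha>\<in>S. cmod (f w - \<alpha>)) ^ (N - 1)"
proof -
  obtain C where C: "C > 0"
    "\<And>f. f holomorphic_on ball 0 1 \<Longrightarrow> f ` ball 0 1 \<inter> S = {} \<Longrightarrow>
       cmod (deriv f 0) ^ N * (1 + (cmod (f 0))\<^sup>2) ^ M \<le> C * (\<Prod>\<alpha>\<in>S. cmod (f 0 - \<alpha>)) ^ (N - 1)"
    using deriv_bound_unit_ball_omit_finite_set[OF assms] by blast
  show ?thesis
  proof (rule that[OF C(1)])
    fix f :: "complex \<Rightarrow> complex" and R and w :: complex
    assume hol: "f holomorphic_on ball 0 R" and om: "f ` ball 0 R \<inter> S = {}" and w: "w \<in> ball 0 R"
    define d where "d = R - cmod w"
    have d: "d > 0" using w by (simp add: d_def)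
    define h where "h z = f (w + of_real d * z)" for z
    have sub: "(\<lambda>z. w + of_real d * z) ` ball 0 1 \<subseteq> ball 0 R"
    proof clarsimp
      fix z assume "cmod z < 1"
      then have "cmod (of_real d * z) < d" using d by (simp add: norm_mult)
      then show "cmod (w + of_real d * z) < R"
        using norm_triangle_ineq[of w "of_real d * z"] by (simp add: d_def)
    qed
    have "h holomorphic_on ball 0 1"
      unfolding h_def by (intro holomorphic_on_compose_gen[OF _ hol sub, unfolded o_def] holomorphic_intros)
    moreover have "h ` ball 0 1 \<inter> S = {}" using om sub by (auto simp: h_def)
    ultimately have "cmod (deriv h 0) ^ N * (1 + (cmod (h 0))\<^sup>2) ^ M
        \<le> C * (\<Prod>\<alpha>\<in>S. cmod (h 0 - \<alpha>)) ^ (N - 1)"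
      by (rule C(2))
    moreover have "deriv h 0 = deriv f w * of_real d"
    proof -
      have "(f has_field_derivative deriv f w) (at (w + of_real d * 0))"
        using holomorphic_derivI[OF hol open_ball w] by simp
      then have "(h has_field_derivative deriv f w * of_real d) (at 0)"
        unfolding h_def by (rule DERIV_chain2) (auto intro!: derivative_eq_intros)
      then show ?thesis by (rule DERIV_imp_deriv)
    qed
    ultimately show "cmod (deriv f w) ^ N * (R - cmod w) ^ N * (1 + (cmod (f w))\<^sup>2) ^ M
         \<le> C * (\<Prod>\<alpha>\<in>S. cmod (f w - \<alpha>)) ^ (N - 1)"
      using d by (simp add: h_def norm_mult power_mult_distrib flip: d_def)
  qed
qed

section \<open>Holomorphic differential equations\<close>

lemma holomorphic_imp_lipschitz_near:
  fixes v :: "complex \<Rightarrow> complex"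
  assumes v: "v holomorphic_on ball z0 r" and r: "r > 0"
  obtains s B where "0 < s" "cball z0 s \<subseteq> ball z0 r" "B > 0"
    "\<And>z. z \<in> cball z0 s \<Longrightarrow> cmod (v z) \<le> B"
    "\<And>x y. x \<in> cball z0 s \<Longrightarrow> y \<in> cball z0 s \<Longrightarrow> cmod (v x - v y) \<le> B * cmod (x - y)"
proof -
  define s where "s = r / 2"
  have s: "0 < s" "cball z0 s \<subseteq> ball z0 r" using r by (auto simp: s_def)
  have "compact (v ` cball z0 s)"
    using v s by (intro compact_continuous_image continuous_on_subset[OF holomorphic_on_imp_continuous_on[OF v]]) auto
  then obtain B1 where B1: "\<And>z. z \<in> cball z0 s \<Longrightarrow> cmod (v z) \<le> B1"
    using compact_imp_bounded bounded_iff by (metis imageI)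
  have "compact (deriv v ` cball z0 s)"
    using v s by (intro compact_continuous_image continuous_on_subset[OF holomorphic_on_imp_continuous_on[OF holomorphic_deriv[OF v]]]) auto
  then obtain B2 where B2: "\<And>z. z \<in> cball z0 s \<Longrightarrow> cmod (deriv v z) \<le> B2"
    using compact_imp_bounded bounded_iff by (metis imageI)
  define B where "B = max 1 (max B1 B2)"
  show ?thesis
  proof (rule that[OF s])
    show "B > 0" by (simp add: B_def)
    show "cmod (v z) \<le> B" if "z \<in> cball z0 s" for z using B1[OF that] by (simp add: B_def)
    show "cmod (v x - v y) \<le> B * cmod (x - y)" if "x \<in> cball z0 s" "y \<in> cball z0 s" for x y
    proof (rule field_differentiable_bound[of "cball z0 s" v "deriv v"])
      fix z assume z: "z \<in> cball z0 s"
      show "(v has_field_derivative deriv v z) (at z within cball z0 s)"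
        using holomorphic_derivI[OF v open_ball] z s by blast
      show "cmod (deriv v z) \<le> B" using B2[OF z] by (simp add: B_def)
    qed (use that in auto)
  qed
qed

lemma holomorphic_primitive_on_ball:
  fixes f :: "complex \<Rightarrow> complex"
  assumes "f holomorphic_on ball 0 \<epsilon>" "\<epsilon> > 0"
  shows "\<exists>F. F 0 = \<zeta> \<and> (\<forall>w\<in>ball 0 \<epsilon>. (F has_field_derivative f w) (at w))"
proof -
  obtain F where F: "\<And>x. x \<in> ball 0 \<epsilon> \<Longrightarrow> (F has_field_derivative f x) (at x within ball 0 \<epsilon>)"
    using holomorphic_convex_primitive'[OF convex_ball open_ball assms(1)] by metis
  show ?thesis
  proof (intro exI[of _ "\<lambda>w. F w - F 0 + \<zeta>"] conjI ballI)
    fix w :: complex assume "w \<in> ball 0 \<epsilon>"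
    then have "(F has_field_derivative f w) (at w)"
      using F[of w] at_within_open[of w "ball 0 \<epsilon>"] by simp
    then show "((\<lambda>w. F w - F 0 + \<zeta>) has_field_derivative f w) (at w)"
      by (auto intro!: derivative_eq_intros)
  qed simp
qed

text \<open>
  Picard iteration. The radius \<open>\<epsilon>\<close> depends only on bounds for \<open>v\<close> near \<open>z0\<close>, and so it serves all initial
  values near \<open>z0\<close>. This uniformity, which also holds at zeros of \<open>v\<close>, is what makes it possible to
  continue a solution from points that merely converge to \<open>z0\<close>.
\<close>

theorem complex_ode_local_existence:
  fixes v :: "complex \<Rightarrow> complex"
  assumes v: "v holomorphic_on ball z0 r" and r: "r > 0"
  obtains \<epsilon> where "\<epsilon> > 0"
    "\<And>\<zeta>. \<zeta> \<in> ball z0 \<epsilon> \<Longrightarrow> \<exists>\<Psi>. \<Psi> 0 = \<zeta> \<and> \<Psi> ` ball 0 \<epsilon> \<subseteq> ball z0 r \<and>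
        (\<forall>w\<in>ball 0 \<epsilon>. (\<Psi> has_field_derivative v (\<Psi> w)) (at w))"
proof -
  obtain s B where s: "0 < s" "cball z0 s \<subseteq> ball z0 r" "B > 0"
    and vB: "\<And>z. z \<in> cball z0 s \<Longrightarrow> cmod (v z) \<le> B"
    and vL: "\<And>x y. x \<in> cball z0 s \<Longrightarrow> y \<in> cball z0 s \<Longrightarrow> cmod (v x - v y) \<le> B * cmod (x - y)"
    using holomorphic_imp_lipschitz_near[OF v r] by metis
  define \<epsilon> where "\<epsilon> = min (s / 2) (min (s / (2 * B)) (1 / (2 * B)))"
  have \<epsilon>: "\<epsilon> > 0" "\<epsilon> \<le> s / 2" using s by (auto simp: \<epsilon>_def)
  have "\<epsilon> \<le> s / (2 * B)" "\<epsilon> \<le> 1 / (2 * B)" by (auto simp: \<epsilon>_def)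
  then have B\<epsilon>: "B * \<epsilon> \<le> s / 2" "B * \<epsilon> \<le> 1 / 2" using s(3) by (auto simp: field_simps)
  show ?thesis
  proof (rule that[OF \<epsilon>(1)])
    fix \<zeta> assume \<zeta>: "\<zeta> \<in> ball z0 \<epsilon>"
    let ?D = "ball (0::complex) \<epsilon>"
    define good where "good F \<longleftrightarrow> F holomorphic_on ?D \<and> F ` ?D \<subseteq> cball z0 s" for F :: "complex \<Rightarrow> complex"
    have holv: "(\<lambda>w. v (F w)) holomorphic_on ?D" if "good F" for F
      using that holomorphic_on_compose_gen[of F ?D v "cball z0 s"] holomorphic_on_subset[OF v s(2)]
      by (auto simp: good_def o_def)
    define P where "P F = (SOME H. H 0 = \<zeta> \<and> (\<forall>w\<in>?D. (H has_field_derivative v (F w)) (at w)))" for F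
    have "P F 0 = \<zeta> \<and> (\<forall>w\<in>?D. (P F has_field_derivative v (F w)) (at w))" if "good F" for F
      unfolding P_def
      using someI_ex[OF holomorphic_primitive_on_ball[OF holv[OF that] \<epsilon>(1), of \<zeta>]] .
    then have P0: "\<And>F. good F \<Longrightarrow> P F 0 = \<zeta>"
      and P: "\<And>F w. good F \<Longrightarrow> w \<in> ?D \<Longrightarrow> (P F has_field_derivative v (F w)) (at w)" by blast+
    \<comment> \<open>\<open>P\<close> is the Picard operator, and \<open>good\<close> describes a set of functions that it maps to itself.\<close>
    have goodP: "good (P F)" if F: "good F" for F
      unfolding good_def
    proof
      show "P F holomorphic_on ?D"
        using P[OF F] holomorphic_on_open[OF open_ball] by blast
      show "P F ` ?D \<subseteq> cball z0 s"
      proof clarify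
        fix w assume w: "w \<in> ?D"
        have "cmod (P F w - P F 0) \<le> B * cmod (w - 0)"
          using P[OF F] vB F w \<epsilon>
          by (intro field_differentiable_bound[of ?D "P F" "\<lambda>w. v (F w)"])
            (auto simp: good_def image_subset_iff intro: has_field_derivative_at_within)
        also have "\<dots> \<le> B * \<epsilon>" using w s by (intro mult_left_mono) auto
        finally have "cmod (P F w - \<zeta>) \<le> s / 2" using B\<epsilon>(1) P0[OF F] by simp
        moreover have "cmod (\<zeta> - z0) \<le> s / 2" using \<zeta> \<epsilon>(2) by (simp add: dist_norm norm_minus_commute)
        ultimately show "P F w \<in> cball z0 s"
          using norm_triangle_ineq[of "P F w - \<zeta>" "\<zeta> - z0"] by (simp add: dist_norm norm_minus_commute)
      qed
    qed
    have contr: "cmod (P F w - P G w) \<le> K / 2"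
      if F: "good F" and G: "good G" and K: "\<And>w. w \<in> ?D \<Longrightarrow> cmod (F w - G w) \<le> K" and w: "w \<in> ?D"
      for F G K w
    proof -
      have "cmod (F 0 - G 0) \<le> K" using K[of 0] \<epsilon>(1) by simp
      then have K0: "K \<ge> 0" using norm_ge_zero order_trans by blast
      have "cmod ((P F w - P G w) - (P F 0 - P G 0)) \<le> (B * K) * cmod (w - 0)"
      proof (rule field_differentiable_bound[of ?D "\<lambda>w. P F w - P G w" "\<lambda>w. v (F w) - v (G w)"])
        fix z assume z: "z \<in> ?D"
        show "((\<lambda>w. P F w - P G w) has_field_derivative v (F z) - v (G z)) (at z within ?D)"
          using P[OF F z] P[OF G z] by (auto intro!: derivative_intros intro: has_field_derivative_at_within)
        have "cmod (v (F z) - v (G z)) \<le> B * cmod (F z - G z)"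
          using F G z by (intro vL) (auto simp: good_def image_subset_iff)
        also have "\<dots> \<le> B * K" using K[OF z] s by (intro mult_left_mono) auto
        finally show "cmod (v (F z) - v (G z)) \<le> B * K" .
      qed (use w \<epsilon> in auto)
      also have "\<dots> \<le> (B * K) * \<epsilon>" using w s K0 by (intro mult_left_mono) auto
      also have "\<dots> = (B * \<epsilon>) * K" by simp
      also have "\<dots> \<le> 1 / 2 * K" using B\<epsilon>(2) K0 by (intro mult_right_mono) auto
      finally show ?thesis using P0[OF F] P0[OF G] by simp
    qed
    define u where "u n = (P ^^ n) (\<lambda>_. \<zeta>)" for n
    have u0: "good (u 0)"
      using \<zeta> \<epsilon> s by (auto simp: u_def good_def)
    have uS: "u (Suc n) = P (u n)" for n by (simp add: u_def)
    have gu: "good (u n)" for n by (induction n) (auto simp: u0 uS goodP)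
    have step: "cmod (u (Suc n) w - u n w) \<le> 2 * s * (1 / 2) ^ n" if "w \<in> ?D" for n w
      using that
    proof (induction n arbitrary: w)
      case 0
      have "u (Suc 0) w \<in> cball z0 s" "u 0 w \<in> cball z0 s"
        using gu[of "Suc 0"] gu[of 0] 0 by (auto simp: good_def image_subset_iff)
      then show ?case
        using dist_triangle2[of "u (Suc 0) w" "u 0 w" z0] by (simp add: dist_norm norm_minus_commute)
    next
      case (Suc n)
      then show ?case
        using contr[OF gu[of "Suc n"] gu[of n], of "2 * s * (1 / 2) ^ n" w] by (simp add: uS)
    qed
    have unif: "uniformly_convergent_on ?D u"
    proof -
      have "uniformly_convergent_on ?D (\<lambda>n w. \<Sum>i<n. u (Suc i) w - u i w)"
        using step by (intro Weierstrass_m_test'[where M = "\<lambda>n. 2 * s * (1 / 2) ^ n"] summable_mult summable_geometric) auto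
      then have "uniformly_convergent_on ?D (\<lambda>n w. (\<Sum>i<n. u (Suc i) w - u i w) + u 0 w)"
        by (rule uniformly_convergent_add) (auto simp: uniformly_convergent_on_def intro: uniform_limit_const)
      moreover have "(\<Sum>i<n. u (Suc i) w - u i w) + u 0 w = u n w" for n w
        using sum_lessThan_telescope[of "\<lambda>i. u i w" n] by simp
      ultimately show ?thesis by simp
    qed
    then obtain \<Psi> where \<Psi>: "uniform_limit ?D u \<Psi> sequentially"
      by (auto simp: uniformly_convergent_on_def)
    have lim: "(\<lambda>n. u n w) \<longlonglongrightarrow> \<Psi> w" if "w \<in> ?D" for w
      using tendsto_uniform_limitI[OF \<Psi> that] .
    have \<Psi>s: "\<Psi> w \<in> cball z0 s" if "w \<in> ?D" for w
      by (rule Lim_in_closed_set[OF closed_cball _ _ lim[OF that]])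
        (use gu that in \<open>auto simp: good_def image_subset_iff\<close>)
    show "\<exists>\<Psi>. \<Psi> 0 = \<zeta> \<and> \<Psi> ` ?D \<subseteq> ball z0 r \<and>
        (\<forall>w\<in>?D. (\<Psi> has_field_derivative v (\<Psi> w)) (at w))"
    proof (intro exI[of _ \<Psi>] conjI ballI)
      have "u n 0 = \<zeta>" for n
        by (cases n) (auto simp: uS P0[OF gu] u_def[of 0])
      then show "\<Psi> 0 = \<zeta>" using lim[of 0] \<epsilon>(1) LIMSEQ_unique[OF _ tendsto_const] by simp
      show "\<Psi> ` ?D \<subseteq> ball z0 r" using \<Psi>s s(2) by blast
    next
      fix w assume w: "w \<in> ?D"
      have "\<exists>g'. \<forall>x\<in>?D. (\<Psi> has_field_derivative g' x) (at x) \<and> ((\<lambda>n. v (u n x)) \<longlonglongrightarrow> g' x)"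
      proof (rule has_complex_derivative_uniform_sequence[of ?D "\<lambda>n. u (Suc n)"])
        show "(u (Suc n) has_field_derivative v (u n x)) (at x)" if "x \<in> ?D" for n x
          unfolding uS by (rule P[OF gu that])
        show "\<exists>d>0. cball x d \<subseteq> ?D \<and> uniform_limit (cball x d) (\<lambda>n. u (Suc n)) \<Psi> sequentially"
          if x: "x \<in> ?D" for x
        proof -
          obtain d where d: "d > 0" "cball x d \<subseteq> ?D" using open_contains_cball[of ?D] x by (meson open_ball)
          have "uniform_limit ?D (\<lambda>n. u (Suc n)) \<Psi> sequentially"
            by (rule filterlim_compose[OF \<Psi> filterlim_Suc])
          then show ?thesis using d uniform_limit_on_subset by blast
        qed
      qed simp
      then obtain y where y: "(\<Psi> has_field_derivative y) (at w)" "(\<lambda>n. v (u n w)) \<longlonglongrightarrow> y"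
        using w by blast
      have "isCont v (\<Psi> w)"
        using \<Psi>s[OF w] s(2) holomorphic_on_imp_continuous_on[OF v] continuous_on_eq_continuous_at[OF open_ball]
        by blast
      then have "(\<lambda>n. v (u n w)) \<longlonglongrightarrow> v (\<Psi> w)"
        by (rule isCont_tendsto_compose[OF _ lim[OF w]])
      then show "(\<Psi> has_field_derivative v (\<Psi> w)) (at w)" using y LIMSEQ_unique by blast
    qed
  qed
qed

text \<open>
  On a disc of radius \<open>\<delta>\<close>, the maximum of \<open>|F - G|\<close> is at most \<open>B * \<delta>\<close> times itself, where \<open>B\<close> is a
  Lipschitz constant of \<open>v\<close>.
\<close>

theorem complex_ode_local_uniqueness:
  fixes v F G :: "complex \<Rightarrow> complex"
  assumes v: "v holomorphic_on U" "open U"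
    and F: "\<forall>\<^sub>F w in nhds a. F w \<in> U \<and> (F has_field_derivative v (F w)) (at w)"
    and G: "\<forall>\<^sub>F w in nhds a. G w \<in> U \<and> (G has_field_derivative v (G w)) (at w)"
    and eq: "F a = G a"
  shows "\<forall>\<^sub>F w in nhds a. F w = G w"
proof -
  define z0 where "z0 = F a"
  have "z0 \<in> U" using F eventually_nhds_x_imp_x z0_def by blast
  then obtain r where r: "r > 0" "ball z0 r \<subseteq> U" using v(2) openE by blast
  obtain s B where s: "0 < s" "cball z0 s \<subseteq> ball z0 r" "B > 0"
    and vL: "\<And>x y. x \<in> cball z0 s \<Longrightarrow> y \<in> cball z0 s \<Longrightarrow> cmod (v x - v y) \<le> B * cmod (x - y)"
    using holomorphic_imp_lipschitz_near[OF holomorphic_on_subset[OF v(1) r(2)] r(1)] by metis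
  have near: "\<forall>\<^sub>F w in nhds a. H w \<in> cball z0 s"
    if "\<forall>\<^sub>F w in nhds a. H w \<in> U \<and> (H has_field_derivative v (H w)) (at w)" "H a = z0" for H
  proof -
    have "isCont H a" using that eventually_nhds_x_imp_x DERIV_isCont by blast
    then have "(H \<longlongrightarrow> z0) (nhds a)" using that(2) by (simp add: isCont_def tendsto_nhds_iff)
    then have "\<forall>\<^sub>F w in nhds a. H w \<in> ball z0 s" using s by (intro topological_tendstoD) auto
    then show ?thesis by eventually_elim auto
  qed
  have "\<forall>\<^sub>F w in nhds a. F w \<in> cball z0 s \<and> G w \<in> cball z0 s \<and>
      (F has_field_derivative v (F w)) (at w) \<and> (G has_field_derivative v (G w)) (at w)"
    using F G near[OF F] near[OF G] eq by (auto simp: z0_def eventually_conj_iff elim: eventually_mono)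
  then obtain \<delta>0 where \<delta>0: "\<delta>0 > 0"
    and ev: "\<And>w. dist w a < \<delta>0 \<Longrightarrow> F w \<in> cball z0 s \<and> G w \<in> cball z0 s \<and>
      (F has_field_derivative v (F w)) (at w) \<and> (G has_field_derivative v (G w)) (at w)"
    unfolding eventually_nhds_metric by blast
  define \<delta> where "\<delta> = min (\<delta>0 / 2) (1 / (2 * B))"
  have \<delta>: "\<delta> > 0" "\<delta> < \<delta>0" "B * \<delta> \<le> 1 / 2"
    using \<delta>0 s by (auto simp: \<delta>_def min_def field_simps)
  have evc: "F w \<in> cball z0 s \<and> G w \<in> cball z0 s \<and>
      (F has_field_derivative v (F w)) (at w) \<and> (G has_field_derivative v (G w)) (at w)"
    if "w \<in> cball a \<delta>" for w
    using ev[of w] that \<delta> by (auto simp: dist_commute)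
  have "continuous_on (cball a \<delta>) (\<lambda>w. cmod (F w - G w))"
    using evc by (intro continuous_intros continuous_at_imp_continuous_on ballI DERIV_isCont) auto
  then obtain x where x: "x \<in> cball a \<delta>" and max: "\<And>w. w \<in> cball a \<delta> \<Longrightarrow> cmod (F w - G w) \<le> cmod (F x - G x)"
    using continuous_attains_sup[of "cball a \<delta>" "\<lambda>w. cmod (F w - G w)"] \<delta>(1) by auto
  let ?K = "cmod (F x - G x)"
  have "cmod ((F x - G x) - (F a - G a)) \<le> (B * ?K) * cmod (x - a)"
  proof (rule field_differentiable_bound[of "cball a \<delta>" "\<lambda>w. F w - G w" "\<lambda>w. v (F w) - v (G w)"])
    fix z assume z: "z \<in> cball a \<delta>"
    show "((\<lambda>w. F w - G w) has_field_derivative v (F z) - v (G z)) (at z within cball a \<delta>)"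
      using evc[OF z] by (auto intro!: derivative_intros intro: has_field_derivative_at_within)
    have "cmod (v (F z) - v (G z)) \<le> B * cmod (F z - G z)"
      using evc[OF z] by (intro vL) auto
    also have "\<dots> \<le> B * ?K" using max[OF z] s by (intro mult_left_mono) auto
    finally show "cmod (v (F z) - v (G z)) \<le> B * ?K" .
  qed (use x \<delta> in auto)
  also have "\<dots> \<le> (B * ?K) * \<delta>" using x s by (intro mult_left_mono) (auto simp: dist_norm norm_minus_commute)
  also have "\<dots> = (B * \<delta>) * ?K" by simp
  also have "\<dots> \<le> 1 / 2 * ?K" using \<delta>(3) by (intro mult_right_mono) auto
  finally have "?K = 0" using eq by simp
  then have "F w = G w" if "dist w a < \<delta>" for w
    using max[of w] that by (auto simp: dist_commute)
  then show ?thesis unfolding eventually_nhds_metric using \<delta>(1) by blast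
qed

section \<open>Integrals of functions that need not be measurable\<close>

text \<open>
  The speed of a path is computed in a chart that is chosen for each time separately, so its
  measurability is not apparent. But the nonnegative integral of any function is the supremum of the
  integrals of its measurable minorants, and this yields subadditivity and affine substitution for
  arbitrary functions.
\<close>

lemma nn_integral_le_if_measurable_minorants_le:
  assumes "\<And>g. g \<in> borel_measurable M \<Longrightarrow> (\<And>x. g x \<le> f x) \<Longrightarrow> (\<integral>\<^sup>+x. g x \<partial>M) \<le> b"
  shows "(\<integral>\<^sup>+x. f x \<partial>M) \<le> b"
  unfolding nn_integral_def
proof (rule SUP_least)
  fix g assume g: "g \<in> {g. simple_function M g \<and> g \<le> f}"
  then have "integral\<^sup>S M g = (\<integral>\<^sup>+x. g x \<partial>M)" by (simp add: nn_integral_eq_simple_integral)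
  also have "\<dots> \<le> b"
    using g by (intro assms) (auto simp: le_fun_def intro: borel_measurable_simple_function)
  finally show "integral\<^sup>S M g \<le> b" .
qed

lemma nn_integral_subadditive_cover:
  fixes f :: "'a \<Rightarrow> ennreal"
  assumes "A \<in> sets M" "B \<in> sets M" "C \<subseteq> A \<union> B"
  shows "(\<integral>\<^sup>+x\<in>C. f x \<partial>M) \<le> (\<integral>\<^sup>+x\<in>A. f x \<partial>M) + (\<integral>\<^sup>+x\<in>B. f x \<partial>M)"
proof (rule nn_integral_le_if_measurable_minorants_le)
  fix g :: "'a \<Rightarrow> ennreal" assume g: "g \<in> borel_measurable M" "\<And>x. g x \<le> f x * indicator C x"
  have "(\<integral>\<^sup>+x. g x \<partial>M) \<le> (\<integral>\<^sup>+x. g x * indicator A x + g x * indicator B x \<partial>M)"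
  proof (rule nn_integral_mono)
    fix x show "g x \<le> g x * indicator A x + g x * indicator B x"
      using g(2)[of x] assms(3) by (cases "x \<in> C"; cases "x \<in> A"; cases "x \<in> B") auto
  qed
  also have "\<dots> = (\<integral>\<^sup>+x\<in>A. g x \<partial>M) + (\<integral>\<^sup>+x\<in>B. g x \<partial>M)"
    using g(1) assms(1,2) by (intro nn_integral_add) auto
  also have "\<dots> \<le> (\<integral>\<^sup>+x\<in>A. f x \<partial>M) + (\<integral>\<^sup>+x\<in>B. f x \<partial>M)"
  proof -
    have "g x \<le> f x" for x
      using g(2)[of x] by (cases "x \<in> C") auto
    then show ?thesis by (intro add_mono nn_integral_mono mult_right_mono) auto
  qed
  finally show "(\<integral>\<^sup>+x. g x \<partial>M) \<le> (\<integral>\<^sup>+x\<in>A. f x \<partial>M) + (\<integral>\<^sup>+x\<in>B. f x \<partial>M)" .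
qed

lemma nn_integral_real_affine_le:
  fixes f :: "real \<Rightarrow> ennreal" and c t :: real
  assumes c: "c \<noteq> 0"
  shows "(\<integral>\<^sup>+x. f x \<partial>lborel) \<le> ennreal \<bar>c\<bar> * (\<integral>\<^sup>+x. f (t + c * x) \<partial>lborel)"
proof (rule nn_integral_le_if_measurable_minorants_le)
  fix g :: "real \<Rightarrow> ennreal" assume g: "g \<in> borel_measurable lborel" "\<And>x. g x \<le> f x"
  then have "(\<integral>\<^sup>+x. g x \<partial>lborel) = ennreal \<bar>c\<bar> * (\<integral>\<^sup>+x. g (t + c * x) \<partial>lborel)"
    using c by (intro nn_integral_real_affine) auto
  also have "\<dots> \<le> ennreal \<bar>c\<bar> * (\<integral>\<^sup>+x. f (t + c * x) \<partial>lborel)"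
    using g(2) by (intro mult_left_mono nn_integral_mono) auto
  finally show "(\<integral>\<^sup>+x. g x \<partial>lborel) \<le> ennreal \<bar>c\<bar> * (\<integral>\<^sup>+x. f (t + c * x) \<partial>lborel)" .
qed

lemma nn_integral_real_affine_ge:
  fixes f :: "real \<Rightarrow> ennreal" and c t :: real
  assumes c: "c \<noteq> 0"
  shows "ennreal \<bar>c\<bar> * (\<integral>\<^sup>+x. f (t + c * x) \<partial>lborel) \<le> (\<integral>\<^sup>+x. f x \<partial>lborel)"
proof -
  have "(\<integral>\<^sup>+x. f (t + c * x) \<partial>lborel) \<le> ennreal \<bar>1 / c\<bar> * (\<integral>\<^sup>+x. f (t + c * (- t / c + 1 / c * x)) \<partial>lborel)"
    by (rule nn_integral_real_affine_le[of "1 / c" "\<lambda>x. f (t + c * x)" "- t / c"]) (use c in auto)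
  also have "(\<lambda>x. f (t + c * (- t / c + 1 / c * x))) = f"
    using c by (auto simp: field_simps)
  finally have "ennreal \<bar>c\<bar> * (\<integral>\<^sup>+x. f (t + c * x) \<partial>lborel) \<le> ennreal \<bar>c\<bar> * (ennreal \<bar>1 / c\<bar> * (\<integral>\<^sup>+x. f x \<partial>lborel))"
    by (rule mult_left_mono) auto
  also have "\<dots> = (ennreal \<bar>c\<bar> * ennreal \<bar>1 / c\<bar>) * (\<integral>\<^sup>+x. f x \<partial>lborel)"
    by (simp only: mult.assoc)
  also have "ennreal \<bar>c\<bar> * ennreal \<bar>1 / c\<bar> = 1"
    using c by (simp flip: ennreal_mult)
  finally show ?thesis by simp
qed

lemma nn_integral_cmult_pos:
  fixes f :: "'a \<Rightarrow> ennreal" and a :: real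
  assumes a: "a > 0"
  shows "(\<integral>\<^sup>+x. ennreal a * f x \<partial>M) = ennreal a * (\<integral>\<^sup>+x. f x \<partial>M)"
proof -
  have le: "(\<integral>\<^sup>+x. ennreal b * h x \<partial>M) \<le> ennreal b * (\<integral>\<^sup>+x. h x \<partial>M)"
    if b: "b > 0" for b :: real and h :: "'a \<Rightarrow> ennreal"
  proof (rule nn_integral_le_if_measurable_minorants_le)
    have inv: "ennreal b * ennreal (1 / b) = 1" using b by (simp flip: ennreal_mult)
    fix g :: "'a \<Rightarrow> ennreal" assume g: "g \<in> borel_measurable M" "\<And>x. g x \<le> ennreal b * h x"
    have "(\<integral>\<^sup>+x. g x \<partial>M) = (\<integral>\<^sup>+x. ennreal b * (ennreal (1 / b) * g x) \<partial>M)"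
      by (simp only: inv mult.assoc[symmetric] mult_1)
    also have "\<dots> = ennreal b * (\<integral>\<^sup>+x. ennreal (1 / b) * g x \<partial>M)"
      using g(1) by (intro nn_integral_cmult) auto
    also have "\<dots> \<le> ennreal b * (\<integral>\<^sup>+x. h x \<partial>M)"
    proof (intro mult_left_mono nn_integral_mono)
      fix x
      have "ennreal (1 / b) * g x \<le> ennreal (1 / b) * (ennreal b * h x)"
        using g(2) by (intro mult_left_mono) auto
      also have "\<dots> = h x" using inv by (simp only: mult.assoc[symmetric] mult.commute[of "ennreal (1 / b)"] mult_1)
      finally show "ennreal (1 / b) * g x \<le> h x" .
    qed auto
    finally show "(\<integral>\<^sup>+x. g x \<partial>M) \<le> ennreal b * (\<integral>\<^sup>+x. h x \<partial>M)" .
  qed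
  show ?thesis
  proof (rule antisym[OF le[OF a]])
    have inv: "ennreal a * ennreal (1 / a) = 1" using a by (simp flip: ennreal_mult)
    have "(\<integral>\<^sup>+x. f x \<partial>M) = (\<integral>\<^sup>+x. ennreal (1 / a) * (ennreal a * f x) \<partial>M)"
      using inv by (simp only: mult.assoc[symmetric] mult.commute[of "ennreal (1 / a)"] mult_1)
    also have "\<dots> \<le> ennreal (1 / a) * (\<integral>\<^sup>+x. ennreal a * f x \<partial>M)"
      using a by (intro le) auto
    finally have "ennreal a * (\<integral>\<^sup>+x. f x \<partial>M) \<le> ennreal a * (ennreal (1 / a) * (\<integral>\<^sup>+x. ennreal a * f x \<partial>M))"
      by (rule mult_left_mono) auto
    then show "ennreal a * (\<integral>\<^sup>+x. f x \<partial>M) \<le> (\<integral>\<^sup>+x. ennreal a * f x \<partial>M)"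
      using inv by (simp only: mult.assoc[symmetric] mult_1)
  qed
qed

text \<open>
  The derivative may be unbounded near the exceptional points, but it is gauge integrable by the
  fundamental theorem of calculus, and therefore Lebesgue measurable. If the integral on the right is
  finite, then the gauge integral is a Lebesgue integral and the triangle inequality for integrals
  applies.
\<close>

lemma displacement_le_nn_integral_speed:
  fixes f :: "real \<Rightarrow> complex"
  assumes ab: "a \<le> b" and cont: "continuous_on {a..b} f" and S: "finite S"
    and der: "\<And>t. t \<in> {a<..<b} - S \<Longrightarrow> (f has_vector_derivative f' t) (at t)"
  shows "ennreal (cmod (f b - f a)) \<le> (\<integral>\<^sup>+t\<in>{a..b}. ennreal (cmod (f' t)) \<partial>lborel)"
proof (cases "(\<integral>\<^sup>+t\<in>{a..b}. ennreal (cmod (f' t)) \<partial>lborel) = \<infinity>")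
  case False
  have int: "(f' has_integral (f b - f a)) {a..b}"
    using fundamental_theorem_of_calculus_interior_strong[OF S ab der cont] by simp
  then have meas: "(\<lambda>t. indicator {a..b} t *\<^sub>R f' t) \<in> borel_measurable lebesgue"
    using has_integral_implies_lebesgue_measurable by blast
  have nn: "(\<integral>\<^sup>+t. ennreal (norm (indicator {a..b} t *\<^sub>R f' t)) \<partial>lebesgue)
      = (\<integral>\<^sup>+t\<in>{a..b}. ennreal (cmod (f' t)) \<partial>lborel)"
    unfolding nn_integral_completion by (intro nn_integral_cong) (auto simp: indicator_def)
  have si: "set_integrable lebesgue {a..b} f'"
    unfolding set_integrable_def
    using meas nn False by (intro integrableI_bounded) (auto simp: top.not_eq_extremum)
  have "f b - f a = integral {a..b} f'" using int by (simp add: integral_unique)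
  also have "\<dots> = (LINT t:{a..b}|lebesgue. f' t)"
    using si by (simp add: set_lebesgue_integral_eq_integral)
  finally have "ennreal (cmod (f b - f a)) = ennreal (cmod (LINT t:{a..b}|lebesgue. f' t))" by simp
  also have "\<dots> \<le> (\<integral>\<^sup>+t. ennreal (norm (indicator {a..b} t *\<^sub>R f' t)) \<partial>lebesgue)"
    unfolding set_lebesgue_integral_def
    by (rule integral_norm_bound_ennreal) (use si in \<open>simp add: set_integrable_def\<close>)
  finally show ?thesis unfolding nn .
qed simp

section \<open>Charts, paths and holomorphic curves\<close>

text \<open>
  Changing \<open>f\<close> outside the interval can destroy the derivatives at the two endpoints, which therefore
  join the exceptional set.
\<close>

lemma piecewise_C1_differentiable_on_cong:
  fixes f g :: "real \<Rightarrow> 'b::real_normed_vector"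
  assumes f: "f piecewise_C1_differentiable_on {a..b}" and eq: "\<And>t. t \<in> {a..b} \<Longrightarrow> f t = g t"
  shows "g piecewise_C1_differentiable_on {a..b}"
proof -
  obtain S where S: "finite S" "f C1_differentiable_on ({a..b} - S)"
    using f by (auto simp: piecewise_C1_differentiable_on_def)
  then obtain D where D: "\<And>t. t \<in> {a..b} - S \<Longrightarrow> (f has_vector_derivative D t) (at t)"
    and cont: "continuous_on ({a..b} - S) D"
    unfolding C1_differentiable_on_def by blast
  have "continuous_on {a..b} g"
    using f eq by (auto simp: piecewise_C1_differentiable_on_def intro: continuous_on_eq)
  moreover have "g C1_differentiable_on ({a..b} - (S \<union> {a, b}))"
    unfolding C1_differentiable_on_def
  proof (intro exI[of _ D] conjI ballI)
    fix t assume t: "t \<in> {a..b} - (S \<union> {a, b})"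
    show "(g has_vector_derivative D t) (at t)"
      by (rule has_vector_derivative_transform_within_open[OF D, where S="{a<..<b}"]) (use t eq in auto)
  qed (use cont in \<open>auto intro: continuous_on_subset\<close>)
  ultimately show ?thesis
    unfolding piecewise_C1_differentiable_on_def using S by (meson finite.emptyI finite_Un finite_insert)
qed

lemma has_derivative_transform_nhds:
  assumes "(f has_derivative D) (at x)" "\<forall>\<^sub>F y in nhds x. f y = g y"
  shows "(g has_derivative D) (at x)"
  using has_derivative_transform_eventually[of f D x UNIV g] assms by (simp add: eventually_nhds_conv_at)

locale riemann =
  fixes X :: "'a topology" and A :: "'a chart set"
  assumes riemann_surface: "riemann_surface X A"
begin

lemma Hausdorff: "Hausdorff_space X"
  using riemann_surface by (simp add: riemann_surface_def)

lemma ex_chart: "p \<in> topspace X \<Longrightarrow> \<exists>c\<in>A. p \<in> fst c"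
  using riemann_surface unfolding riemann_surface_def by blast

context
  fixes c assumes c: "c \<in> A"
begin

lemma chart: "openin X (fst c)" "open (snd c ` fst c)"
    "homeomorphic_map (subtopology X (fst c)) (top_of_set (snd c ` fst c)) (snd c)"
  using riemann_surface c by (auto simp: riemann_surface_def chart_of_def case_prod_unfold)

lemma chart_topspace: "p \<in> fst c \<Longrightarrow> p \<in> topspace X"
  using chart(1) openin_subset by blast

lemma chart_inj: "inj_on (snd c) (fst c)"
  using homeomorphic_imp_injective_map[OF chart(3)] openin_subset[OF chart(1)]
  by (simp add: Int_absorb1)

lemma chart_inv_in: "z \<in> snd c ` fst c \<Longrightarrow> chart_inv c z \<in> fst c"
  and chart_chart_inv: "z \<in> snd c ` fst c \<Longrightarrow> snd c (chart_inv c z) = z"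
  and chart_inv_chart: "p \<in> fst c \<Longrightarrow> chart_inv c (snd c p) = p"
  using chart_inj by (auto simp: chart_inv_def inv_into_into f_inv_into_f)

lemma continuous_map_chart: "continuous_map (subtopology X (fst c)) euclidean (snd c)"
  using homeomorphic_imp_continuous_map[OF chart(3)] by (simp add: continuous_map_in_subtopology)

lemma open_chart_image:
  assumes "openin X V" "V \<subseteq> fst c"
  shows "open (snd c ` V)"
proof -
  have "openin (subtopology X (fst c)) V"
    using assms by (simp add: openin_open_subtopology chart(1))
  then have "openin (top_of_set (snd c ` fst c)) (snd c ` V)"
    using homeomorphic_imp_open_map[OF chart(3)] by (simp add: open_map_def)
  then show ?thesis using chart(2) by (simp add: openin_open_eq)
qed

lemma openin_chart_vimage:
  assumes "open W"
  shows "openin X {p \<in> fst c. snd c p \<in> W}"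
proof -
  have "openin (subtopology X (fst c)) {p \<in> topspace (subtopology X (fst c)). snd c p \<in> W}"
    using continuous_map_chart assms by (simp add: continuous_map)
  moreover have "{p \<in> topspace (subtopology X (fst c)). snd c p \<in> W} = {p \<in> fst c. snd c p \<in> W}"
    using chart_topspace by auto
  ultimately show ?thesis by (simp add: openin_open_subtopology chart(1))
qed

lemma continuous_map_chart_inv: "continuous_map (top_of_set (snd c ` fst c)) X (chart_inv c)"
proof (clarsimp simp: continuous_map chart_inv_in chart_topspace)
  show "chart_inv c ` snd c ` fst c \<subseteq> topspace X \<and>
    (\<forall>V. openin X V \<longrightarrow> openin (top_of_set (snd c ` fst c)) {z \<in> snd c ` fst c. chart_inv c z \<in> V})"
  proof (intro conjI allI impI)
    show "chart_inv c ` snd c ` fst c \<subseteq> topspace X" using chart_inv_in chart_topspace by blast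
    fix V assume "openin X V"
    then have "open (snd c ` (fst c \<inter> V))" using chart(1) by (intro open_chart_image) auto
    moreover have "{z \<in> snd c ` fst c. chart_inv c z \<in> V} = snd c ` (fst c \<inter> V)"
      using chart_inv_in chart_inv_chart by auto
    ultimately show "openin (top_of_set (snd c ` fst c)) {z \<in> snd c ` fst c. chart_inv c z \<in> V}"
      using chart(2) by (auto simp: openin_open_eq)
  qed
qed

end

lemma transition_chart:
  assumes "c \<in> A" "p \<in> fst c"
  shows "transition c c' (snd c p) = snd c' p"
  using assms by (simp add: transition_def chart_inv_chart)

lemma transition_has_field_derivative:
  assumes "c \<in> A" "c' \<in> A" "p \<in> fst c" "p \<in> fst c'"
  shows "(transition c c' has_field_derivative deriv (transition c c') (snd c p)) (at (snd c p))"
proof (rule holomorphic_derivI)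
  show "transition c c' holomorphic_on (snd c ` (fst c \<inter> fst c'))"
    using riemann_surface assms by (simp add: riemann_surface_def)
  show "open (snd c ` (fst c \<inter> fst c'))"
    using assms by (intro open_chart_image) (auto simp: chart)
qed (use assms in auto)

lemma eventually_in_openin:
  fixes f :: "'b::t2_space \<Rightarrow> 'a"
  assumes c: "c \<in> A" and ev: "\<forall>\<^sub>F y in nhds x. f y \<in> fst c" and cont: "isCont (snd c \<circ> f) x"
    and V: "openin X V" "f x \<in> V"
  shows "\<forall>\<^sub>F y in nhds x. f y \<in> V"
proof -
  have fx: "f x \<in> fst c" using ev eventually_nhds_x_imp_x by blast
  have "open (snd c ` (fst c \<inter> V))" using c V by (intro open_chart_image) (auto simp: chart)
  moreover have "((snd c \<circ> f) \<longlongrightarrow> (snd c \<circ> f) x) (nhds x)"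
    using cont by (simp add: isCont_def tendsto_nhds_iff)
  ultimately have "\<forall>\<^sub>F y in nhds x. (snd c \<circ> f) y \<in> snd c ` (fst c \<inter> V)"
    using fx V topological_tendstoD[of "snd c \<circ> f"] by (metis IntI comp_apply image_eqI)
  with ev show ?thesis
    by eventually_elim (use chart_inj[OF c] in \<open>auto dest: inj_onD\<close>)
qed

text \<open>
  Stated for arbitrary normed domains so as to cover both paths in the surface and holomorphic maps
  from the plane.
\<close>

lemma chart_change_has_derivative:
  fixes f :: "'b::real_normed_vector \<Rightarrow> 'a"
  assumes c: "c \<in> A" "c' \<in> A" and fx: "f x \<in> fst c'"
    and ev: "\<forall>\<^sub>F y in nhds x. f y \<in> fst c"
    and D: "((snd c \<circ> f) has_derivative D) (at x)"
  shows "((snd c' \<circ> f) has_derivative (\<lambda>h. deriv (transition c c') (snd c (f x)) * D h)) (at x)"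
proof -
  have fx1: "f x \<in> fst c" using ev eventually_nhds_x_imp_x by blast
  have "((\<lambda>y. transition c c' ((snd c \<circ> f) y)) has_derivative
          (\<lambda>h. deriv (transition c c') (snd c (f x)) * D h)) (at x)"
  proof -
    have "(transition c c' has_derivative (*) (deriv (transition c c') (snd c (f x)))) (at ((snd c \<circ> f) x))"
      using transition_has_field_derivative[OF c fx1 fx] by (simp add: has_field_derivative_def)
    from has_derivative_compose[OF D this] show ?thesis .
  qed
  moreover have "\<forall>\<^sub>F y in nhds x. transition c c' ((snd c \<circ> f) y) = (snd c' \<circ> f) y"
    using ev by eventually_elim (simp add: transition_chart[OF c(1)])
  ultimately show ?thesis by (rule has_derivative_transform_nhds)
qed

lemma piecewise_C1_pathD:
  assumes "piecewise_C1_path X A \<gamma>" "c \<in> A" "0 \<le> a" "b \<le> 1" "\<gamma> ` {a..b} \<subseteq> fst c"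
  shows "(snd c \<circ> \<gamma>) piecewise_C1_differentiable_on {a..b}"
  using assms unfolding piecewise_C1_path_def by blast

lemma pathin_openin_interval:
  assumes "pathin X \<gamma>" "openin X V" "x \<in> {0..1}" "\<gamma> x \<in> V"
  obtains d where "d > 0" "\<And>t. t \<in> {0..1} \<Longrightarrow> dist t x < d \<Longrightarrow> \<gamma> t \<in> V"
proof -
  have "openin (top_of_set {0..1::real}) {t \<in> {0..1}. \<gamma> t \<in> V}"
    using assms by (auto simp: pathin_def continuous_map)
  then show ?thesis using assms that by (auto simp: openin_euclidean_subtopology_iff) 
qed

text \<open>
  The definition of a piecewise \<open>C\<^sup>1\<close> path only speaks of time intervals that stay inside one chart.
  Bisection of the unit interval, with a chart around each time, shows that there are finitely many
  exceptional times altogether. Away from these a path is differentiable in every chart, since it is so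
  in one.
\<close>

lemma piecewise_C1_path_differentiable:
  assumes \<gamma>: "piecewise_C1_path X A \<gamma>"
  obtains S where "finite S"
    "\<And>t c. t \<in> {0<..<1} - S \<Longrightarrow> c \<in> A \<Longrightarrow> \<gamma> t \<in> fst c \<Longrightarrow> (snd c \<circ> \<gamma>) differentiable at t"
proof -
  have path: "pathin X \<gamma>" using \<gamma> by (simp add: piecewise_C1_path_def)
  define bad where "bad = {t. \<exists>c\<in>A. \<gamma> t \<in> fst c \<and> \<not> (snd c \<circ> \<gamma>) differentiable at t}"
  have "finite (bad \<inter> {0<..<1} \<inter> {0..1})"
  proof (rule Bolzano[of 0 1 "\<lambda>a b. finite (bad \<inter> {0<..<1} \<inter> {a..b})"])
    fix a b c :: real
    assume fin: "finite (bad \<inter> {0<..<1} \<inter> {a..b})" "finite (bad \<inter> {0<..<1} \<inter> {b..c})" and "a \<le> b" "b \<le> c"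
    have "bad \<inter> {0<..<1} \<inter> {a..c} \<subseteq> (bad \<inter> {0<..<1} \<inter> {a..b}) \<union> (bad \<inter> {0<..<1} \<inter> {b..c})" by auto
    then show "finite (bad \<inter> {0<..<1} \<inter> {a..c})" using fin by (meson finite_UnI finite_subset)
  next
    fix x :: real assume x: "0 \<le> x" "x \<le> 1"
    then have "\<gamma> x \<in> topspace X" using path_image_subset_topspace[OF path] by auto
    then obtain c where c: "c \<in> A" "\<gamma> x \<in> fst c" using ex_chart by blast
    obtain d where d: "d > 0" "\<And>t. t \<in> {0..1} \<Longrightarrow> dist t x < d \<Longrightarrow> \<gamma> t \<in> fst c"
      using pathin_openin_interval[OF path chart(1)[OF c(1)] _ c(2)] x by auto
    show "\<exists>d>0. \<forall>a b. a \<le> x \<and> x \<le> b \<and> b - a < d \<longrightarrow> finite (bad \<inter> {0<..<1} \<inter> {a..b})"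
    proof (intro exI[of _ d] conjI allI impI)
      fix a b assume ab: "a \<le> x \<and> x \<le> b \<and> b - a < d"
      define a' b' where "a' = max 0 a" and "b' = min 1 b"
      have sub: "\<gamma> ` {a'..b'} \<subseteq> fst c"
        using d(2) ab by (auto simp: a'_def b'_def dist_real_def)
      then have "(snd c \<circ> \<gamma>) piecewise_C1_differentiable_on {a'..b'}"
        using piecewise_C1_pathD[OF \<gamma> c(1)] by (auto simp: a'_def b'_def)
      then obtain S where S: "finite S" "(snd c \<circ> \<gamma>) C1_differentiable_on ({a'..b'} - S)"
        by (auto simp: piecewise_C1_differentiable_on_def)
      have "bad \<inter> {0<..<1} \<inter> {a..b} \<subseteq> S \<union> {a', b'}"
      proof
        fix t assume t: "t \<in> bad \<inter> {0<..<1} \<inter> {a..b}"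
        show "t \<in> S \<union> {a', b'}"
        proof (rule ccontr)
          assume "t \<notin> S \<union> {a', b'}"
          then have t': "t \<in> {a'..b'} - S" "t \<in> {a'<..<b'}" using t by (auto simp: a'_def b'_def)
          then have diff: "(snd c \<circ> \<gamma>) differentiable at t"
            using S(2) by (auto simp: C1_differentiable_on_eq)
          have "\<forall>\<^sub>F y in nhds t. \<gamma> y \<in> fst c"
            using eventually_nhds_in_open[of "{a'<..<b'}" t] t'(2) sub
            by (auto elim!: eventually_mono simp: image_subset_iff)
          then have "(snd c' \<circ> \<gamma>) differentiable at t" if "c' \<in> A" "\<gamma> t \<in> fst c'" for c'
            using chart_change_has_derivative[where f = \<gamma> and x = t, OF c(1) that] diff unfolding differentiable_def by blast
          then show False using t by (auto simp: bad_def)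
        qed
      qed
      then show "finite (bad \<inter> {0<..<1} \<inter> {a..b})" using S(1) finite_subset by blast
    qed (rule d(1))
  qed auto
  moreover have "bad \<inter> {0<..<1} \<inter> {0..1} = bad \<inter> {0<..<1}" by auto
  ultimately have fin: "finite (bad \<inter> {0<..<1})" by simp
  show ?thesis
  proof (rule that[OF fin])
    fix t c assume "t \<in> {0<..<1} - bad \<inter> {0<..<1}" "c \<in> A" "\<gamma> t \<in> fst c"
    then show "(snd c \<circ> \<gamma>) differentiable at t" unfolding bad_def by blast
  qed
qed

lemma piecewise_C1_path_affine:
  assumes \<gamma>: "piecewise_C1_path X A \<gamma>" and cA: "c \<in> A" and img: "(\<lambda>t. \<gamma> (k * t + e)) ` {a..b} \<subseteq> fst c"
    and sub: "(\<lambda>t. k * t + e) ` {a..b} \<subseteq> {0..1}"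
  shows "(\<lambda>t. snd c (\<gamma> (k * t + e))) piecewise_C1_differentiable_on {a..b}"
proof (cases "a \<le> b")
  case True
  define l u where "l = min (k * a + e) (k * b + e)" and "u = max (k * a + e) (k * b + e)"
  have eq: "(\<lambda>t. k * t + e) ` {a..b} = {l..u}"
    using image_affinity_atLeastAtMost[of k e a b] True by (auto simp: l_def u_def mult_left_mono min_def max_def)
  have "(snd c \<circ> \<gamma>) piecewise_C1_differentiable_on {l..u}"
  proof (rule piecewise_C1_pathD[OF \<gamma> cA])
    show "0 \<le> l" "u \<le> 1" using sub eq True unfolding l_def u_def by (auto simp: image_subset_iff)
    show "\<gamma> ` {l..u} \<subseteq> fst c" using img eq by (metis image_image)
  qed
  then show ?thesis
    using piecewise_C1_differentiable_affine[of "snd c \<circ> \<gamma>" k e "{a..b}"] by (simp add: eq o_def)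
qed (auto simp: piecewise_C1_differentiable_on_def intro: exI[of _ "{}"])

lemma piecewise_C1_path_reverse:
  assumes \<gamma>: "piecewise_C1_path X A \<gamma>"
  shows "piecewise_C1_path X A (\<lambda>t. \<gamma> (1 - t))"
  unfolding piecewise_C1_path_def
proof (intro conjI ballI allI impI)
  show "pathin X (\<lambda>t. \<gamma> (1 - t))"
  proof -
    have "continuous_map (top_of_set {0..1::real}) (top_of_set {0..1}) (\<lambda>t. 1 - t)"
      by (auto simp: continuous_map_in_subtopology continuous_on_op_minus)
    from continuous_map_compose[OF this] \<gamma> show ?thesis
      by (auto simp: piecewise_C1_path_def pathin_def o_def)
  qed
  fix c a b assume c: "c \<in> A" and ab: "0 \<le> a \<and> b \<le> 1 \<and> (\<lambda>t. \<gamma> (1 - t)) ` {a..b} \<subseteq> fst c"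
  then show "snd c \<circ> (\<lambda>t. \<gamma> (1 - t)) piecewise_C1_differentiable_on {a..b}"
    using piecewise_C1_path_affine[OF \<gamma> c, of "-1" 1 a b] by (auto simp: o_def)
qed

definition path_join :: "(real \<Rightarrow> 'a) \<Rightarrow> (real \<Rightarrow> 'a) \<Rightarrow> real \<Rightarrow> 'a" where
  "path_join \<gamma> \<delta> t = (if t \<le> 1 / 2 then \<gamma> (2 * t) else \<delta> (2 * t - 1))"

lemma piecewise_C1_path_join:
  assumes \<gamma>: "piecewise_C1_path X A \<gamma>" and \<delta>: "piecewise_C1_path X A \<delta>" and eq: "\<gamma> 1 = \<delta> 0"
  shows "piecewise_C1_path X A (path_join \<gamma> \<delta>)"
  unfolding piecewise_C1_path_def
proof (intro conjI ballI allI impI)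
  show "pathin X (path_join \<gamma> \<delta>)"
    unfolding pathin_def path_join_def
  proof (intro continuous_map_cases_le)
    let ?T01 = "top_of_set {0..1::real}"
    have "continuous_map (subtopology ?T01 {x \<in> topspace ?T01. x \<le> 1/2}) ?T01 ((*) 2)"
      by (auto simp: continuous_map_in_subtopology continuous_map_from_subtopology)
    from continuous_map_compose[OF this] \<gamma>
    show "continuous_map (subtopology ?T01 {x \<in> topspace ?T01. x \<le> 1/2}) X (\<lambda>t. \<gamma> (2 * t))"
      by (auto simp: piecewise_C1_path_def pathin_def o_def)
    have "continuous_map (subtopology ?T01 {x. 0 \<le> x \<and> x \<le> 1 \<and> 1 \<le> x * 2}) euclideanreal (\<lambda>t. 2 * t - 1)"
      by (intro continuous_intros) (force intro: continuous_map_from_subtopology)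
    then have "continuous_map (subtopology ?T01 {x \<in> topspace ?T01. 1/2 \<le> x}) ?T01 (\<lambda>t. 2 * t - 1)"
      by (force simp: continuous_map_in_subtopology)
    from continuous_map_compose[OF this] \<delta>
    show "continuous_map (subtopology ?T01 {x \<in> topspace ?T01. 1/2 \<le> x}) X (\<lambda>t. \<delta> (2 * t - 1))"
      by (auto simp: piecewise_C1_path_def pathin_def o_def)
    show "\<gamma> (2 * x) = \<delta> (2 * x - 1)" if "x \<in> topspace ?T01" "x = 1/2" for x
      unfolding that(2) using eq by simp
  qed auto
  fix c a b assume c: "c \<in> A" and ab: "0 \<le> a \<and> b \<le> 1 \<and> path_join \<gamma> \<delta> ` {a..b} \<subseteq> fst c"
  have img: "path_join \<gamma> \<delta> t \<in> fst c" if "t \<in> {a..b}" for t using ab that by blast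
  have half: "\<gamma> (2 * (1 / 2)) = \<delta> (2 * (1 / 2) - 1)" using eq by simp
  have join1: "path_join \<gamma> \<delta> t = \<gamma> (2 * t)" if "t \<le> 1 / 2" for t
    using that by (simp add: path_join_def)
  have join2: "path_join \<gamma> \<delta> t = \<delta> (2 * t - 1)" if "1 / 2 \<le> t" for t
  proof (cases "t = 1 / 2")
    case True
    show ?thesis unfolding True using eq by (simp add: path_join_def)
  qed (use that in \<open>simp add: path_join_def\<close>)
  have first: "(\<lambda>t. snd c (\<gamma> (2 * t + 0))) piecewise_C1_differentiable_on {a..min b (1/2)}"
  proof (rule piecewise_C1_path_affine[OF \<gamma> c])
    show "(\<lambda>t. \<gamma> (2 * t + 0)) ` {a..min b (1/2)} \<subseteq> fst c"
    proof clarify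
      fix t assume "t \<in> {a..min b (1/2)}"
      then show "\<gamma> (2 * t + 0) \<in> fst c" using img[of t] join1[of t] by auto
    qed
    show "(\<lambda>t. 2 * t + 0) ` {a..min b (1/2)} \<subseteq> {0..1}"
      by (rule image_subsetI) (use ab in simp)
  qed
  have second: "(\<lambda>t. snd c (\<delta> (2 * t + - 1))) piecewise_C1_differentiable_on {max a (1/2)..b}"
  proof (rule piecewise_C1_path_affine[OF \<delta> c])
    show "(\<lambda>t. \<delta> (2 * t + - 1)) ` {max a (1 / 2)..b} \<subseteq> fst c"
    proof clarify
      fix t assume "t \<in> {max a (1 / 2)..b}"
      then show "\<delta> (2 * t + - 1) \<in> fst c" using img[of t] join2[of t] by auto
    qed
    show "(\<lambda>t. 2 * t + - 1) ` {max a (1/2)..b} \<subseteq> {0..1}"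
      by (rule image_subsetI) (use ab in simp)
  qed
  consider "b \<le> 1/2" | "1 / 2 \<le> a" | "a \<le> 1 / 2" "1 / 2 \<le> b" by linarith
  then show "snd c \<circ> path_join \<gamma> \<delta> piecewise_C1_differentiable_on {a..b}"
  proof cases
    case 1
    show ?thesis
      by (rule piecewise_C1_differentiable_on_cong[OF first[unfolded min_absorb1[OF 1]]])
        (use 1 in \<open>auto simp: join1\<close>)
  next
    case 2
    show ?thesis
      by (rule piecewise_C1_differentiable_on_cong[OF second[unfolded max_absorb1[OF 2]]])
        (use 2 in \<open>auto simp: join2\<close>)
  next
    case 3
    have "(\<lambda>t. if t \<le> 1 / 2 then snd c (\<gamma> (2 * t + 0)) else snd c (\<delta> (2 * t + - 1)))
        piecewise_C1_differentiable_on {a..b}"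
      using first second 3 eq by (intro piecewise_C1_differentiable_cases) auto
    moreover have "(\<lambda>t. if t \<le> 1 / 2 then snd c (\<gamma> (2 * t + 0)) else snd c (\<delta> (2 * t + - 1)))
        = snd c \<circ> path_join \<gamma> \<delta>"
      by (auto simp: path_join_def fun_eq_iff)
    ultimately show ?thesis by simp
  qed
qed

lemma path_eventually_in:
  assumes "pathin X \<gamma>" "t \<in> {0<..<1}" "openin X V" "\<gamma> t \<in> V"
  shows "\<forall>\<^sub>F s in nhds t. \<gamma> s \<in> V"
proof -
  obtain d where d: "d > 0" "\<And>s. s \<in> {0..1} \<Longrightarrow> dist s t < d \<Longrightarrow> \<gamma> s \<in> V"
    using pathin_openin_interval[OF assms(1,3) _ assms(4)] assms(2) by auto
  have "\<forall>\<^sub>F s in nhds t. s \<in> {0<..<1}" using assms(2) by (intro eventually_nhds_in_open) auto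
  moreover have "\<forall>\<^sub>F s in nhds t. dist s t < d" using d(1) eventually_nhds_metric by blast
  ultimately show ?thesis by eventually_elim (use d(2) in auto)
qed

text \<open>
  A holomorphic map from a subset of the plane into the surface, described by its germs. Inverse charts
  and integral curves of vector fields are the examples of interest.
\<close>

definition holo_curve :: "complex set \<Rightarrow> (complex \<Rightarrow> 'a) \<Rightarrow> bool" where
  "holo_curve S \<Phi> \<longleftrightarrow> (\<forall>w\<in>S. \<exists>c\<in>A. (\<forall>\<^sub>F y in nhds w. \<Phi> y \<in> fst c) \<and> (snd c \<circ> \<Phi>) field_differentiable (at w))"

lemma holo_curve_in_chart:
  assumes \<Phi>: "holo_curve S \<Phi>" and w: "w \<in> S" and c: "c \<in> A" "\<Phi> w \<in> fst c"
  shows "\<forall>\<^sub>F y in nhds w. \<Phi> y \<in> fst c" "(snd c \<circ> \<Phi>) field_differentiable (at w)"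
proof -
  obtain c' where c': "c' \<in> A" "\<forall>\<^sub>F y in nhds w. \<Phi> y \<in> fst c'" "(snd c' \<circ> \<Phi>) field_differentiable (at w)"
    using \<Phi> w unfolding holo_curve_def by blast
  then obtain D where D: "(snd c' \<circ> \<Phi> has_field_derivative D) (at w)" by (auto simp: field_differentiable_def)
  show "\<forall>\<^sub>F y in nhds w. \<Phi> y \<in> fst c"
    using eventually_in_openin[OF c'(1,2) _ chart(1)[OF c(1)] c(2)] DERIV_isCont[OF D] by simp
  show "(snd c \<circ> \<Phi>) field_differentiable (at w)"
    using chart_change_has_derivative[where f = \<Phi> and x = w and D = "(*) D", OF c'(1) c(1) c(2) c'(2)] D
    by (force simp: has_field_derivative_def field_differentiable_def mult.assoc[symmetric])
qed

lemma holo_curve_openin: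
  assumes \<Phi>: "holo_curve S \<Phi>" and S: "open S" and V: "openin X V"
  shows "open {w \<in> S. \<Phi> w \<in> V}"
proof (rule openI)
  fix w assume w: "w \<in> {w \<in> S. \<Phi> w \<in> V}"
  then obtain c where c: "c \<in> A" "\<forall>\<^sub>F y in nhds w. \<Phi> y \<in> fst c" "(snd c \<circ> \<Phi>) field_differentiable (at w)"
    using \<Phi> unfolding holo_curve_def by blast
  then have "isCont (snd c \<circ> \<Phi>) w" by (simp add: field_differentiable_imp_continuous_at)
  then have "\<forall>\<^sub>F y in nhds w. \<Phi> y \<in> V" using eventually_in_openin[OF c(1,2) _ V] w by auto
  moreover have "\<forall>\<^sub>F y in nhds w. y \<in> S" using S w by (intro eventually_nhds_in_open) auto
  ultimately have "\<forall>\<^sub>F y in nhds w. y \<in> {w \<in> S. \<Phi> w \<in> V}" by eventually_elim auto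
  then show "\<exists>e>0. ball w e \<subseteq> {w \<in> S. \<Phi> w \<in> V}"
    unfolding eventually_nhds_metric by (auto simp: dist_commute subset_iff)
qed

lemma holo_curve_topspace: "holo_curve S \<Phi> \<Longrightarrow> w \<in> S \<Longrightarrow> \<Phi> w \<in> topspace X"
  unfolding holo_curve_def using chart_topspace eventually_nhds_x_imp_x by metis

lemma holo_curve_continuous:
  assumes "holo_curve S \<Phi>" "open S"
  shows "continuous_map (top_of_set S) X \<Phi>"
  unfolding continuous_map_def
  using holo_curve_openin[OF assms] holo_curve_topspace[OF assms(1)] assms(2)
  by (auto simp: openin_open_eq)

lemma holo_curve_holomorphic:
  assumes \<Phi>: "holo_curve S \<Phi>" and c: "c \<in> A"
  shows "(snd c \<circ> \<Phi>) holomorphic_on {w \<in> S. \<Phi> w \<in> fst c}"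
  unfolding holomorphic_on_def
  using holo_curve_in_chart(2)[OF \<Phi> _ c] by (auto intro: field_differentiable_at_within)

text \<open>
  Straight segments in the domain of a holomorphic curve supply all the explicit paths that are needed:
  coordinate segments inside a chart, and pieces of the rays of a flow.
\<close>

lemma holo_curve_segment_path:
  assumes \<Phi>: "holo_curve S \<Phi>" and S: "open S" and seg: "closed_segment w0 w1 \<subseteq> S"
  shows "piecewise_C1_path X A (\<lambda>t. \<Phi> (w0 + of_real t * (w1 - w0)))"
  unfolding piecewise_C1_path_def
proof (intro conjI ballI allI impI)
  let ?w = "\<lambda>t. w0 + complex_of_real t * (w1 - w0)"
  have w: "?w t \<in> S" if "t \<in> {0..1}" for t
    using seg that by (force simp: closed_segment_def scaleR_conv_of_real algebra_simps)
  have "continuous_map (top_of_set {0..1}) (top_of_set S) ?w"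
    using w by (auto simp: continuous_map_in_subtopology intro!: continuous_intros)
  from continuous_map_compose[OF this holo_curve_continuous[OF \<Phi> S]]
  show "pathin X (\<lambda>t. \<Phi> (?w t))" by (simp add: pathin_def o_def)
  fix c a b assume c: "c \<in> A" and ab: "0 \<le> a \<and> b \<le> 1 \<and> (\<lambda>t. \<Phi> (?w t)) ` {a..b} \<subseteq> fst c"
  define T where "T = {w \<in> S. \<Phi> w \<in> fst c}"
  have T: "open T" unfolding T_def by (rule holo_curve_openin[OF \<Phi> S chart(1)[OF c]])
  have hol: "(snd c \<circ> \<Phi>) holomorphic_on T" unfolding T_def by (rule holo_curve_holomorphic[OF \<Phi> c])
  have wT: "?w t \<in> T" if "t \<in> {a..b}" for t using w ab that by (auto simp: T_def)
  show "snd c \<circ> (\<lambda>t. \<Phi> (?w t)) piecewise_C1_differentiable_on {a..b}"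
  proof (rule C1_differentiable_imp_piecewise, unfold C1_differentiable_on_def, intro exI conjI ballI)
    fix t assume t: "t \<in> {a..b}"
    have "(?w has_vector_derivative (w1 - w0)) (at t)"
      by (auto intro!: derivative_eq_intros simp: has_vector_derivative_def scaleR_conv_of_real)
    from field_vector_diff_chain_at[OF this holomorphic_derivI[OF hol T wT[OF t]]]
    show "(snd c \<circ> (\<lambda>t. \<Phi> (?w t)) has_vector_derivative (w1 - w0) * deriv (snd c \<circ> \<Phi>) (?w t)) (at t)"
      by (simp add: o_def)
  next
    have "continuous_on {a..b} (\<lambda>t. deriv (snd c \<circ> \<Phi>) (?w t))"
      by (rule continuous_on_compose2[OF holomorphic_on_imp_continuous_on[OF holomorphic_deriv[OF hol T]]])
        (use wT in \<open>auto intro!: continuous_intros\<close>)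
    then show "continuous_on {a..b} (\<lambda>t. (w1 - w0) * deriv (snd c \<circ> \<Phi>) (?w t))"
      by (intro continuous_intros)
  qed
qed

lemma holo_curve_chart_inv:
  assumes c: "c \<in> A"
  shows "holo_curve (snd c ` fst c) (chart_inv c)"
  unfolding holo_curve_def
proof (intro ballI bexI conjI)
  fix w assume w: "w \<in> snd c ` fst c"
  have ev: "\<forall>\<^sub>F y in nhds w. y \<in> snd c ` fst c"
    using w chart(2)[OF c] by (intro eventually_nhds_in_open) auto
  then show "\<forall>\<^sub>F y in nhds w. chart_inv c y \<in> fst c"
    by eventually_elim (simp add: chart_inv_in[OF c])
  have "((\<lambda>y. y) has_field_derivative 1) (at w)" by (rule DERIV_ident)
  then have "((snd c \<circ> chart_inv c) has_field_derivative 1) (at w)"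
    by (rule has_field_derivative_transform_within_open[OF _ chart(2)[OF c] w]) (simp add: chart_chart_inv[OF c])
  then show "(snd c \<circ> chart_inv c) field_differentiable at w" by (auto simp: field_differentiable_def)
qed (rule c)

end

section \<open>The distance of a conformal metric\<close>

locale conformal_surface = riemann X A for X :: "'a topology" and A +
  fixes \<rho> :: "'a chart \<Rightarrow> complex \<Rightarrow> real"
  assumes connected: "connected_space X" and conformal: "conformal_metric A \<rho>"
begin

lemma density_pos: "c \<in> A \<Longrightarrow> p \<in> fst c \<Longrightarrow> \<rho> c (snd c p) > 0"
  using conformal unfolding conformal_metric_def by blast

lemma density_continuous: "c \<in> A \<Longrightarrow> continuous_on (snd c ` fst c) (\<rho> c)"
  using conformal unfolding conformal_metric_def smooth_on_def by (metis Ck_on.simps(1))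

lemma density_change:
  assumes "c \<in> A" "c' \<in> A" "p \<in> fst c" "p \<in> fst c'"
  shows "\<rho> c (snd c p) = \<rho> c' (snd c' p) * (cmod (deriv (transition c c') (snd c p)))\<^sup>2"
proof -
  have "snd c p \<in> snd c ` (fst c \<inter> fst c')" using assms by blast
  then have "\<rho> c (snd c p) = \<rho> c' (transition c c' (snd c p)) * (cmod (deriv (transition c c') (snd c p)))\<^sup>2"
    using conformal assms(1,2) unfolding conformal_metric_def by blast
  then show ?thesis using transition_chart[OF assms(1,3)] by simp
qed

text \<open>
  At a time of differentiability, the choice of the chart in the definition of the speed is irrelevant:
  the factor by which the velocity changes is compensated by the transformation rule of the densities.
\<close>

lemma speed_eq:
  assumes c: "c \<in> A" and ev: "\<forall>\<^sub>F s in nhds t. \<gamma> s \<in> fst c"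
    and v: "(snd c \<circ> \<gamma> has_vector_derivative v) (at t)"
  shows "speed A \<rho> \<gamma> t = sqrt (\<rho> c (snd c (\<gamma> t))) * cmod v"
proof -
  have \<gamma>c: "\<gamma> t \<in> fst c" using ev eventually_nhds_x_imp_x by blast
  define c' where "c' = (SOME c. c \<in> A \<and> \<gamma> t \<in> fst c)"
  have c': "c' \<in> A" "\<gamma> t \<in> fst c'"
    using someI[of "\<lambda>c. c \<in> A \<and> \<gamma> t \<in> fst c" c] c \<gamma>c by (auto simp: c'_def)
  let ?\<tau> = "deriv (transition c c') (snd c (\<gamma> t))"
  have "(snd c' \<circ> \<gamma> has_vector_derivative ?\<tau> * v) (at t)"
    using chart_change_has_derivative[where f = \<gamma> and x = t and D = "\<lambda>h. h *\<^sub>R v", OF c c'(1,2) ev] v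
    by (simp add: has_vector_derivative_def)
  then have "speed A \<rho> \<gamma> t = sqrt (\<rho> c' (snd c' (\<gamma> t))) * cmod (?\<tau> * v)"
    by (simp add: speed_def vector_derivative_at flip: c'_def)
  then show ?thesis
    by (simp add: density_change[OF c c'(1) \<gamma>c c'(2)] norm_mult real_sqrt_mult)
qed

lemma speed_affine:
  assumes "\<gamma> (e + k * t) \<in> topspace X"
    and diff: "\<And>c. c \<in> A \<Longrightarrow> \<gamma> (e + k * t) \<in> fst c \<Longrightarrow> (snd c \<circ> \<gamma>) differentiable at (e + k * t)"
    and eq: "\<forall>\<^sub>F s in nhds t. \<delta> s = \<gamma> (e + k * s)"
  shows "speed A \<rho> \<delta> t = \<bar>k\<bar> * speed A \<rho> \<gamma> (e + k * t)"
proof -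
  have \<delta>t: "\<delta> t = \<gamma> (e + k * t)" using eq eventually_nhds_x_imp_x by blast
  define c where "c = (SOME c. c \<in> A \<and> \<gamma> (e + k * t) \<in> fst c)"
  have "\<exists>c. c \<in> A \<and> \<gamma> (e + k * t) \<in> fst c" using ex_chart[OF assms(1)] by blast
  from someI_ex[OF this] have c: "c \<in> A" "\<gamma> (e + k * t) \<in> fst c" unfolding c_def by blast+
  obtain v where v: "(snd c \<circ> \<gamma> has_vector_derivative v) (at (e + k * t))"
    using diff[OF c] vector_derivative_works by blast
  have aff: "((\<lambda>s. e + k * s) has_vector_derivative k) (at t)"
    by (auto intro!: derivative_eq_intros simp: has_vector_derivative_def)
  have "((snd c \<circ> \<gamma>) \<circ> (\<lambda>s. e + k * s) has_vector_derivative k *\<^sub>R v) (at t)"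
    by (rule vector_diff_chain_at[OF aff v])
  moreover have "\<forall>\<^sub>F s in nhds t. ((snd c \<circ> \<gamma>) \<circ> (\<lambda>s. e + k * s)) s = (snd c \<circ> \<delta>) s"
    using eq by eventually_elim simp
  ultimately have "(snd c \<circ> \<delta> has_vector_derivative k *\<^sub>R v) (at t)"
    unfolding has_vector_derivative_def by (rule has_derivative_transform_nhds)
  then show ?thesis
    using v by (simp add: speed_def \<delta>t vector_derivative_at flip: c_def)
qed

text \<open>
  Reversal and concatenation of paths are both piecewise affine reparametrisations.
\<close>

lemma path_len_affine_piece:
  assumes \<gamma>: "piecewise_C1_path X A \<gamma>" and k: "k \<noteq> 0"
    and eq: "\<And>t. t \<in> {a<..<b} \<Longrightarrow> \<delta> t = \<gamma> (e + k * t)"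
    and sub: "\<And>t. t \<in> {a<..<b} \<Longrightarrow> e + k * t \<in> {0<..<1}"
  shows "(\<integral>\<^sup>+t\<in>{a..b}. ennreal (speed A \<rho> \<delta> t) \<partial>lborel) \<le> path_len A \<rho> \<gamma>"
proof -
  obtain S where S: "finite S"
    "\<And>t c. t \<in> {0<..<1} - S \<Longrightarrow> c \<in> A \<Longrightarrow> \<gamma> t \<in> fst c \<Longrightarrow> (snd c \<circ> \<gamma>) differentiable at t"
    using piecewise_C1_path_differentiable[OF \<gamma>] by blast
  let ?f = "\<lambda>t. ennreal (speed A \<rho> \<gamma> t) * indicator {0..1} t"
  have "finite ({a, b} \<union> (\<lambda>s. (s - e) / k) ` S)" using S(1) by simp
  then have "AE t in lborel. t \<notin> {a, b} \<union> (\<lambda>s. (s - e) / k) ` S"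
    by (intro AE_not_in finite_imp_null_set_lborel)
  then have "AE t in lborel. ennreal (speed A \<rho> \<delta> t) * indicator {a..b} t \<le> ennreal \<bar>k\<bar> * ?f (e + k * t)"
  proof eventually_elim
    case (elim t)
    show ?case
    proof (cases "t \<in> {a..b}")
      case True
      then have t: "t \<in> {a<..<b}" using elim by auto
      have nS: "e + k * t \<notin> S"
      proof
        assume "e + k * t \<in> S"
        then have "(e + k * t - e) / k \<in> (\<lambda>s. (s - e) / k) ` S" by (rule imageI)
        then show False using elim k by simp
      qed
      have "speed A \<rho> \<delta> t = \<bar>k\<bar> * speed A \<rho> \<gamma> (e + k * t)"
      proof (rule speed_affine)
        show "\<gamma> (e + k * t) \<in> topspace X"
          using path_image_subset_topspace[of X \<gamma>] \<gamma> sub[OF t] by (auto simp: piecewise_C1_path_def)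
        show "(snd c \<circ> \<gamma>) differentiable at (e + k * t)" if "c \<in> A" "\<gamma> (e + k * t) \<in> fst c" for c
          using S(2) sub[OF t] nS that by blast
        show "\<forall>\<^sub>F s in nhds t. \<delta> s = \<gamma> (e + k * s)"
          using eventually_nhds_in_open[of "{a<..<b}" t] t by (auto elim!: eventually_mono simp: eq)
      qed
      then show ?thesis using sub[OF t] True by (simp add: ennreal_mult')
    qed simp
  qed
  then have "(\<integral>\<^sup>+t\<in>{a..b}. ennreal (speed A \<rho> \<delta> t) \<partial>lborel) \<le> (\<integral>\<^sup>+t. ennreal \<bar>k\<bar> * ?f (e + k * t) \<partial>lborel)"
    by (rule nn_integral_mono_AE)
  also have "\<dots> = ennreal \<bar>k\<bar> * (\<integral>\<^sup>+t. ?f (e + k * t) \<partial>lborel)"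
    using k by (intro nn_integral_cmult_pos) auto
  also have "\<dots> \<le> path_len A \<rho> \<gamma>"
    unfolding path_len_def by (rule nn_integral_real_affine_ge[OF k])
  finally show ?thesis .
qed

lemma path_len_reverse:
  assumes "piecewise_C1_path X A \<gamma>"
  shows "path_len A \<rho> (\<lambda>t. \<gamma> (1 - t)) \<le> path_len A \<rho> \<gamma>"
  unfolding path_len_def[of A \<rho> "\<lambda>t. \<gamma> (1 - t)"]
  by (rule path_len_affine_piece[OF assms, of "-1" _ _ _ 1]) auto

lemma path_len_join:
  assumes "piecewise_C1_path X A \<gamma>" "piecewise_C1_path X A \<delta>" "\<gamma> 1 = \<delta> 0"
  shows "path_len A \<rho> (path_join \<gamma> \<delta>) \<le> path_len A \<rho> \<gamma> + path_len A \<rho> \<delta>"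
proof -
  have "path_len A \<rho> (path_join \<gamma> \<delta>) \<le> (\<integral>\<^sup>+t\<in>{0..1/2}. ennreal (speed A \<rho> (path_join \<gamma> \<delta>) t) \<partial>lborel)
      + (\<integral>\<^sup>+t\<in>{1/2..1}. ennreal (speed A \<rho> (path_join \<gamma> \<delta>) t) \<partial>lborel)"
    unfolding path_len_def by (rule nn_integral_subadditive_cover) auto
  also have "\<dots> \<le> path_len A \<rho> \<gamma> + path_len A \<rho> \<delta>"
    by (intro add_mono path_len_affine_piece[OF assms(1), of 2 _ _ _ 0]
        path_len_affine_piece[OF assms(2), of 2 _ _ _ "-1"]) (auto simp: path_join_def)
  finally show ?thesis .
qed

lemma path_len_segment_le:
  assumes \<Phi>: "holo_curve S \<Phi>" and S: "open S" and seg: "closed_segment w0 w1 \<subseteq> S"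
    and B: "\<And>w. w \<in> closed_segment w0 w1 \<Longrightarrow> \<exists>c\<in>A. \<Phi> w \<in> fst c \<and>
              sqrt (\<rho> c (snd c (\<Phi> w))) * cmod (deriv (snd c \<circ> \<Phi>) w) \<le> B"
  shows "path_len A \<rho> (\<lambda>t. \<Phi> (w0 + of_real t * (w1 - w0))) \<le> ennreal (B * cmod (w1 - w0))"
proof -
  let ?w = "\<lambda>t. w0 + complex_of_real t * (w1 - w0)"
  have *: "speed A \<rho> (\<lambda>t. \<Phi> (?w t)) t \<le> B * cmod (w1 - w0)" if t: "t \<in> {0..1}" for t
  proof -
    have w: "?w t \<in> closed_segment w0 w1"
      using t by (force simp: closed_segment_def scaleR_conv_of_real algebra_simps)
    then obtain c where c: "c \<in> A" "\<Phi> (?w t) \<in> fst c"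
      "sqrt (\<rho> c (snd c (\<Phi> (?w t)))) * cmod (deriv (snd c \<circ> \<Phi>) (?w t)) \<le> B" using B by blast
    have wS: "?w t \<in> S" using w seg by blast
    have ww: "(?w has_vector_derivative (w1 - w0)) (at t)"
      by (auto intro!: derivative_eq_intros simp: has_vector_derivative_def scaleR_conv_of_real)
    have D: "(snd c \<circ> \<Phi> has_field_derivative deriv (snd c \<circ> \<Phi>) (?w t)) (at (?w t))"
      using holo_curve_in_chart(2)[OF \<Phi> wS c(1,2)] by (simp add: field_differentiable_derivI)
    have "speed A \<rho> (\<lambda>t. \<Phi> (?w t)) t
        = sqrt (\<rho> c (snd c (\<Phi> (?w t)))) * cmod ((w1 - w0) * deriv (snd c \<circ> \<Phi>) (?w t))"
    proof (rule speed_eq[OF c(1)])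
      have "(?w \<longlongrightarrow> ?w t) (nhds t)" by (intro tendsto_intros filterlim_ident)
      then have "filterlim ?w (nhds (?w t)) (nhds t)" .
      from eventually_compose_filterlim[OF holo_curve_in_chart(1)[OF \<Phi> wS c(1,2)] this]
      show "\<forall>\<^sub>F s in nhds t. \<Phi> (?w s) \<in> fst c" .
      show "(snd c \<circ> (\<lambda>t. \<Phi> (?w t)) has_vector_derivative (w1 - w0) * deriv (snd c \<circ> \<Phi>) (?w t)) (at t)"
        using field_vector_diff_chain_at[OF ww D] by (simp add: o_def)
    qed
    also have "\<dots> \<le> B * cmod (w1 - w0)"
      using mult_right_mono[OF c(3), of "cmod (w1 - w0)"] by (simp add: norm_mult mult_ac)
    finally show ?thesis .
  qed
  have "path_len A \<rho> (\<lambda>t. \<Phi> (?w t)) \<le> (\<integral>\<^sup>+t\<in>{0..1::real}. ennreal (B * cmod (w1 - w0)) \<partial>lborel)"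
    unfolding path_len_def
  proof (rule nn_integral_mono)
    fix t
    show "ennreal (speed A \<rho> (\<lambda>t. \<Phi> (?w t)) t) * indicator {0..1} t
        \<le> ennreal (B * cmod (w1 - w0)) * indicator {0..1} t"
      using *[of t] by (cases "t \<in> {0..1}") (auto intro: ennreal_leI)
  qed
  also have "\<dots> = ennreal (B * cmod (w1 - w0))"
    by (subst nn_integral_cmult_indicator) auto
  finally show ?thesis .
qed

text \<open>
  The distance before it is turned into a real number. Only this version distinguishes points that are
  joined by no path of finite length from points at distance 0.
\<close>

definition edist :: "'a \<Rightarrow> 'a \<Rightarrow> ennreal" where
  "edist p q = (INF \<gamma> \<in> {\<gamma>. piecewise_C1_path X A \<gamma> \<and> \<gamma> 0 = p \<and> \<gamma> 1 = q}. path_len A \<rho> \<gamma>)"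

lemma metric_dist_edist: "metric_dist X A \<rho> p q = enn2real (edist p q)"
  by (simp add: metric_dist_def edist_def)

lemma edist_le:
  assumes "piecewise_C1_path X A \<gamma>"
  shows "edist (\<gamma> 0) (\<gamma> 1) \<le> path_len A \<rho> \<gamma>"
  unfolding edist_def by (rule INF_lower) (use assms in auto)

lemma le_edist:
  assumes "\<And>\<gamma>. piecewise_C1_path X A \<gamma> \<Longrightarrow> \<gamma> 0 = p \<Longrightarrow> \<gamma> 1 = q \<Longrightarrow> k \<le> path_len A \<rho> \<gamma>"
  shows "k \<le> edist p q"
  unfolding edist_def by (rule INF_greatest) (use assms in auto)

lemma edist_sym_le: "edist q p \<le> edist p q"
proof (rule le_edist)
  fix \<gamma> assume \<gamma>: "piecewise_C1_path X A \<gamma>" "\<gamma> 0 = p" "\<gamma> 1 = q"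
  have "edist q p \<le> path_len A \<rho> (\<lambda>t. \<gamma> (1 - t))"
    using edist_le[OF piecewise_C1_path_reverse[OF \<gamma>(1)]] \<gamma> by simp
  also have "\<dots> \<le> path_len A \<rho> \<gamma>" by (rule path_len_reverse[OF \<gamma>(1)])
  finally show "edist q p \<le> path_len A \<rho> \<gamma>" .
qed

lemma edist_sym: "edist p q = edist q p"
  by (intro antisym edist_sym_le)

lemma edist_triangle: "edist p r \<le> edist p q + edist q r"
proof (cases "edist p q = top \<or> edist q r = top")
  case False
  show ?thesis
  proof (rule ennreal_le_epsilon)
    fix e :: real assume e: "0 < e"
    have "edist p q < edist p q + ennreal (e / 2)" "edist q r < edist q r + ennreal (e / 2)"
      using False e by (auto simp: ennreal_add_less_top top.not_eq_extremum)
    then obtain \<gamma> \<delta> where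
      \<gamma>: "piecewise_C1_path X A \<gamma>" "\<gamma> 0 = p" "\<gamma> 1 = q" "path_len A \<rho> \<gamma> < edist p q + ennreal (e / 2)" and
      \<delta>: "piecewise_C1_path X A \<delta>" "\<delta> 0 = q" "\<delta> 1 = r" "path_len A \<rho> \<delta> < edist q r + ennreal (e / 2)"
      unfolding edist_def INF_less_iff by blast
    have join: "\<gamma> 1 = \<delta> 0" using \<gamma> \<delta> by simp
    have "edist p r \<le> path_len A \<rho> (path_join \<gamma> \<delta>)"
      using edist_le[OF piecewise_C1_path_join[OF \<gamma>(1) \<delta>(1) join]] \<gamma> \<delta> by (simp add: path_join_def)
    also have "\<dots> \<le> path_len A \<rho> \<gamma> + path_len A \<rho> \<delta>" by (rule path_len_join[OF \<gamma>(1) \<delta>(1) join])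
    also have "\<dots> \<le> (edist p q + ennreal (e / 2)) + (edist q r + ennreal (e / 2))"
      using \<gamma>(4) \<delta>(4) by (intro add_mono) auto
    also have "\<dots> = edist p q + edist q r + (ennreal (e / 2) + ennreal (e / 2))" by (simp add: ac_simps)
    also have "ennreal (e / 2) + ennreal (e / 2) = ennreal e" using e by (simp flip: ennreal_plus)
    finally show "edist p r \<le> edist p q + edist q r + ennreal e" .
  qed
qed auto

lemma edist_segment_le:
  assumes "holo_curve S \<Phi>" "open S" "closed_segment w0 w1 \<subseteq> S"
    and "\<And>w. w \<in> closed_segment w0 w1 \<Longrightarrow> \<exists>c\<in>A. \<Phi> w \<in> fst c \<and>
              sqrt (\<rho> c (snd c (\<Phi> w))) * cmod (deriv (snd c \<circ> \<Phi>) w) \<le> B"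
  shows "edist (\<Phi> w0) (\<Phi> w1) \<le> ennreal (B * cmod (w1 - w0))"
  using edist_le[OF holo_curve_segment_path[OF assms(1-3)]] path_len_segment_le[OF assms]
  by (auto intro: order_trans)

lemma edist_locally_finite:
  assumes c: "c \<in> A" and p: "p \<in> fst c"
  shows "\<exists>V. openin X V \<and> p \<in> V \<and> (\<forall>q\<in>V. edist p q < top)"
proof -
  let ?D = "snd c ` fst c"
  obtain r where r: "r > 0" "cball (snd c p) r \<subseteq> ?D"
    using open_contains_cball[of ?D] chart(2)[OF c] p by blast
  have "compact ((\<lambda>z. sqrt (\<rho> c z)) ` cball (snd c p) r)"
    using density_continuous[OF c] r(2)
    by (intro compact_continuous_image continuous_intros) (auto intro: continuous_on_subset)
  then have "bounded ((\<lambda>z. sqrt (\<rho> c z)) ` cball (snd c p) r)" by (rule compact_imp_bounded)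
  then obtain B where "\<forall>x\<in>(\<lambda>z. sqrt (\<rho> c z)) ` cball (snd c p) r. norm x \<le> B"
    unfolding bounded_iff by blast
  then have B: "\<bar>sqrt (\<rho> c z)\<bar> \<le> B" if "z \<in> cball (snd c p) r" for z
    using that by (simp del: mem_cball)
  have fin: "edist p q < top" if q: "q \<in> fst c" "snd c q \<in> ball (snd c p) r" for q
  proof -
    have seg: "closed_segment (snd c p) (snd c q) \<subseteq> cball (snd c p) r"
      using q r by (intro closed_segment_subset) auto
    have "edist (chart_inv c (snd c p)) (chart_inv c (snd c q)) \<le> ennreal (B * cmod (snd c q - snd c p))"
    proof (rule edist_segment_le[OF holo_curve_chart_inv[OF c] chart(2)[OF c]])
      fix w assume "w \<in> closed_segment (snd c p) (snd c q)"
      then have w: "w \<in> cball (snd c p) r" using seg by blast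
      then have wD: "w \<in> ?D" using r by blast
      have "((\<lambda>y. y) has_field_derivative 1) (at w)" by (rule DERIV_ident)
      then have "((snd c \<circ> chart_inv c) has_field_derivative 1) (at w)"
        by (rule has_field_derivative_transform_within_open[OF _ chart(2)[OF c] wD])
          (simp add: chart_chart_inv[OF c])
      then have "deriv (snd c \<circ> chart_inv c) w = 1" by (rule DERIV_imp_deriv)
      then show "\<exists>c'\<in>A. chart_inv c w \<in> fst c' \<and>
          sqrt (\<rho> c' (snd c' (chart_inv c w))) * cmod (deriv (snd c' \<circ> chart_inv c) w) \<le> B"
        using c B[OF w] chart_inv_in[OF c wD] chart_chart_inv[OF c wD] by (intro bexI[of _ c]) auto
    qed (use seg r in auto)
    then show ?thesis
      using p q(1) by (simp add: chart_inv_chart[OF c] le_less_trans)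
  qed
  show ?thesis
  proof (intro exI[of _ "{q \<in> fst c. snd c q \<in> ball (snd c p) r}"] conjI ballI)
    show "openin X {q \<in> fst c. snd c q \<in> ball (snd c p) r}"
      by (rule openin_chart_vimage[OF c open_ball])
  qed (use p r fin in auto)
qed

text \<open>
  Being joined by a path of finite length is an equivalence relation with open classes.
\<close>

lemma edist_finite:
  assumes p: "p \<in> topspace X" and q: "q \<in> topspace X"
  shows "edist p q < top"
proof -
  define R where "R = {q \<in> topspace X. edist p q < top}"
  have nbhd: "\<exists>V. openin X V \<and> x \<in> V \<and> (\<forall>y\<in>V. edist x y < top)" if "x \<in> topspace X" for x
    using ex_chart[OF that] edist_locally_finite by blast
  have trans: "edist p y < top" if "edist p x < top" "edist x y < top" for x y
    using edist_triangle[of p y x] that by (meson ennreal_add_less_top le_less_trans)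
  have "openin X R"
    unfolding openin_subopen[of X R]
  proof
    fix x assume x: "x \<in> R"
    then obtain V where V: "openin X V" "x \<in> V" "\<forall>y\<in>V. edist x y < top"
      using nbhd by (auto simp: R_def)
    then have "V \<subseteq> R" using x trans openin_subset[OF V(1)] by (auto simp: R_def)
    then show "\<exists>T. openin X T \<and> x \<in> T \<and> T \<subseteq> R" using V by blast
  qed
  moreover have "openin X (topspace X - R)"
    unfolding openin_subopen[of X "topspace X - R"]
  proof
    fix x assume x: "x \<in> topspace X - R"
    then obtain V where V: "openin X V" "x \<in> V" "\<forall>y\<in>V. edist x y < top"
      using nbhd by auto
    have "y \<notin> R" if "y \<in> V" for y
      using trans[of y x] V(3) that x by (auto simp: R_def edist_sym[of y x])
    then have "V \<subseteq> topspace X - R" using openin_subset[OF V(1)] by auto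
    then show "\<exists>T. openin X T \<and> x \<in> T \<and> T \<subseteq> topspace X - R" using V by blast
  qed
  ultimately have "R = {} \<or> R = topspace X"
    using connected unfolding connected_space_clopen_in by (metis closedin_def openin_subset)
  moreover have "p \<in> R"
  proof -
    obtain V where "openin X V" "p \<in> V" "\<forall>y\<in>V. edist p y < top" using nbhd[OF p] by blast
    then show ?thesis using p by (auto simp: R_def)
  qed
  ultimately show ?thesis using q by (auto simp: R_def)
qed

lemma edist_refl:
  assumes "p \<in> topspace X"
  shows "edist p p = 0"
proof -
  obtain c where c: "c \<in> A" "p \<in> fst c" using ex_chart[OF assms] by blast
  have "edist (chart_inv c (snd c p)) (chart_inv c (snd c p))
      \<le> ennreal ((sqrt (\<rho> c (snd c p)) * cmod (deriv (snd c \<circ> chart_inv c) (snd c p))) * cmod (snd c p - snd c p))"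
    by (rule edist_segment_le[OF holo_curve_chart_inv[OF c(1)] chart(2)[OF c(1)]])
      (use c in \<open>auto simp: chart_inv_chart intro!: bexI[of _ c]\<close>)
  then show ?thesis using c by (simp add: chart_inv_chart)
qed

text \<open>
  Up to the first time at which the path leaves the coordinate ball it stays in the compact closed ball,
  hence in the chart, where the line element is at least \<open>k\<close> times the Euclidean one.
\<close>

lemma path_leaving_chart_ball_long:
  assumes c: "c \<in> A" and r: "r > 0" and z0: "cball z0 r \<subseteq> snd c ` fst c"
    and k: "k > 0" "\<And>z. z \<in> cball z0 r \<Longrightarrow> k \<le> sqrt (\<rho> c z)"
    and \<gamma>: "piecewise_C1_path X A \<gamma>" and \<gamma>0: "\<gamma> 0 \<in> fst c" "snd c (\<gamma> 0) = z0"
    and \<gamma>1: "\<not> (\<gamma> 1 \<in> fst c \<and> snd c (\<gamma> 1) \<in> ball z0 r)"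
  shows "ennreal (k * r) \<le> path_len A \<rho> \<gamma>"
proof -
  have path: "pathin X \<gamma>" using \<gamma> by (simp add: piecewise_C1_path_def)
  have cl: "closed {t \<in> {0..1}. \<gamma> t \<in> K}" if "closedin X K" for K
    using path that unfolding pathin_def continuous_map_closedin
    by (auto intro: closedin_closed_trans)
  define V where "V = {q \<in> fst c. snd c q \<in> ball z0 r}"
  have V: "openin X V" unfolding V_def by (rule openin_chart_vimage[OF c open_ball])
  define K where "K = chart_inv c ` cball z0 r"
  have "compactin X K"
    unfolding K_def
  proof (rule image_compactin[OF _ continuous_map_chart_inv[OF c]])
    show "compactin (top_of_set (snd c ` fst c)) (cball z0 r)"
      using z0 by (simp add: compactin_subtopology)
  qed
  then have K: "closedin X K" using compactin_imp_closedin[OF Hausdorff] by blast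
  have Kc: "p \<in> fst c \<and> snd c p \<in> cball z0 r" if "p \<in> K" for p
    using that z0 chart_inv_in[OF c] chart_chart_inv[OF c] by (auto simp: K_def subset_iff)
  have VK: "V \<subseteq> K"
  proof
    fix p assume p: "p \<in> V"
    then have "p = chart_inv c (snd c p)" by (simp add: V_def chart_inv_chart[OF c])
    then show "p \<in> K" using p unfolding K_def V_def by (intro image_eqI) auto
  qed
  define T where "T = {t \<in> {0..1}. \<gamma> t \<in> topspace X - V}"
  have T: "closed T" unfolding T_def by (rule cl) (use V in auto)
  have "\<gamma> 1 \<in> topspace X" using path_finish_in_topspace[OF path] .
  then have T1: "1 \<in> T" using \<gamma>1 by (auto simp: T_def V_def)
  have Tbb: "bdd_below T" unfolding T_def by (rule bdd_belowI[of _ 0]) auto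
  define \<tau> where "\<tau> = Inf T"
  have \<tau>T: "\<tau> \<in> T" unfolding \<tau>_def using T1 Tbb T by (intro closed_contains_Inf) auto
  have before: "\<gamma> t \<in> V" if "0 \<le> t" "t < \<tau>" for t
  proof -
    have "t \<notin> T" using cInf_lower[OF _ Tbb] that unfolding \<tau>_def by force
    moreover have "t \<in> {0..1}" using that \<tau>T by (auto simp: T_def)
    moreover have "\<gamma> t \<in> topspace X" using path_image_subset_topspace[OF path] \<open>t \<in> {0..1}\<close> by auto
    ultimately show ?thesis by (auto simp: T_def)
  qed
  have \<tau>01: "0 \<le> \<tau>" "\<tau> \<le> 1" using \<tau>T by (auto simp: T_def)
  have "\<tau> \<noteq> 0" using \<tau>T \<gamma>0 r by (auto simp: T_def V_def)
  then have \<tau>0: "0 < \<tau>" using \<tau>01 by simp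
  have "{0..<\<tau>} \<subseteq> {t \<in> {0..1}. \<gamma> t \<in> K}" using before VK \<tau>01 by auto
  then have "closure {0..<\<tau>} \<subseteq> {t \<in> {0..1}. \<gamma> t \<in> K}" by (intro closure_minimal cl K)
  then have inK: "\<gamma> t \<in> K" if "t \<in> {0..\<tau>}" for t using that \<tau>0 by auto
  let ?z = "snd c \<circ> \<gamma>"
  have img: "\<gamma> ` {0..\<tau>} \<subseteq> fst c" using inK Kc by blast
  have C1: "?z piecewise_C1_differentiable_on {0..\<tau>}"
    by (rule piecewise_C1_pathD[OF \<gamma> c]) (use \<tau>01 img in auto)
  obtain S where S: "finite S"
    "\<And>t c. t \<in> {0<..<1} - S \<Longrightarrow> c \<in> A \<Longrightarrow> \<gamma> t \<in> fst c \<Longrightarrow> (snd c \<circ> \<gamma>) differentiable at t"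
    using piecewise_C1_path_differentiable[OF \<gamma>] by blast
  have der: "(?z has_vector_derivative vector_derivative ?z (at t)) (at t)" if "t \<in> {0<..<\<tau>} - S" for t
  proof -
    have "t \<in> {0<..<1} - S" "t \<in> {0..\<tau>}" using that \<tau>01 by auto
    then have "?z differentiable at t" using S(2) c img by blast
    then show ?thesis by (simp add: vector_derivative_works)
  qed
  have "ennreal r \<le> ennreal (cmod (?z \<tau> - ?z 0))"
  proof -
    have "\<gamma> \<tau> \<in> fst c" "\<gamma> \<tau> \<notin> V" using img \<tau>T \<tau>0 by (auto simp: T_def)
    then have "\<not> snd c (\<gamma> \<tau>) \<in> ball z0 r" by (auto simp: V_def)
    then show ?thesis using \<gamma>0 by (intro ennreal_leI) (auto simp: dist_norm norm_minus_commute)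
  qed
  also have "\<dots> \<le> (\<integral>\<^sup>+t\<in>{0..\<tau>}. ennreal (cmod (vector_derivative ?z (at t))) \<partial>lborel)"
  proof (rule displacement_le_nn_integral_speed[OF _ _ S(1) der])
    show "continuous_on {0..\<tau>} ?z" using C1 by (simp add: piecewise_C1_differentiable_on_def)
  qed (use \<tau>0 in auto)
  finally have "ennreal k * ennreal r
      \<le> ennreal k * (\<integral>\<^sup>+t\<in>{0..\<tau>}. ennreal (cmod (vector_derivative ?z (at t))) \<partial>lborel)"
    by (rule mult_left_mono) simp
  also have "\<dots> = (\<integral>\<^sup>+t. ennreal k * (ennreal (cmod (vector_derivative ?z (at t))) * indicator {0..\<tau>} t) \<partial>lborel)"
    using k(1) by (intro nn_integral_cmult_pos[symmetric])
  also have "\<dots> \<le> path_len A \<rho> \<gamma>"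
    unfolding path_len_def
  proof (rule nn_integral_mono_AE)
    have "finite ({0, \<tau>} \<union> S)" using S(1) by simp
    then have "AE t in lborel. t \<notin> {0, \<tau>} \<union> S"
      by (intro AE_not_in finite_imp_null_set_lborel)
    then show "AE t in lborel. ennreal k * (ennreal (cmod (vector_derivative ?z (at t))) * indicator {0..\<tau>} t)
        \<le> ennreal (speed A \<rho> \<gamma> t) * indicator {0..1} t"
    proof eventually_elim
      case (elim t)
      show ?case
      proof (cases "t \<in> {0..\<tau>}")
        case True
        then have t: "t \<in> {0<..<\<tau>} - S" using elim by auto
        then have t1: "t \<in> {0<..<1}" using \<tau>01 by auto
        have \<gamma>t: "\<gamma> t \<in> fst c" using img True by blast
        have "speed A \<rho> \<gamma> t = sqrt (\<rho> c (snd c (\<gamma> t))) * cmod (vector_derivative ?z (at t))"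
          by (rule speed_eq[OF c path_eventually_in[OF path t1 chart(1)[OF c] \<gamma>t] der[OF t]])
        moreover have "k * cmod (vector_derivative ?z (at t))
            \<le> sqrt (\<rho> c (snd c (\<gamma> t))) * cmod (vector_derivative ?z (at t))"
          using Kc[OF inK[OF True]] by (intro mult_right_mono k(2)) auto
        ultimately have "ennreal (k * cmod (vector_derivative ?z (at t))) \<le> ennreal (speed A \<rho> \<gamma> t)"
          by (intro ennreal_leI) simp
        then show ?thesis using True t1 k(1) by (simp add: ennreal_mult)
      qed simp
    qed
  qed
  finally show ?thesis using k(1) r by (simp add: ennreal_mult)
qed

text \<open>
  Every neighbourhood of \<open>p\<close> contains a ball for the distance. This yields both that distinct points have
  positive distance and that metric convergence implies topological convergence.
\<close>

lemma edist_lower_bound: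
  assumes p: "p \<in> V" and V: "openin X V"
  obtains k where "k > 0" "\<And>q. q \<notin> V \<Longrightarrow> ennreal k \<le> edist p q"
proof -
  have "p \<in> topspace X" using p V openin_subset by blast
  then obtain c where c: "c \<in> A" "p \<in> fst c" using ex_chart by blast
  have "open (snd c ` (fst c \<inter> V))"
    using V chart(1)[OF c(1)] by (intro open_chart_image[OF c(1)]) auto
  moreover have "snd c p \<in> snd c ` (fst c \<inter> V)" using c p by blast
  ultimately obtain r where r: "r > 0" "cball (snd c p) r \<subseteq> snd c ` (fst c \<inter> V)"
    using open_contains_cball by blast
  have rD: "cball (snd c p) r \<subseteq> snd c ` fst c" using r(2) by blast
  have "continuous_on (cball (snd c p) r) (\<lambda>z. sqrt (\<rho> c z))"
    by (intro continuous_intros continuous_on_subset[OF density_continuous[OF c(1)] rD])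
  then obtain z1 where z1: "z1 \<in> cball (snd c p) r"
    "\<And>z. z \<in> cball (snd c p) r \<Longrightarrow> sqrt (\<rho> c z1) \<le> sqrt (\<rho> c z)"
    using continuous_attains_inf[of "cball (snd c p) r" "\<lambda>z. sqrt (\<rho> c z)"] r(1) by auto
  obtain p1 where "p1 \<in> fst c" "z1 = snd c p1" using z1(1) rD by blast
  then have k: "sqrt (\<rho> c z1) > 0" using density_pos[OF c(1)] by simp
  show ?thesis
  proof (rule that)
    show "sqrt (\<rho> c z1) * r > 0" using k r by simp
    fix q assume q: "q \<notin> V"
    show "ennreal (sqrt (\<rho> c z1) * r) \<le> edist p q"
    proof (rule le_edist)
      fix \<gamma> assume \<gamma>: "piecewise_C1_path X A \<gamma>" "\<gamma> 0 = p" "\<gamma> 1 = q"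
      show "ennreal (sqrt (\<rho> c z1) * r) \<le> path_len A \<rho> \<gamma>"
      proof (rule path_leaving_chart_ball_long[OF c(1) r(1) rD k z1(2) \<gamma>(1)])
        show "\<not> (\<gamma> 1 \<in> fst c \<and> snd c (\<gamma> 1) \<in> ball (snd c p) r)"
        proof
          assume a: "\<gamma> 1 \<in> fst c \<and> snd c (\<gamma> 1) \<in> ball (snd c p) r"
          then have "snd c q \<in> snd c ` (fst c \<inter> V)" using r(2) \<gamma>(3) by auto
          then have "q \<in> V" using a \<gamma>(3) chart_inj[OF c(1)] by (auto dest: inj_onD)
          then show False using q by simp
        qed
      qed (use \<gamma> c in auto)
    qed
  qed
qed

lemma metric_dist_eq_edist:
  assumes "p \<in> topspace X" "q \<in> topspace X"
  shows "ennreal (metric_dist X A \<rho> p q) = edist p q"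
  using edist_finite[OF assms] by (simp add: metric_dist_edist)

sublocale Metric: Metric_space "topspace X" "metric_dist X A \<rho>"
proof
  show "0 \<le> metric_dist X A \<rho> p q" for p q by (simp add: metric_dist_edist)
  show "metric_dist X A \<rho> p q = metric_dist X A \<rho> q p" for p q
    by (simp add: metric_dist_edist edist_sym[of p q])
  show "(metric_dist X A \<rho> p q = 0) = (p = q)" if "p \<in> topspace X" "q \<in> topspace X" for p q
  proof
    assume 0: "metric_dist X A \<rho> p q = 0"
    show "p = q"
    proof (rule ccontr)
      assume "p \<noteq> q"
      define V where "V = topspace X - {q}"
      have "closedin X {q}" using Hausdorff that closedin_Hausdorff_sing_eq by metis
      then have V: "openin X V" "p \<in> V" "q \<notin> V"
        using \<open>p \<noteq> q\<close> that by (auto simp: V_def)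
      obtain k where "k > 0" "\<And>q. q \<notin> V \<Longrightarrow> ennreal k \<le> edist p q"
        using edist_lower_bound[OF V(2,1)] by blast
      then have "ennreal k \<le> 0" using V(3) metric_dist_eq_edist[OF that] 0 by (metis ennreal_0)
      then show False using \<open>k > 0\<close> by simp
    qed
  qed (simp add: metric_dist_edist edist_refl that)
  show "metric_dist X A \<rho> p r \<le> metric_dist X A \<rho> p q + metric_dist X A \<rho> q r"
    if "p \<in> topspace X" "q \<in> topspace X" "r \<in> topspace X" for p q r
    unfolding metric_dist_edist
  proof -
    have fin: "edist p q < top" "edist q r < top" using edist_finite that by auto
    then have "enn2real (edist p r) \<le> enn2real (edist p q + edist q r)"
      by (intro enn2real_mono edist_triangle) (simp add: ennreal_add_less_top)
    also have "\<dots> = enn2real (edist p q) + enn2real (edist q r)"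
      by (rule enn2real_plus[OF fin])
    finally show "enn2real (edist p r) \<le> enn2real (edist p q) + enn2real (edist q r)" .
  qed
qed

lemma limitin_if_limitin_metric:
  assumes "limitin Metric.mtopology \<sigma> p F"
  shows "limitin X \<sigma> p F"
proof -
  have p: "p \<in> topspace X" and lim: "\<And>e. e > 0 \<Longrightarrow> \<forall>\<^sub>F n in F. \<sigma> n \<in> topspace X \<and> metric_dist X A \<rho> (\<sigma> n) p < e"
    using assms by (auto simp: Metric.limitin_metric)
  show ?thesis
    unfolding limitin_def
  proof (intro conjI p allI impI)
    fix V assume V: "openin X V \<and> p \<in> V"
    then obtain k where k: "k > 0" "\<And>q. q \<notin> V \<Longrightarrow> ennreal k \<le> edist p q"
      using edist_lower_bound by metis
    from lim[OF k(1)] show "\<forall>\<^sub>F n in F. \<sigma> n \<in> V"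
    proof eventually_elim
      case (elim n)
      show ?case
      proof (rule ccontr)
        assume "\<sigma> n \<notin> V"
        then have "ennreal k \<le> ennreal (metric_dist X A \<rho> p (\<sigma> n))"
          using k(2) metric_dist_eq_edist[OF p] elim by simp
        then show False using elim Metric.commute[of p "\<sigma> n"] k(1) by (simp add: ennreal_le_iff2)
      qed
    qed
  qed
qed

end

lemma (in Metric_space) MCauchy_if_summable_steps:
  assumes \<sigma>: "range \<sigma> \<subseteq> M" and a: "summable a" and step: "\<And>n. d (\<sigma> n) (\<sigma> (Suc n)) \<le> a n"
  shows "MCauchy \<sigma>"
proof -
  have \<sigma>M: "\<sigma> n \<in> M" for n using \<sigma> by auto
  have chain: "d (\<sigma> n) (\<sigma> (n + k)) \<le> sum a {n..<n + k}" for n k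
  proof (induction k)
    case (Suc k)
    have "d (\<sigma> n) (\<sigma> (n + Suc k)) \<le> d (\<sigma> n) (\<sigma> (n + k)) + d (\<sigma> (n + k)) (\<sigma> (Suc (n + k)))"
      using triangle[OF \<sigma>M \<sigma>M \<sigma>M] by simp
    then show ?case using Suc step[of "n + k"] by simp
  qed (simp add: \<sigma>M)
  have le: "d (\<sigma> n) (\<sigma> k) < e"
    if "n \<le> k" "n \<ge> N" and N: "\<forall>m\<ge>N. \<forall>n. norm (sum a {m..<n}) < e" for n k N e
  proof -
    have "d (\<sigma> n) (\<sigma> k) \<le> sum a {n..<k}" using chain[of n "k - n"] that by simp
    also have "\<dots> < e" using N that(2) by (smt (verit) real_norm_def)
    finally show ?thesis .
  qed
  show ?thesis
    unfolding MCauchy_def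
  proof (intro conjI \<sigma> allI impI)
    fix e :: real assume "e > 0"
    then obtain N where N: "\<forall>m\<ge>N. \<forall>n. norm (sum a {m..<n}) < e"
      using a unfolding summable_Cauchy by blast
    show "\<exists>N. \<forall>n n'. N \<le> n \<longrightarrow> N \<le> n' \<longrightarrow> d (\<sigma> n) (\<sigma> n') < e"
    proof (intro exI[of _ N] allI impI)
      fix n n' assume "N \<le> n" "N \<le> n'"
      then show "d (\<sigma> n) (\<sigma> n') < e"
        using le[of n n' N e] le[of n' n N e] N commute[of "\<sigma> n" "\<sigma> n'"] by (cases "n \<le> n'") auto
    qed
  qed
qed

section \<open>Complex-time flow of a holomorphic vector field\<close>

locale holomorphic_vector_field = riemann X A for X :: "'a topology" and A +
  fixes V :: "'a chart \<Rightarrow> complex \<Rightarrow> complex"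
  assumes field_holomorphic: "c \<in> A \<Longrightarrow> V c holomorphic_on (snd c ` fst c)"
    and field_change: "c \<in> A \<Longrightarrow> c' \<in> A \<Longrightarrow> p \<in> fst c \<Longrightarrow> p \<in> fst c' \<Longrightarrow>
      V c' (snd c' p) = deriv (transition c c') (snd c p) * V c (snd c p)"
begin

text \<open>
  One chart suffices in the definition of an integral curve, because the components of the vector field
  transform like the derivative of the curve.
\<close>

definition flow_at :: "(complex \<Rightarrow> 'a) \<Rightarrow> complex \<Rightarrow> bool" where
  "flow_at \<Phi> w \<longleftrightarrow> (\<exists>c\<in>A. (\<forall>\<^sub>F y in nhds w. \<Phi> y \<in> fst c) \<and>
     (snd c \<circ> \<Phi> has_field_derivative V c (snd c (\<Phi> w))) (at w))"

definition flow_on :: "complex set \<Rightarrow> (complex \<Rightarrow> 'a) \<Rightarrow> bool" where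
  "flow_on S \<Phi> \<longleftrightarrow> (\<forall>w\<in>S. flow_at \<Phi> w)"

lemma flow_on_subset: "flow_on S \<Phi> \<Longrightarrow> T \<subseteq> S \<Longrightarrow> flow_on T \<Phi>"
  by (auto simp: flow_on_def)

lemma flow_on_imp_holo_curve:
  assumes "flow_on S \<Phi>"
  shows "holo_curve S \<Phi>"
  unfolding holo_curve_def
proof
  fix w assume "w \<in> S"
  then obtain c where "c \<in> A" "\<forall>\<^sub>F y in nhds w. \<Phi> y \<in> fst c"
      "(snd c \<circ> \<Phi> has_field_derivative V c (snd c (\<Phi> w))) (at w)"
    using assms unfolding flow_on_def flow_at_def by blast
  then show "\<exists>c\<in>A. (\<forall>\<^sub>F y in nhds w. \<Phi> y \<in> fst c) \<and> (snd c \<circ> \<Phi>) field_differentiable (at w)"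
    unfolding field_differentiable_def by blast
qed

lemma flow_derivative:
  assumes \<Phi>: "flow_on S \<Phi>" and w: "w \<in> S" and c: "c \<in> A" "\<Phi> w \<in> fst c"
  shows "(snd c \<circ> \<Phi> has_field_derivative V c (snd c (\<Phi> w))) (at w)"
proof -
  obtain c' where c': "c' \<in> A" "\<forall>\<^sub>F y in nhds w. \<Phi> y \<in> fst c'"
    "(snd c' \<circ> \<Phi> has_field_derivative V c' (snd c' (\<Phi> w))) (at w)"
    using \<Phi> w unfolding flow_on_def flow_at_def by blast
  have wc': "\<Phi> w \<in> fst c'" using c'(2) eventually_nhds_x_imp_x by blast
  have "((snd c \<circ> \<Phi>) has_derivative
      (\<lambda>h. deriv (transition c' c) (snd c' (\<Phi> w)) * (V c' (snd c' (\<Phi> w)) * h))) (at w)"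
    using chart_change_has_derivative[where f = \<Phi> and x = w, OF c'(1) c c'(2)] c'(3)
    by (simp add: has_field_derivative_def)
  moreover have "(\<lambda>h. deriv (transition c' c) (snd c' (\<Phi> w)) * (V c' (snd c' (\<Phi> w)) * h))
      = (*) (V c (snd c (\<Phi> w)))"
    unfolding field_change[OF c'(1) c(1) wc' c(2)] by (simp add: fun_eq_iff mult.assoc)
  ultimately show ?thesis by (simp add: has_field_derivative_def)
qed

lemma flow_at_cong:
  assumes "flow_at \<Phi> w" "\<forall>\<^sub>F y in nhds w. \<Phi> y = \<Psi> y"
  shows "flow_at \<Psi> w"
proof -
  obtain c where c: "c \<in> A" "\<forall>\<^sub>F y in nhds w. \<Phi> y \<in> fst c"
      "(snd c \<circ> \<Phi> has_field_derivative V c (snd c (\<Phi> w))) (at w)"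
    using assms unfolding flow_at_def by blast
  have eq: "\<Phi> w = \<Psi> w" using assms(2) eventually_nhds_x_imp_x by blast
  have "\<forall>\<^sub>F y in nhds w. \<Psi> y \<in> fst c" using c(2) assms(2) by eventually_elim simp
  moreover have "(snd c \<circ> \<Psi> has_field_derivative V c (snd c (\<Psi> w))) (at w)"
  proof -
    have "\<forall>\<^sub>F y in nhds w. (snd c \<circ> \<Phi>) y = (snd c \<circ> \<Psi>) y" using assms(2) by eventually_elim simp
    then show ?thesis
      using c(3) has_derivative_transform_nhds unfolding has_field_derivative_def eq by blast
  qed
  ultimately show ?thesis using c(1) unfolding flow_at_def by blast
qed

lemma flow_unique_near:
  assumes \<Phi>: "flow_on S \<Phi>" and \<Psi>: "flow_on S \<Psi>" and S: "open S" and w: "w \<in> S" and eq: "\<Phi> w = \<Psi> w"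
  shows "\<forall>\<^sub>F y in nhds w. \<Phi> y = \<Psi> y"
proof -
  have "\<Phi> w \<in> topspace X" using holo_curve_topspace[OF flow_on_imp_holo_curve[OF \<Phi>] w] .
  then obtain c where c: "c \<in> A" "\<Phi> w \<in> fst c" using ex_chart by blast
  have ev: "\<forall>\<^sub>F y in nhds w. F y \<in> fst c \<and> (snd c \<circ> F) y \<in> snd c ` fst c \<and>
      (snd c \<circ> F has_field_derivative V c ((snd c \<circ> F) y)) (at y)"
    if F: "flow_on S F" "F w \<in> fst c" for F
  proof -
    have "\<forall>\<^sub>F y in nhds w. F y \<in> fst c"
      by (rule holo_curve_in_chart(1)[OF flow_on_imp_holo_curve[OF F(1)] w c(1) F(2)])
    moreover have "\<forall>\<^sub>F y in nhds w. y \<in> S" using S w by (rule eventually_nhds_in_open)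
    ultimately show ?thesis
      by eventually_elim (use flow_derivative[OF F(1) _ c(1)] in auto)
  qed
  have 1: "\<forall>\<^sub>F y in nhds w. (snd c \<circ> \<Phi>) y = (snd c \<circ> \<Psi>) y"
  proof (rule complex_ode_local_uniqueness[OF field_holomorphic[OF c(1)] chart(2)[OF c(1)]])
    show "\<forall>\<^sub>F y in nhds w. (snd c \<circ> \<Phi>) y \<in> snd c ` fst c \<and>
        (snd c \<circ> \<Phi> has_field_derivative V c ((snd c \<circ> \<Phi>) y)) (at y)"
      using ev[OF \<Phi> c(2)] by eventually_elim blast
    show "\<forall>\<^sub>F y in nhds w. (snd c \<circ> \<Psi>) y \<in> snd c ` fst c \<and>
        (snd c \<circ> \<Psi> has_field_derivative V c ((snd c \<circ> \<Psi>) y)) (at y)"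
      using ev[OF \<Psi> c(2)[unfolded eq]] by eventually_elim blast
  qed (simp add: eq)
  show ?thesis
    using 1 ev[OF \<Phi> c(2)] ev[OF \<Psi> c(2)[unfolded eq]]
    by eventually_elim (use chart_inj[OF c(1)] in \<open>auto dest: inj_onD\<close>)
qed

text \<open>
  The set of agreement is open by local uniqueness, and its complement is open since the surface is
  Hausdorff.
\<close>

lemma flow_unique:
  assumes \<Phi>: "flow_on S \<Phi>" and \<Psi>: "flow_on S \<Psi>" and S: "open S" "connected S"
    and a: "a \<in> S" "\<Phi> a = \<Psi> a" and w: "w \<in> S"
  shows "\<Phi> w = \<Psi> w"
proof (rule ccontr)
  assume ne: "\<Phi> w \<noteq> \<Psi> w"
  define E where "E = {y \<in> S. \<Phi> y = \<Psi> y}"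
  have "open E"
  proof (rule openI)
    fix y assume y: "y \<in> E"
    then have "\<forall>\<^sub>F x in nhds y. \<Phi> x = \<Psi> x"
      using flow_unique_near[OF \<Phi> \<Psi> S(1)] by (auto simp: E_def)
    moreover have "\<forall>\<^sub>F x in nhds y. x \<in> S" using S y by (intro eventually_nhds_in_open) (auto simp: E_def)
    ultimately have "\<forall>\<^sub>F x in nhds y. x \<in> E" by eventually_elim (simp add: E_def)
    then show "\<exists>e>0. ball y e \<subseteq> E"
      unfolding eventually_nhds_metric by (auto simp: dist_commute subset_iff)
  qed
  have "open (S - E)"
  proof (rule openI)
    fix y assume y: "y \<in> S - E"
    have top: "\<Phi> y \<in> topspace X" "\<Psi> y \<in> topspace X"
      using y holo_curve_topspace[OF flow_on_imp_holo_curve] \<Phi> \<Psi> by blast+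
    have "\<Phi> y \<noteq> \<Psi> y" using y by (auto simp: E_def)
    then obtain U1 U2 where U: "openin X U1" "openin X U2" "\<Phi> y \<in> U1" "\<Psi> y \<in> U2" "disjnt U1 U2"
      using Hausdorff top unfolding Hausdorff_space_def by metis
    have "open ({y \<in> S. \<Phi> y \<in> U1} \<inter> {y \<in> S. \<Psi> y \<in> U2})"
      by (intro open_Int holo_curve_openin flow_on_imp_holo_curve \<Phi> \<Psi> S U)
    moreover have "y \<in> {y \<in> S. \<Phi> y \<in> U1} \<inter> {y \<in> S. \<Psi> y \<in> U2}" using y U by auto
    moreover have "{y \<in> S. \<Phi> y \<in> U1} \<inter> {y \<in> S. \<Psi> y \<in> U2} \<subseteq> S - E"
      using U(5) by (auto simp: E_def disjnt_iff)
    ultimately show "\<exists>e>0. ball y e \<subseteq> S - E" by (meson openE order_trans)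
  qed
  moreover have "E \<inter> (S - E) = {}" "S \<subseteq> E \<union> (S - E)" by auto
  ultimately have "E \<inter> S = {} \<or> (S - E) \<inter> S = {}"
    using connectedD[OF S(2) \<open>open E\<close>, of "S - E"] by blast
  then show False using a w ne by (auto simp: E_def)
qed

lemma flow_glue:
  assumes S: "\<And>i. i \<in> I \<Longrightarrow> open (S i)" and F: "\<And>i. i \<in> I \<Longrightarrow> flow_on (S i) (F i)"
    and agree: "\<And>i j w. i \<in> I \<Longrightarrow> j \<in> I \<Longrightarrow> w \<in> S i \<Longrightarrow> w \<in> S j \<Longrightarrow> F i w = F j w"
  obtains \<Phi> where "flow_on (\<Union>i\<in>I. S i) \<Phi>" "\<And>i w. i \<in> I \<Longrightarrow> w \<in> S i \<Longrightarrow> \<Phi> w = F i w"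
proof -
  define \<Phi> where "\<Phi> w = F (SOME i. i \<in> I \<and> w \<in> S i) w" for w
  have eq: "\<Phi> w = F i w" if "i \<in> I" "w \<in> S i" for i w
    using someI[of "\<lambda>i. i \<in> I \<and> w \<in> S i" i] that agree unfolding \<Phi>_def by blast
  have "flow_on (\<Union>i\<in>I. S i) \<Phi>"
    unfolding flow_on_def
  proof
    fix w assume "w \<in> (\<Union>i\<in>I. S i)"
    then obtain i where i: "i \<in> I" "w \<in> S i" by blast
    have "\<forall>\<^sub>F y in nhds w. F i y = \<Phi> y"
      using eventually_nhds_in_open[OF S[OF i(1)] i(2)] by eventually_elim (simp add: eq[OF i(1)])
    then show "flow_at \<Phi> w"
      using F[OF i(1)] i(2) flow_at_cong[of "F i"] by (auto simp: flow_on_def)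
  qed
  then show ?thesis by (rule that[OF _ eq])
qed

lemma flow_local_existence:
  assumes q: "q \<in> topspace X"
  obtains U \<epsilon> where "openin X U" "q \<in> U" "\<epsilon> > 0"
    "\<And>p w0. p \<in> U \<Longrightarrow> \<exists>\<Psi>. flow_on (ball w0 \<epsilon>) \<Psi> \<and> \<Psi> w0 = p"
proof -
  obtain c where c: "c \<in> A" "q \<in> fst c" using ex_chart[OF q] by blast
  obtain r where r: "r > 0" "ball (snd c q) r \<subseteq> snd c ` fst c"
    using chart(2)[OF c(1)] c(2) by (meson imageI openE)
  obtain \<epsilon> where \<epsilon>: "\<epsilon> > 0"
    "\<And>\<zeta>. \<zeta> \<in> ball (snd c q) \<epsilon> \<Longrightarrow> \<exists>\<Psi>. \<Psi> 0 = \<zeta> \<and> \<Psi> ` ball 0 \<epsilon> \<subseteq> ball (snd c q) r \<and>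
        (\<forall>w\<in>ball 0 \<epsilon>. (\<Psi> has_field_derivative V c (\<Psi> w)) (at w))"
    using complex_ode_local_existence[OF holomorphic_on_subset[OF field_holomorphic[OF c(1)] r(2)] r(1)] by blast
  show ?thesis
  proof (rule that)
    show "openin X {p \<in> fst c. snd c p \<in> ball (snd c q) \<epsilon>}"
      by (rule openin_chart_vimage[OF c(1) open_ball])
    show "q \<in> {p \<in> fst c. snd c p \<in> ball (snd c q) \<epsilon>}" using c \<epsilon>(1) by simp
    fix p w0 assume p: "p \<in> {p \<in> fst c. snd c p \<in> ball (snd c q) \<epsilon>}"
    then obtain \<psi> where \<psi>: "\<psi> 0 = snd c p" "\<psi> ` ball 0 \<epsilon> \<subseteq> ball (snd c q) r"
      "\<And>w. w \<in> ball 0 \<epsilon> \<Longrightarrow> (\<psi> has_field_derivative V c (\<psi> w)) (at w)"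
      using \<epsilon>(2)[of "snd c p"] by auto
    define \<Psi> where "\<Psi> w = chart_inv c (\<psi> (w - w0))" for w
    have inD: "\<psi> (w - w0) \<in> snd c ` fst c" if "w \<in> ball w0 \<epsilon>" for w
    proof -
      have "w - w0 \<in> ball 0 \<epsilon>" using that by (simp add: dist_norm norm_minus_commute)
      then show ?thesis using \<psi>(2) r(2) by blast
    qed
    have "flow_on (ball w0 \<epsilon>) \<Psi>"
      unfolding flow_on_def flow_at_def
    proof (intro ballI bexI[of _ c] conjI c(1))
      fix w assume w: "w \<in> ball w0 \<epsilon>"
      show "\<forall>\<^sub>F y in nhds w. \<Psi> y \<in> fst c"
        using eventually_nhds_in_open[OF open_ball w]
        by eventually_elim (use inD chart_inv_in[OF c(1)] in \<open>auto simp: \<Psi>_def\<close>)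
      have "w - w0 \<in> ball 0 \<epsilon>" using w by (simp add: dist_norm norm_minus_commute)
      then have "((\<lambda>y. \<psi> (y - w0)) has_field_derivative V c (\<psi> (w - w0)) * 1) (at w)"
        by (intro DERIV_chain2[OF \<psi>(3)]) (auto intro!: derivative_eq_intros)
      then have "(snd c \<circ> \<Psi> has_field_derivative V c (\<psi> (w - w0)) * 1) (at w)"
        by (rule has_field_derivative_transform_within_open[OF _ open_ball w])
          (simp add: \<Psi>_def chart_chart_inv[OF c(1) inD] del: mem_ball)
      then show "(snd c \<circ> \<Psi> has_field_derivative V c (snd c (\<Psi> w))) (at w)"
        using inD[OF w] by (simp add: \<Psi>_def chart_chart_inv[OF c(1)])
    qed
    moreover have "\<Psi> w0 = p" using p \<psi>(1) by (simp add: \<Psi>_def chart_inv_chart[OF c(1)])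
    ultimately show "\<exists>\<Psi>. flow_on (ball w0 \<epsilon>) \<Psi> \<and> \<Psi> w0 = p" by blast
  qed (rule \<epsilon>(1))
qed

text \<open>
  Once the points on the ray to \<open>a\<close> are close to the limit \<open>q\<close>, the integral curves starting there exist
  on a disc of fixed radius, which covers \<open>a\<close> as soon as the starting time is close enough to \<open>a\<close>.
\<close>

lemma flow_extends_at_boundary_point:
  assumes \<Phi>: "flow_on (ball 0 R) \<Phi>" and a: "cmod a = R" "R > 0"
    and q: "limitin X (\<lambda>n. \<Phi> (of_real (1 - (1 / 2) ^ n) * a)) q sequentially"
  shows "\<exists>\<epsilon> \<Psi>. \<epsilon> > 0 \<and> flow_on (ball a \<epsilon>) \<Psi> \<and> (\<forall>w\<in>ball a \<epsilon> \<inter> ball 0 R. \<Psi> w = \<Phi> w)"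
proof -
  let ?w = "\<lambda>n. complex_of_real (1 - (1 / 2) ^ n) * a"
  have "q \<in> topspace X" using q by (simp add: limitin_def)
  then obtain U \<epsilon> where U: "openin X U" "q \<in> U" "\<epsilon> > 0"
    "\<And>p w0. p \<in> U \<Longrightarrow> \<exists>\<Psi>. flow_on (ball w0 \<epsilon>) \<Psi> \<and> \<Psi> w0 = p"
    using flow_local_existence by metis
  have ev1: "\<forall>\<^sub>F n in sequentially. \<Phi> (?w n) \<in> U"
    using q U by (auto simp: limitin_def)
  have "(\<lambda>n. (1 / 2) ^ n * R) \<longlonglongrightarrow> 0 * R" by (intro tendsto_intros) auto
  then have ev2: "\<forall>\<^sub>F n in sequentially. (1 / 2) ^ n * R < \<epsilon> / 2"
    using U(3) by (intro order_tendstoD) auto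
  obtain n where n: "\<Phi> (?w n) \<in> U" "(1 / 2) ^ n * R < \<epsilon> / 2"
    using eventually_happens[OF eventually_conj[OF ev1 ev2]] by auto
  obtain \<Psi> where \<Psi>: "flow_on (ball (?w n) \<epsilon>) \<Psi>" "\<Psi> (?w n) = \<Phi> (?w n)" using U(4)[OF n(1)] by blast
  have dist: "dist (?w n) a = (1 / 2) ^ n * R"
  proof -
    have "?w n - a = - (of_real ((1 / 2) ^ n) * a)" by (simp add: algebra_simps)
    then show ?thesis using a by (simp add: dist_norm norm_mult norm_power norm_divide)
  qed
  have sub: "ball a (\<epsilon> / 2) \<subseteq> ball (?w n) \<epsilon>"
  proof
    fix y assume "y \<in> ball a (\<epsilon> / 2)"
    then show "y \<in> ball (?w n) \<epsilon>"
      using dist_triangle[of "?w n" y a] dist n(2) by simp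
  qed
  have "cmod (?w n) = (1 - (1 / 2) ^ n) * R"
    using a by (simp add: norm_mult power_le_one del: of_real_diff of_real_power)
  also have "\<dots> < R" using a(2) by simp
  finally have wn: "?w n \<in> ball 0 R" by simp
  have "\<Psi> w = \<Phi> w" if "w \<in> ball a (\<epsilon> / 2) \<inter> ball 0 R" for w
  proof (rule flow_unique[of "ball (?w n) \<epsilon> \<inter> ball 0 R" \<Psi> \<Phi> "?w n"])
    show "connected (ball (?w n) \<epsilon> \<inter> ball 0 R)"
      by (intro convex_connected convex_Int convex_ball)
  qed (use \<Psi> \<Phi> wn U(3) sub that in \<open>auto intro: flow_on_subset\<close>)
  then show ?thesis using U(3) flow_on_subset[OF \<Psi>(1) sub] by (intro exI[of _ "\<epsilon> / 2"] exI[of _ \<Psi>]) auto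
qed

text \<open>
  The local extensions agree on overlaps, so they fit together on a neighbourhood of the closed disc,
  and this contains a larger concentric disc by compactness.
\<close>

lemma flow_extends_past_ball:
  assumes \<Phi>: "flow_on (ball 0 R) \<Phi>" and R: "R > 0"
    and bdry: "\<And>a. cmod a = R \<Longrightarrow>
      \<exists>\<epsilon> \<Psi>. \<epsilon> > 0 \<and> flow_on (ball a \<epsilon>) \<Psi> \<and> (\<forall>w\<in>ball a \<epsilon> \<inter> ball 0 R. \<Psi> w = \<Phi> w)"
  shows "\<exists>R' \<Phi>'. R' > R \<and> flow_on (ball 0 R') \<Phi>' \<and> \<Phi>' 0 = \<Phi> 0"
proof -
  obtain \<epsilon> \<Psi> where \<epsilon>: "\<And>a. cmod a = R \<Longrightarrow> \<epsilon> a > 0" and \<Psi>: "\<And>a. cmod a = R \<Longrightarrow> flow_on (ball a (\<epsilon> a)) (\<Psi> a)"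
    and eq: "\<And>a w. cmod a = R \<Longrightarrow> w \<in> ball a (\<epsilon> a) \<Longrightarrow> w \<in> ball 0 R \<Longrightarrow> \<Psi> a w = \<Phi> w"
    using bdry by (metis IntI)
  define I where "I = insert None (Some ` sphere (0::complex) R)"
  define S where "S i = (case i of None \<Rightarrow> ball 0 R | Some a \<Rightarrow> ball a (\<epsilon> a))" for i
  define F where "F i = (case i of None \<Rightarrow> \<Phi> | Some a \<Rightarrow> \<Psi> a)" for i
  \<comment> \<open>Two intersecting boundary balls meet inside the big ball, on the chord between their centres.\<close>
  have agree: "\<Psi> a w = \<Psi> b w"
    if a: "cmod a = R" and b: "cmod b = R" and w: "w \<in> ball a (\<epsilon> a)" "w \<in> ball b (\<epsilon> b)" for a b w
  proof (cases "a = b")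
    case False
    have \<epsilon>ab: "\<epsilon> a > 0" "\<epsilon> b > 0" using \<epsilon> a b by auto
    have dab: "cmod (b - a) < \<epsilon> a + \<epsilon> b"
      using dist_triangle[of a b w] w by (simp add: dist_norm norm_minus_commute)
    define t where "t = \<epsilon> a / (\<epsilon> a + \<epsilon> b)"
    have t: "0 < t" "t < 1" "1 - t = \<epsilon> b / (\<epsilon> a + \<epsilon> b)"
      using \<epsilon>ab by (auto simp: t_def field_simps)
    define u where "u = (1 - t) *\<^sub>R a + t *\<^sub>R b"
    have ua: "u - a = t *\<^sub>R (b - a)" and ub: "u - b = (1 - t) *\<^sub>R (a - b)"
      by (auto simp: u_def algebra_simps)
    have "cmod (u - a) < t * (\<epsilon> a + \<epsilon> b)" unfolding ua using t dab by simp
    then have u1: "u \<in> ball a (\<epsilon> a)" using \<epsilon>ab by (simp add: t_def dist_norm norm_minus_commute)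
    have "cmod (u - b) < (1 - t) * (\<epsilon> a + \<epsilon> b)"
      unfolding ub using t(2) dab by (simp add: norm_minus_commute)
    then have u2: "u \<in> ball b (\<epsilon> b)" using \<epsilon>ab unfolding t(3) by (simp add: dist_norm norm_minus_commute)
    have "u \<in> open_segment a b" using t False by (auto simp: in_segment u_def)
    then have "u \<in> ball 0 R" using dist_decreases_open_segment[of u a b 0] a b by auto
    then have "\<Psi> a u = \<Psi> b u" using eq a b u1 u2 by simp
    moreover have "connected (ball a (\<epsilon> a) \<inter> ball b (\<epsilon> b))"
      by (intro convex_connected convex_Int convex_ball)
    ultimately show ?thesis
      using u1 u2 w flow_on_subset[OF \<Psi>[OF a]] flow_on_subset[OF \<Psi>[OF b]]
      by (intro flow_unique[of "ball a (\<epsilon> a) \<inter> ball b (\<epsilon> b)" "\<Psi> a" "\<Psi> b" u w]) auto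
  qed simp
  obtain \<Phi>' where \<Phi>': "flow_on (\<Union>i\<in>I. S i) \<Phi>'" "\<And>i w. i \<in> I \<Longrightarrow> w \<in> S i \<Longrightarrow> \<Phi>' w = F i w"
  proof (rule flow_glue[of I S F])
    show "open (S i)" if "i \<in> I" for i by (simp add: S_def split: option.split)
    show "flow_on (S i) (F i)" if "i \<in> I" for i
      using that \<Phi> \<Psi> by (cases i) (auto simp: I_def S_def F_def)
    show "F i w = F j w" if "i \<in> I" "j \<in> I" "w \<in> S i" "w \<in> S j" for i j w
    proof -
      have SomeI: "cmod a = R \<and> w \<in> ball a (\<epsilon> a)" if "Some a \<in> I" "w \<in> S (Some a)" for a
        using that by (auto simp: I_def S_def)
      have NoneI: "w \<in> ball 0 R" if "w \<in> S None" using that by (simp add: S_def)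
      show ?thesis
      proof (cases i)
        case i: None
        show ?thesis
        proof (cases j)
          case j: (Some b)
          have "\<Psi> b w = \<Phi> w" using eq SomeI[of b] NoneI that i j by blast
          then show ?thesis by (simp add: F_def i j)
        qed (simp add: i)
      next
        case i: (Some a)
        then have a: "cmod a = R \<and> w \<in> ball a (\<epsilon> a)" using SomeI that by blast
        show ?thesis
        proof (cases j)
          case j: None
          have "\<Psi> a w = \<Phi> w" using eq a NoneI that j by blast
          then show ?thesis by (simp add: F_def i j)
        next
          case j: (Some b)
          then have "cmod b = R \<and> w \<in> ball b (\<epsilon> b)" using SomeI that by blast
          then have "\<Psi> a w = \<Psi> b w" using a by (intro agree) auto
          then show ?thesis by (simp add: F_def i j)
        qed
      qed
    qed
  qed (rule that)
  have "cball 0 R \<subseteq> (\<Union>i\<in>I. S i)"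
  proof
    fix w :: complex assume "w \<in> cball 0 R"
    then consider "w \<in> ball 0 R" | "cmod w = R" by force
    then show "w \<in> (\<Union>i\<in>I. S i)"
    proof cases
      case 1
      then show ?thesis by (intro UN_I[of None]) (auto simp: I_def S_def)
    next
      case 2
      then show ?thesis using \<epsilon> by (intro UN_I[of "Some w"]) (auto simp: I_def S_def)
    qed
  qed
  moreover have "open (\<Union>i\<in>I. S i)" by (intro open_UN ballI) (simp add: S_def split: option.split)
  ultimately obtain e where e: "e > 0" "(\<Union>x\<in>cball 0 R. ball x e) \<subseteq> (\<Union>i\<in>I. S i)"
    using compact_subset_open_imp_ball_epsilon_subset[of "cball (0::complex) R"] by (metis compact_cball)
  have "ball (0::complex) (R + e) \<subseteq> (\<Union>x\<in>cball 0 R. ball x e)"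
  proof
    fix w :: complex assume w: "w \<in> ball 0 (R + e)"
    show "w \<in> (\<Union>x\<in>cball 0 R. ball x e)"
    proof (cases "cmod w \<le> R")
      case True
      then show ?thesis using e(1) by (intro UN_I[of w]) auto
    next
      case False
      have w0: "cmod w > 0" using False R by linarith
      define x where "x = (R / cmod w) *\<^sub>R w"
      have "x - w = (R / cmod w - 1) *\<^sub>R w" by (simp add: x_def algebra_simps)
      then have "cmod (x - w) = \<bar>R / cmod w - 1\<bar> * cmod w" by simp
      also have "\<dots> = cmod w - R" using False R w0 by (simp add: abs_if field_simps)
      finally have "dist x w < e" using w by (simp add: dist_norm)
      moreover have "cmod x = R" using w0 R by (simp add: x_def)
      ultimately show ?thesis by (intro UN_I[of x]) auto
    qed
  qed
  then have "flow_on (ball 0 (R + e)) \<Phi>'" using e(2) by (intro flow_on_subset[OF \<Phi>'(1)]) blast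
  moreover have "\<Phi>' 0 = \<Phi> 0" using \<Phi>'(2)[of None 0] R by (simp add: I_def S_def F_def)
  ultimately show ?thesis using e(1) by (intro exI[of _ "R + e"] exI[of _ \<Phi>']) auto
qed

text \<open>
  If the radii of the discs on which the flow from \<open>p\<close> exists were bounded, then the flow would exist on
  the disc whose radius is their supremum, and it would extend beyond it.
\<close>

theorem flow_exists_on_all_balls:
  assumes p: "p \<in> topspace X" and R: "R > 0"
    and rays_converge: "\<And>R \<Phi> a. R > 0 \<Longrightarrow> flow_on (ball 0 R) \<Phi> \<Longrightarrow> \<Phi> 0 = p \<Longrightarrow> cmod a = R \<Longrightarrow>
      \<exists>q. limitin X (\<lambda>n. \<Phi> (of_real (1 - (1 / 2) ^ n) * a)) q sequentially"
  shows "\<exists>\<Phi>. flow_on (ball 0 R) \<Phi> \<and> \<Phi> 0 = p"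
proof (rule ccontr)
  assume no: "\<not> ?thesis"
  define G where "G = {r. r > 0 \<and> (\<exists>\<Phi>. flow_on (ball 0 r) \<Phi> \<and> \<Phi> 0 = p)}"
  have ub: "r \<le> R" if "r \<in> G" for r
  proof (rule ccontr)
    assume "\<not> r \<le> R"
    then have "ball (0::complex) R \<subseteq> ball 0 r" by (simp add: subset_ball)
    then show False using that no flow_on_subset unfolding G_def by blast
  qed
  then have bdd: "bdd_above G" by (rule bdd_aboveI)
  obtain U \<epsilon> where "p \<in> U" "\<epsilon> > 0"
    "\<And>p w0. p \<in> U \<Longrightarrow> \<exists>\<Psi>. flow_on (ball w0 \<epsilon>) \<Psi> \<and> \<Psi> w0 = p"
    using flow_local_existence[OF p] by metis
  then have \<epsilon>: "\<epsilon> \<in> G" by (auto simp: G_def)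
  define R0 where "R0 = Sup G"
  have R0: "R0 > 0" using \<epsilon> cSup_upper[OF \<epsilon> bdd] by (auto simp: R0_def G_def)
  obtain F where F: "\<And>r. r \<in> G \<Longrightarrow> flow_on (ball 0 r) (F r)" "\<And>r. r \<in> G \<Longrightarrow> F r 0 = p"
  proof -
    have "\<forall>r\<in>G. \<exists>\<Phi>. flow_on (ball 0 r) \<Phi> \<and> \<Phi> 0 = p" by (auto simp: G_def)
    then show thesis using that by metis
  qed
  obtain \<Phi> where \<Phi>: "flow_on (\<Union>r\<in>G. ball 0 r) \<Phi>" "\<And>r w. r \<in> G \<Longrightarrow> w \<in> ball 0 r \<Longrightarrow> \<Phi> w = F r w"
  proof (rule flow_glue[of G "ball 0" F])
    show "F i w = F j w" if ij: "i \<in> G" "j \<in> G" and w: "w \<in> ball 0 i" "w \<in> ball 0 j" for i j w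
    proof (rule flow_unique[of "ball 0 i \<inter> ball 0 j" "F i" "F j" 0])
      show "connected (ball 0 i \<inter> ball (0::complex) j)"
        by (intro convex_connected convex_Int convex_ball)
    qed (use ij w F in \<open>auto simp: G_def intro: flow_on_subset\<close>)
    show "flow_on (ball 0 i) (F i)" if "i \<in> G" for i using F(1)[OF that] .
  qed (rule open_ball, rule that)
  have "ball 0 R0 \<subseteq> (\<Union>r\<in>G. ball (0::complex) r)"
  proof
    fix w :: complex assume "w \<in> ball 0 R0"
    then obtain r where "r \<in> G" "cmod w < r"
      using less_cSup_iff[OF _ bdd, of "cmod w"] \<epsilon> by (auto simp: R0_def)
    then show "w \<in> (\<Union>r\<in>G. ball 0 r)" by auto
  qed
  then have flow0: "flow_on (ball 0 R0) \<Phi>" by (rule flow_on_subset[OF \<Phi>(1)])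
  have \<Phi>0: "\<Phi> 0 = p" using \<Phi>(2)[OF \<epsilon>, of 0] F(2)[OF \<epsilon>] \<epsilon> by (simp add: G_def)
  have "\<exists>R' \<Phi>'. R' > R0 \<and> flow_on (ball 0 R') \<Phi>' \<and> \<Phi>' 0 = \<Phi> 0"
  proof (rule flow_extends_past_ball[OF flow0 R0])
    fix a assume a: "cmod a = R0"
    obtain q where "limitin X (\<lambda>n. \<Phi> (of_real (1 - (1 / 2) ^ n) * a)) q sequentially"
      using rays_converge[OF R0 flow0 \<Phi>0 a] by blast
    then show "\<exists>\<epsilon> \<Psi>. \<epsilon> > 0 \<and> flow_on (ball a \<epsilon>) \<Psi> \<and> (\<forall>w\<in>ball a \<epsilon> \<inter> ball 0 R0. \<Psi> w = \<Phi> w)"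
      by (rule flow_extends_at_boundary_point[OF flow0 a R0])
  qed
  then obtain R' where "R' > R0" "R' \<in> G" using \<Phi>0 R0 by (auto simp: G_def)
  then show False using cSup_upper[OF _ bdd] by (force simp: R0_def)
qed

end

section \<open>Isolated values of holomorphic functions on a surface\<close>

context riemann
begin

text \<open>
  The set of points near which \<open>G\<close> is constantly \<open>b\<close> is open. By the identity theorem in a chart, it
  contains each point at which the value \<open>b\<close> accumulates; in particular it is closed.
\<close>

lemma nonconstant_isolated_values:
  fixes G :: "'a \<Rightarrow> complex"
  assumes conn: "connected_space X"
    and G: "\<And>c. c \<in> A \<Longrightarrow> (G \<circ> chart_inv c) holomorphic_on (snd c ` fst c)"
    and nonconst: "\<not> G constant_on topspace X" and c: "c \<in> A" "z0 \<in> snd c ` fst c"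
  shows "\<forall>\<^sub>F z in at z0. G (chart_inv c z) \<noteq> b"
proof (rule ccontr)
  assume not_ev: "\<not> ?thesis"
  define I where "I = {p. \<exists>V. openin X V \<and> p \<in> V \<and> (\<forall>q\<in>V. G q = b)}"
  have Ib: "G q = b" if "q \<in> I" for q using that by (auto simp: I_def)
  have openI: "openin X I"
    unfolding openin_subopen[of X I] by (auto simp: I_def)
  have key: "p \<in> I" if c: "c \<in> A" "p \<in> fst c" and freq: "\<not> (\<forall>\<^sub>F z in at (snd c p). G (chart_inv c z) \<noteq> b)" for c p
  proof -
    obtain r where r: "r > 0" "ball (snd c p) r \<subseteq> snd c ` fst c"
      using chart(2)[OF c(1)] c(2) by (meson imageI openE)
    have lim: "snd c p islimpt {z \<in> ball (snd c p) r. G (chart_inv c z) = b}"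
      unfolding islimpt_approachable
    proof (intro allI impI)
      fix e :: real assume "e > 0"
      then have "\<not> (\<forall>z. z \<noteq> snd c p \<and> dist z (snd c p) < min e r \<longrightarrow> G (chart_inv c z) \<noteq> b)"
        using freq r(1) unfolding eventually_at by (metis UNIV_I min_less_iff_conj)
      then show "\<exists>x'\<in>{z \<in> ball (snd c p) r. G (chart_inv c z) = b}. x' \<noteq> snd c p \<and> dist x' (snd c p) < e"
        by (auto simp: dist_commute)
    qed
    have Gb: "(G \<circ> chart_inv c) z = b" if z: "z \<in> ball (snd c p) r" for z
    proof -
      have "(G \<circ> chart_inv c) z - b = 0"
      proof (rule analytic_continuation[OF _ open_ball connected_ball _ _ lim _ z])
        show "(\<lambda>z. (G \<circ> chart_inv c) z - b) holomorphic_on ball (snd c p) r"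
          by (intro holomorphic_intros holomorphic_on_subset[OF G[OF c(1)] r(2)])
      qed (use r(1) in auto)
      then show ?thesis by simp
    qed
    have "openin X {q \<in> fst c. snd c q \<in> ball (snd c p) r}" by (rule openin_chart_vimage[OF c(1) open_ball])
    moreover have "G q = b" if "q \<in> {q \<in> fst c. snd c q \<in> ball (snd c p) r}" for q
      using Gb[of "snd c q"] that by (simp add: chart_inv_chart[OF c(1)])
    moreover have "p \<in> {q \<in> fst c. snd c q \<in> ball (snd c p) r}" using c r(1) by simp
    ultimately show ?thesis unfolding I_def by blast
  qed
  have "openin X (topspace X - I)"
    unfolding openin_subopen[of X "topspace X - I"]
  proof
    fix p assume p: "p \<in> topspace X - I"
    then obtain c where c: "c \<in> A" "p \<in> fst c" using ex_chart by blast
    have "\<forall>\<^sub>F z in at (snd c p). G (chart_inv c z) \<noteq> b" using key[OF c] p by blast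
    then obtain e where e: "e > 0" "\<And>z. z \<noteq> snd c p \<Longrightarrow> dist z (snd c p) < e \<Longrightarrow> G (chart_inv c z) \<noteq> b"
      unfolding eventually_at by blast
    let ?T = "{q \<in> fst c. snd c q \<in> ball (snd c p) e}"
    have "q \<notin> I" if q: "q \<in> ?T" for q
    proof (cases "q = p")
      case False
      then have "snd c q \<noteq> snd c p" using chart_inj[OF c(1)] c q by (auto dest: inj_onD)
      then have "G (chart_inv c (snd c q)) \<noteq> b" using q by (intro e(2)) (auto simp: dist_commute)
      then show ?thesis using Ib q by (auto simp: chart_inv_chart[OF c(1)])
    qed (use p in auto)
    then have "?T \<subseteq> topspace X - I" using chart_topspace[OF c(1)] by auto
    moreover have "openin X ?T" by (rule openin_chart_vimage[OF c(1) open_ball])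
    moreover have "p \<in> ?T" using c e(1) by simp
    ultimately show "\<exists>T. openin X T \<and> p \<in> T \<and> T \<subseteq> topspace X - I" by blast
  qed
  then have "I = {} \<or> I = topspace X"
    using conn openI openin_subset[OF openI] unfolding connected_space_clopen_in by (metis closedin_def)
  moreover have "chart_inv c z0 \<in> I"
    using key[OF c(1) chart_inv_in[OF c]] not_ev chart_chart_inv[OF c] by simp
  ultimately have "I = topspace X" by blast
  then have "G constant_on topspace X" using Ib unfolding constant_on_def by blast
  then show False using nonconst by simp
qed

lemma constant_if_deriv_zero:
  fixes G :: "'a \<Rightarrow> complex"
  assumes conn: "connected_space X"
    and G: "\<And>c. c \<in> A \<Longrightarrow> (G \<circ> chart_inv c) holomorphic_on (snd c ` fst c)"
    and zero: "\<And>c p. c \<in> A \<Longrightarrow> p \<in> fst c \<Longrightarrow> deriv (G \<circ> chart_inv c) (snd c p) = 0"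
  shows "G constant_on topspace X"
proof (rule ccontr)
  assume nonconst: "\<not> ?thesis"
  then obtain p where "p \<in> topspace X" unfolding constant_on_def by blast
  then obtain c where c: "c \<in> A" "p \<in> fst c" using ex_chart by blast
  obtain r where r: "r > 0" "ball (snd c p) r \<subseteq> snd c ` fst c"
    using chart(2)[OF c(1)] c(2) by (meson imageI openE)
  have "(G \<circ> chart_inv c) constant_on ball (snd c p) r"
  proof (rule has_field_derivative_0_imp_constant_on)
    fix z assume z: "z \<in> ball (snd c p) r"
    then obtain q where q: "q \<in> fst c" "z = snd c q" using r(2) by blast
    have "z \<in> snd c ` fst c" using z r(2) by blast
    from holomorphic_derivI[OF G[OF c(1)] chart(2)[OF c(1)] this]
    show "((G \<circ> chart_inv c) has_field_derivative 0) (at z)" using zero[OF c(1) q(1)] q(2) by simp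
  qed auto
  then obtain b where b: "\<And>z. z \<in> ball (snd c p) r \<Longrightarrow> G (chart_inv c z) = b"
    unfolding constant_on_def by auto
  have "\<forall>\<^sub>F z in at (snd c p). G (chart_inv c z) \<noteq> b"
    using nonconstant_isolated_values[OF conn G nonconst c(1)] c(2) by blast
  moreover have "\<forall>\<^sub>F z in at (snd c p). z \<in> ball (snd c p) r"
    using r(1) by (intro eventually_at_in_open') auto
  ultimately have "\<forall>\<^sub>F z in at (snd c p). False" by eventually_elim (use b in auto)
  then show False by (simp add: trivial_limit_def[symmetric])
qed

end

section \<open>Representations by a holomorphic function\<close>

text \<open>
  The metric in the form \<open>\<kappa> (1 + |G|\<^sup>2)\<^sup>m |W|\<^sup>2\<close> with a function \<open>G\<close> that has no poles. Positivity of the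
  density then makes \<open>W\<close> nowhere zero.
\<close>

locale weierstrass_representation = conformal_surface X A \<rho>
  for X :: "'a topology" and A and \<rho> :: "'a chart \<Rightarrow> complex \<Rightarrow> real" +
  fixes G :: "'a \<Rightarrow> complex" and W :: "'a chart \<Rightarrow> complex \<Rightarrow> complex" and \<kappa> :: real and m :: nat
  assumes G_holomorphic: "c \<in> A \<Longrightarrow> (G \<circ> chart_inv c) holomorphic_on (snd c ` fst c)"
    and W_holomorphic: "c \<in> A \<Longrightarrow> W c holomorphic_on (snd c ` fst c)"
    and W_change: "c \<in> A \<Longrightarrow> c' \<in> A \<Longrightarrow> p \<in> fst c \<Longrightarrow> p \<in> fst c' \<Longrightarrow>
      W c (snd c p) = W c' (snd c' p) * deriv (transition c c') (snd c p)"
    and \<kappa>: "\<kappa> > 0"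
    and density_eq: "c \<in> A \<Longrightarrow> p \<in> fst c \<Longrightarrow>
      \<rho> c (snd c p) = \<kappa> * (1 + (cmod (G p))\<^sup>2) ^ m * (cmod (W c (snd c p)))\<^sup>2"

locale omitting_representation = weierstrass_representation X A \<rho> G W \<kappa> m
  for X :: "'a topology" and A and \<rho> :: "'a chart \<Rightarrow> complex \<Rightarrow> real" and G W \<kappa> m +
  fixes S :: "complex set"
  assumes S: "finite S" "card S = m + 2"
    and omits: "p \<in> topspace X \<Longrightarrow> G p \<notin> S"
    and complete: "Metric.mcomplete"
begin

text \<open>
  The value is forced: the \<open>(N+1)\<close>-th power of the line element contains \<open>1 + |G|^2\<close> to the power
  \<open>M = m * (N + 1) / 2\<close>, and the estimate for functions omitting \<open>m + 2\<close> values requires that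
  \<open>2 * M + N + 1 = (m + 2) * (N - 1)\<close>.
\<close>

definition N :: nat where "N = 2 * m + 3"

definition P :: "complex \<Rightarrow> complex" where "P x = (\<Prod>\<alpha>\<in>S. x - \<alpha>)"

text \<open>
  The components of the vector field dual to the 1-form \<open>W^(N+1) P(G)^(N-1) / (dG)^N\<close>. It vanishes at the
  critical points of \<open>G\<close>, where the 1-form has poles.
\<close>

definition V :: "'a chart \<Rightarrow> complex \<Rightarrow> complex" where
  "V c z = deriv (G \<circ> chart_inv c) z ^ N / (W c z ^ (N + 1) * P (G (chart_inv c z)) ^ (N - 1))"

lemma W_nonzero: "c \<in> A \<Longrightarrow> p \<in> fst c \<Longrightarrow> W c (snd c p) \<noteq> 0"
  using density_pos[of c p] density_eq[of c p] by auto

lemma P_nonzero: "p \<in> topspace X \<Longrightarrow> P (G p) \<noteq> 0"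
  using omits[of p] S by (auto simp: P_def)

lemma G_has_derivative:
  assumes "c \<in> A" "p \<in> fst c"
  shows "((G \<circ> chart_inv c) has_field_derivative deriv (G \<circ> chart_inv c) (snd c p)) (at (snd c p))"
  using holomorphic_derivI[OF G_holomorphic[OF assms(1)] chart(2)[OF assms(1)]] assms(2) by blast

lemma G_deriv_change:
  assumes c: "c \<in> A" "c' \<in> A" and p: "p \<in> fst c" "p \<in> fst c'"
  shows "deriv (G \<circ> chart_inv c) (snd c p)
    = deriv (G \<circ> chart_inv c') (snd c' p) * deriv (transition c c') (snd c p)"
proof -
  let ?O = "snd c ` (fst c \<inter> fst c')"
  have O: "open ?O" using c by (intro open_chart_image) (auto simp: chart)
  have pO: "snd c p \<in> ?O" using p by blast
  have "((\<lambda>z. (G \<circ> chart_inv c') (transition c c' z)) has_field_derivative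
      deriv (G \<circ> chart_inv c') (snd c' p) * deriv (transition c c') (snd c p)) (at (snd c p))"
    using G_has_derivative[OF c(2) p(2)] transition_has_field_derivative[OF c p]
      DERIV_chain2[where f = "G \<circ> chart_inv c'" and g = "transition c c'"]
    by (simp add: transition_chart[OF c(1) p(1)] del: o_apply)
  then have "((G \<circ> chart_inv c) has_field_derivative
      deriv (G \<circ> chart_inv c') (snd c' p) * deriv (transition c c') (snd c p)) (at (snd c p))"
    by (rule has_field_derivative_transform_within_open[OF _ O pO])
      (auto simp: transition_chart[OF c(1)] chart_inv_chart c)
  then show ?thesis by (rule DERIV_imp_deriv)
qed

sublocale Field: holomorphic_vector_field X A V
proof
  fix c assume c: "c \<in> A"
  let ?D = "snd c ` fst c"
  have "P (G (chart_inv c z)) \<noteq> 0" "W c z \<noteq> 0" if "z \<in> ?D" for z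
    using P_nonzero[of "chart_inv c z"] chart_topspace[OF c] W_nonzero[OF c] chart_inv_in[OF c] that by auto
  moreover have "(\<lambda>z. P (G (chart_inv c z))) holomorphic_on ?D"
    unfolding P_def using G_holomorphic[OF c] by (intro holomorphic_intros) (simp add: o_def)
  ultimately show "V c holomorphic_on ?D"
    unfolding V_def using W_holomorphic[OF c] G_holomorphic[OF c] chart(2)[OF c]
    by (intro holomorphic_intros) auto
next
  fix c c' p assume c: "c \<in> A" "c' \<in> A" and p: "p \<in> fst c" "p \<in> fst c'"
  let ?\<tau> = "deriv (transition c c') (snd c p)"
  \<comment> \<open>The 1-form \<open>W\<close> picks up a factor \<open>?\<tau>\<close>, and so does \<open>dG\<close>; the exponents leave one factor \<open>?\<tau>\<close> overall.\<close>
  have "?\<tau> \<noteq> 0" using W_change[OF c p] W_nonzero[OF c(1) p(1)] by auto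
  then show "V c' (snd c' p) = ?\<tau> * V c (snd c p)"
    using p c by (simp add: V_def G_deriv_change[OF c p] W_change[OF c p] power_mult_distrib chart_inv_chart field_simps)
qed

lemma flow_G_derivative:
  assumes \<Phi>: "Field.flow_on T \<Phi>" and w: "w \<in> T" and c: "c \<in> A" "\<Phi> w \<in> fst c"
  shows "((G \<circ> \<Phi>) has_field_derivative
    deriv (G \<circ> chart_inv c) (snd c (\<Phi> w)) * V c (snd c (\<Phi> w))) (at w)"
proof -
  have "((\<lambda>y. (G \<circ> chart_inv c) ((snd c \<circ> \<Phi>) y)) has_field_derivative
    deriv (G \<circ> chart_inv c) (snd c (\<Phi> w)) * V c (snd c (\<Phi> w))) (at w)"
    using G_has_derivative[OF c]
    by (intro DERIV_chain2[where f = "G \<circ> chart_inv c" and g = "snd c \<circ> \<Phi>", OF _ Field.flow_derivative[OF \<Phi> w c]])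
      simp
  moreover have "\<forall>\<^sub>F y in nhds w. (G \<circ> chart_inv c) ((snd c \<circ> \<Phi>) y) = (G \<circ> \<Phi>) y"
    using holo_curve_in_chart(1)[OF Field.flow_on_imp_holo_curve[OF \<Phi>] w c]
    by eventually_elim (simp add: chart_inv_chart[OF c(1)])
  ultimately show ?thesis
    unfolding has_field_derivative_def by (rule has_derivative_transform_nhds)
qed

text \<open>
  In the flow coordinate \<open>w\<close> the 1-form \<open>W^(N+1) P(G)^(N-1) / (dG)^N\<close> becomes \<open>dw\<close>. This expresses \<open>|W|^(N+1)\<close> by \<open>G \<circ> \<Phi>\<close>
  alone, and hence the line element as well.
\<close>

lemma flow_speed_power:
  assumes \<Phi>: "Field.flow_on T \<Phi>" and w: "w \<in> T" and c: "c \<in> A" "\<Phi> w \<in> fst c"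
  shows "(sqrt (\<rho> c (snd c (\<Phi> w))) * cmod (deriv (snd c \<circ> \<Phi>) w)) ^ (N + 1) * cmod (P (G (\<Phi> w))) ^ (N - 1)
    = \<kappa> ^ (m + 2) * ((1 + (cmod (G (\<Phi> w)))\<^sup>2) ^ (m * (m + 2)) * cmod (deriv (G \<circ> \<Phi>) w) ^ N)"
proof -
  let ?z = "snd c (\<Phi> w)" and ?g = "cmod (deriv (G \<circ> chart_inv c) (snd c (\<Phi> w)))" and ?W = "cmod (W c (snd c (\<Phi> w)))"
    and ?V = "cmod (V c (snd c (\<Phi> w)))" and ?Q = "cmod (P (G (\<Phi> w))) ^ (N - 1)"
  have dz: "deriv (snd c \<circ> \<Phi>) w = V c ?z"
    using Field.flow_derivative[OF \<Phi> w c] by (rule DERIV_imp_deriv)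
  have df: "cmod (deriv (G \<circ> \<Phi>) w) = ?g * ?V"
    using DERIV_imp_deriv[OF flow_G_derivative[OF \<Phi> w c]] by (simp add: norm_mult)
  have W0: "?W \<noteq> 0" using W_nonzero[OF c] by simp
  have Q0: "?Q \<noteq> 0" using P_nonzero[of "\<Phi> w"] chart_topspace[OF c] by simp
  have V: "?W ^ (N + 1) * ?V * ?Q = ?g ^ N"
    using W0 Q0 by (simp add: V_def norm_divide norm_mult norm_power chart_inv_chart[OF c] del: power_Suc)
  have sq: "sqrt (\<rho> c ?z) ^ (N + 1) = \<rho> c ?z ^ (m + 2)"
  proof -
    have "sqrt (\<rho> c ?z) ^ (2 * (m + 2)) = \<rho> c ?z ^ (m + 2)"
      using density_pos[OF c] by (simp only: power_mult) simp
    moreover have "N + 1 = 2 * (m + 2)" by (simp add: N_def)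
    ultimately show ?thesis by simp
  qed
  have "\<rho> c ?z ^ (m + 2) = \<kappa> ^ (m + 2) * (1 + (cmod (G (\<Phi> w)))\<^sup>2) ^ (m * (m + 2)) * ?W ^ (2 * (m + 2))"
    unfolding density_eq[OF c] by (simp only: power_mult_distrib power_mult)
  also have "2 * (m + 2) = N + 1" by (simp add: N_def)
  finally have "(sqrt (\<rho> c ?z) * ?V) ^ (N + 1) * ?Q
      = \<kappa> ^ (m + 2) * (1 + (cmod (G (\<Phi> w)))\<^sup>2) ^ (m * (m + 2)) * (?W ^ (N + 1) * ?V * ?Q) * ?V ^ N"
    by (simp only: power_mult_distrib sq) (simp add: mult_ac)
  also have "\<dots> = \<kappa> ^ (m + 2) * ((1 + (cmod (G (\<Phi> w)))\<^sup>2) ^ (m * (m + 2)) * cmod (deriv (G \<circ> \<Phi>) w) ^ N)"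
    unfolding V df by (simp add: power_mult_distrib mult_ac)
  finally show ?thesis unfolding dz .
qed

text \<open>
  Two consequences of the estimate for functions that omit \<open>S\<close>: the first is used at the centre of large
  discs, and the second, a bound for the line element of the metric, near the boundary of a disc.
\<close>

lemma flow_estimates:
  obtains C where "C > 0"
    "\<And>\<Phi> R w. Field.flow_on (ball 0 R) \<Phi> \<Longrightarrow> w \<in> ball 0 R \<Longrightarrow>
      cmod (deriv (G \<circ> \<Phi>) w) ^ N * (R - cmod w) ^ N \<le> C * cmod (P (G (\<Phi> w))) ^ (N - 1)"
    "\<And>\<Phi> R w c. Field.flow_on (ball 0 R) \<Phi> \<Longrightarrow> w \<in> ball 0 R \<Longrightarrow> c \<in> A \<Longrightarrow> \<Phi> w \<in> fst c \<Longrightarrow>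
      (sqrt (\<rho> c (snd c (\<Phi> w))) * cmod (deriv (snd c \<circ> \<Phi>) w)) ^ (N + 1) * (R - cmod w) ^ N \<le> C"
proof -
  have arith: "2 * (m * (m + 2)) + N + 1 = card S * (N - 1)"
    by (simp add: S N_def algebra_simps)
  obtain C where C: "C > 0" and est: "\<And>f R w. f holomorphic_on ball 0 R \<Longrightarrow> f ` ball 0 R \<inter> S = {} \<Longrightarrow>
       w \<in> ball 0 R \<Longrightarrow> cmod (deriv f w) ^ N * (R - cmod w) ^ N * (1 + (cmod (f w))\<^sup>2) ^ (m * (m + 2))
         \<le> C * (\<Prod>\<alpha>\<in>S. cmod (f w - \<alpha>)) ^ (N - 1)"
    using deriv_bound_omit_finite_set[OF S(1) _ _ arith] S(2) by (auto simp: N_def)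
  have main: "cmod (deriv (G \<circ> \<Phi>) w) ^ N * (R - cmod w) ^ N * (1 + (cmod (G (\<Phi> w)))\<^sup>2) ^ (m * (m + 2))
      \<le> C * cmod (P (G (\<Phi> w))) ^ (N - 1)"
    if \<Phi>: "Field.flow_on (ball 0 R) \<Phi>" and w: "w \<in> ball 0 R" for \<Phi> R w
  proof -
    have top: "\<Phi> y \<in> topspace X" if "y \<in> ball 0 R" for y
      by (rule holo_curve_topspace[OF Field.flow_on_imp_holo_curve[OF \<Phi>] that])
    have "(G \<circ> \<Phi>) holomorphic_on ball 0 R"
      unfolding holomorphic_on_open[OF open_ball]
      using flow_G_derivative[OF \<Phi>] ex_chart[OF top] by blast
    moreover have "(G \<circ> \<Phi>) ` ball 0 R \<inter> S = {}" using omits top by auto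
    ultimately show ?thesis using est[of "G \<circ> \<Phi>" R w] w by (simp add: P_def prod_norm)
  qed
  show ?thesis
  proof (rule that)
    show "max C (\<kappa> ^ (m + 2) * C) > 0" using C by simp
    fix \<Phi> R and w :: complex assume \<Phi>: "Field.flow_on (ball 0 R) \<Phi>" and w: "w \<in> ball 0 R"
    have Rw: "R - cmod w > 0" using w by simp
    let ?D = "cmod (deriv (G \<circ> \<Phi>) w) ^ N * (R - cmod w) ^ N"
    let ?Q = "cmod (P (G (\<Phi> w))) ^ (N - 1)"
    have "?D * 1 \<le> ?D * (1 + (cmod (G (\<Phi> w)))\<^sup>2) ^ (m * (m + 2))"
      using Rw by (intro mult_left_mono one_le_power) auto
    also have "\<dots> \<le> C * ?Q" by (rule main[OF \<Phi> w])
    also have "\<dots> \<le> max C (\<kappa> ^ (m + 2) * C) * ?Q" by (intro mult_right_mono) auto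
    finally show "?D \<le> max C (\<kappa> ^ (m + 2) * C) * ?Q" by simp
    fix c assume c: "c \<in> A" "\<Phi> w \<in> fst c"
    let ?s = "(sqrt (\<rho> c (snd c (\<Phi> w))) * cmod (deriv (snd c \<circ> \<Phi>) w)) ^ (N + 1)"
    have Q0: "?Q > 0" using P_nonzero[of "\<Phi> w"] chart_topspace[OF c] by simp
    have "?s * (R - cmod w) ^ N * ?Q = (?s * ?Q) * (R - cmod w) ^ N" by (simp add: mult_ac)
    also have "\<dots> = \<kappa> ^ (m + 2) * (cmod (deriv (G \<circ> \<Phi>) w) ^ N * (R - cmod w) ^ N
        * (1 + (cmod (G (\<Phi> w)))\<^sup>2) ^ (m * (m + 2)))"
      unfolding flow_speed_power[OF \<Phi> w c] by (simp add: mult_ac)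
    also have "\<dots> \<le> \<kappa> ^ (m + 2) * (C * ?Q)"
      using \<kappa> by (intro mult_left_mono main[OF \<Phi> w]) auto
    also have "\<dots> \<le> max C (\<kappa> ^ (m + 2) * C) * ?Q"
      using Q0 by (simp add: mult.assoc[symmetric])
    finally show "?s * (R - cmod w) ^ N \<le> max C (\<kappa> ^ (m + 2) * C)" using Q0 by simp
  qed
qed

text \<open>
  The part of the ray between the points with index \<open>n\<close> and \<open>n + 1\<close> has Euclidean length
  \<open>\<delta> = (1 / 2) ^ (n + 1) * R\<close>, and on it the line element is at most \<open>(C / \<delta>^N)^(1/(N+1))\<close>. So its length
  in the surface is at most \<open>(C \<delta>)^(1/(N+1))\<close>, which is summable over \<open>n\<close>.
\<close>

lemma flow_rays_converge:
  assumes R: "R > 0" and \<Phi>: "Field.flow_on (ball 0 R) \<Phi>" and a: "cmod a = R"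
  shows "\<exists>q. limitin X (\<lambda>n. \<Phi> (of_real (1 - (1 / 2) ^ n) * a)) q sequentially"
proof -
  obtain C where C: "C > 0" and est: "\<And>\<Phi> R w c. Field.flow_on (ball 0 R) \<Phi> \<Longrightarrow> w \<in> ball 0 R \<Longrightarrow> c \<in> A \<Longrightarrow> \<Phi> w \<in> fst c \<Longrightarrow>
      (sqrt (\<rho> c (snd c (\<Phi> w))) * cmod (deriv (snd c \<circ> \<Phi>) w)) ^ (N + 1) * (R - cmod w) ^ N \<le> C"
    using flow_estimates by metis
  let ?w = "\<lambda>n. complex_of_real (1 - (1 / 2) ^ n) * a"
  have holo: "holo_curve (ball 0 R) \<Phi>" by (rule Field.flow_on_imp_holo_curve[OF \<Phi>])
  have nw: "cmod (?w n) = (1 - (1 / 2) ^ n) * R" for n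
    using a by (simp add: norm_mult power_le_one del: of_real_diff of_real_power)
  have wR: "?w n \<in> ball 0 R" for n
  proof -
    have "(1 - (1 / 2) ^ n) * R < R" using R by simp
    then show ?thesis unfolding mem_ball_0 nw .
  qed
  have top: "\<Phi> (?w n) \<in> topspace X" for n by (rule holo_curve_topspace[OF holo wR])
  define \<theta> where "\<theta> = root (N + 1) (1 / 2)"
  have \<theta>: "0 \<le> \<theta>" "\<theta> < 1" by (auto simp: \<theta>_def)
  have step: "metric_dist X A \<rho> (\<Phi> (?w n)) (\<Phi> (?w (Suc n))) \<le> root (N + 1) (C * R) * \<theta> ^ Suc n" for n
  proof -
    define \<delta> where "\<delta> = (1 / 2) ^ Suc n * R"
    have \<delta>: "\<delta> > 0" using R by (simp add: \<delta>_def)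
    have diff: "cmod (?w (Suc n) - ?w n) = \<delta>"
    proof -
      have eq: "?w (Suc n) - ?w n = of_real ((1 / 2) ^ Suc n) * a" by (simp add: algebra_simps)
      show ?thesis unfolding eq norm_mult norm_of_real \<delta>_def using a by simp
    qed
    have seg: "cmod w \<le> R - \<delta>" if "w \<in> closed_segment (?w n) (?w (Suc n))" for w
    proof -
      have "cmod (?w n) \<le> R - \<delta>" "cmod (?w (Suc n)) \<le> R - \<delta>"
        unfolding nw \<delta>_def using R by (auto simp: algebra_simps)
      then have "closed_segment (?w n) (?w (Suc n)) \<subseteq> cball 0 (R - \<delta>)"
        by (intro closed_segment_subset) auto
      then show ?thesis using that by auto
    qed
    let ?B = "root (N + 1) (C * \<delta>) / \<delta>"
    have "edist (\<Phi> (?w n)) (\<Phi> (?w (Suc n))) \<le> ennreal (?B * cmod (?w (Suc n) - ?w n))"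
    proof (rule edist_segment_le[OF holo open_ball])
      show "closed_segment (?w n) (?w (Suc n)) \<subseteq> ball 0 R" using seg \<delta> by force
      fix w assume w: "w \<in> closed_segment (?w n) (?w (Suc n))"
      have wR: "w \<in> ball 0 R" using seg[OF w] \<delta> by simp
      then obtain c where c: "c \<in> A" "\<Phi> w \<in> fst c"
        using ex_chart[OF holo_curve_topspace[OF holo]] by blast
      let ?s = "sqrt (\<rho> c (snd c (\<Phi> w))) * cmod (deriv (snd c \<circ> \<Phi>) w)"
      have s0: "?s \<ge> 0" using density_pos[OF c] by simp
      have "(?s * \<delta>) ^ (N + 1) = (?s ^ (N + 1) * \<delta> ^ N) * \<delta>" by (simp add: power_mult_distrib)
      also have "\<dots> \<le> (?s ^ (N + 1) * (R - cmod w) ^ N) * \<delta>"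
        using \<delta> s0 seg[OF w] by (intro mult_right_mono mult_left_mono power_mono zero_le_power) auto
      also have "\<dots> \<le> C * \<delta>" using est[OF \<Phi> wR c] \<delta> by (intro mult_right_mono) auto
      finally have "(?s * \<delta>) ^ (N + 1) \<le> C * \<delta>" .
      then have "root (N + 1) ((?s * \<delta>) ^ (N + 1)) \<le> root (N + 1) (C * \<delta>)"
        by (rule real_root_le_mono[rotated]) simp
      moreover have "root (N + 1) ((?s * \<delta>) ^ (N + 1)) = ?s * \<delta>"
        using s0 \<delta> by (intro real_root_power_cancel) auto
      ultimately have "?s * \<delta> \<le> root (N + 1) (C * \<delta>)" by argo
      then show "\<exists>c\<in>A. \<Phi> w \<in> fst c \<and> sqrt (\<rho> c (snd c (\<Phi> w))) * cmod (deriv (snd c \<circ> \<Phi>) w) \<le> ?B"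
        using c \<delta> by (intro bexI[of _ c]) (auto simp: pos_le_divide_eq)
    qed
    also have "?B * cmod (?w (Suc n) - ?w n) = root (N + 1) (C * \<delta>)" unfolding diff using \<delta> by simp
    also have "root (N + 1) (C * \<delta>) = root (N + 1) (C * R) * \<theta> ^ Suc n"
    proof -
      have "C * \<delta> = (C * R) * (1 / 2) ^ Suc n" by (simp add: \<delta>_def)
      then show ?thesis by (simp only: real_root_mult real_root_power \<theta>_def) 
    qed
    finally show ?thesis
      unfolding metric_dist_eq_edist[OF top top, symmetric]
      using C R \<theta> by (subst (asm) ennreal_le_iff) auto
  qed
  have "Metric.MCauchy (\<lambda>n. \<Phi> (?w n))"
  proof (rule Metric.MCauchy_if_summable_steps[where a = "\<lambda>n. root (N + 1) (C * R) * \<theta> ^ Suc n"])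
    show "metric_dist X A \<rho> (\<Phi> (?w n)) (\<Phi> (?w (Suc n))) \<le> root (N + 1) (C * R) * \<theta> ^ Suc n" for n
      by (rule step)
    show "summable (\<lambda>n. root (N + 1) (C * R) * \<theta> ^ Suc n)"
      using \<theta> by (intro summable_mult) (simp add: summable_geometric)
  qed (use top in auto)
  then obtain q where "limitin Metric.mtopology (\<lambda>n. \<Phi> (?w n)) q sequentially"
    using complete unfolding Metric.mcomplete_def by blast
  then show ?thesis using limitin_if_limitin_metric by blast
qed

text \<open>
  At a point where \<open>dG\<close> is nonzero, \<open>V\<close> and thus the derivative of \<open>G\<close> along the flow are nonzero too.
  This contradicts the estimate at the centre of a sufficiently large disc.
\<close>

theorem G_deriv_zero:
  assumes c: "c \<in> A" and p: "p \<in> fst c"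
  shows "deriv (G \<circ> chart_inv c) (snd c p) = 0"
proof (rule ccontr)
  assume G0: "deriv (G \<circ> chart_inv c) (snd c p) \<noteq> 0"
  have top: "p \<in> topspace X" using chart_topspace[OF c p] .
  let ?f' = "deriv (G \<circ> chart_inv c) (snd c p) * V c (snd c p)"
  have "V c (snd c p) \<noteq> 0"
    using G0 W_nonzero[OF c p] P_nonzero[OF top] p by (simp add: V_def chart_inv_chart[OF c])
  then have f0: "cmod ?f' ^ N > 0" using G0 by simp
  obtain C where C: "C > 0" and est: "\<And>\<Phi> R w. Field.flow_on (ball 0 R) \<Phi> \<Longrightarrow> w \<in> ball 0 R \<Longrightarrow>
      cmod (deriv (G \<circ> \<Phi>) w) ^ N * (R - cmod w) ^ N \<le> C * cmod (P (G (\<Phi> w))) ^ (N - 1)"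
    using flow_estimates by metis
  let ?Q = "cmod (P (G p)) ^ (N - 1)"
  \<comment> \<open>This \<open>R\<close> is so large that the estimate at the centre fails; \<open>R \<ge> 1\<close> gives \<open>R \<le> R ^ N\<close>.\<close>
  define R where "R = max 1 (2 * C * ?Q / cmod ?f' ^ N)"
  have R: "R \<ge> 1" "R > C * ?Q / cmod ?f' ^ N"
  proof -
    have "C * ?Q / cmod ?f' ^ N > 0" using C f0 P_nonzero[OF top] by simp
    moreover have "R \<ge> 2 * C * ?Q / cmod ?f' ^ N" by (simp add: R_def)
    moreover have "2 * C * ?Q / cmod ?f' ^ N = 2 * (C * ?Q / cmod ?f' ^ N)" by simp
    ultimately show "R > C * ?Q / cmod ?f' ^ N" by linarith
  qed (simp add: R_def)
  have "\<exists>\<Phi>. Field.flow_on (ball 0 R) \<Phi> \<and> \<Phi> 0 = p"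
    by (rule Field.flow_exists_on_all_balls[OF top _ flow_rays_converge]) (use R(1) in auto)
  then obtain \<Phi> where \<Phi>: "Field.flow_on (ball 0 R) \<Phi>" "\<Phi> 0 = p" by blast
  have 0: "0 \<in> ball 0 R" using R(1) by simp
  have "deriv (G \<circ> \<Phi>) 0 = ?f'"
    using DERIV_imp_deriv[OF flow_G_derivative[OF \<Phi>(1) 0 c]] p \<Phi>(2) by simp
  then have "cmod ?f' ^ N * R ^ N \<le> C * ?Q"
    using est[OF \<Phi>(1) 0] \<Phi>(2) by simp
  moreover have "cmod ?f' ^ N * R \<le> cmod ?f' ^ N * R ^ N"
    using power_increasing[of 1 N R] R(1) f0 by (intro mult_left_mono) (auto simp: N_def)
  moreover have "C * ?Q < R * cmod ?f' ^ N"
    using R(2) unfolding pos_divide_less_eq[OF f0] .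
  ultimately show False using mult.commute[of R "cmod ?f' ^ N"] by linarith
qed

end

section \<open>Moving an omitted value to infinity\<close>

text \<open>
  Riemann's theorem on removable singularities, for a set \<open>Z\<close> of singularities that is discrete in \<open>D\<close>
  but possibly infinite.
\<close>

lemma holomorphic_fill_isolated_singularities:
  fixes F :: "complex \<Rightarrow> complex"
  assumes D: "open D" and F: "F holomorphic_on (D - Z)"
    and isolated: "\<And>z0. z0 \<in> D \<Longrightarrow> \<forall>\<^sub>F z in at z0. z \<notin> Z"
    and bounded: "\<And>z0. z0 \<in> D \<inter> Z \<Longrightarrow> \<exists>B. \<forall>\<^sub>F z in at z0. cmod (F z) \<le> B"
  shows "(\<lambda>z. if z \<in> Z then Lim (at z) F else F z) holomorphic_on D"
  unfolding holomorphic_on_open[OF D]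
proof
  let ?H = "\<lambda>z. if z \<in> Z then Lim (at z) F else F z"
  fix z0 assume z0: "z0 \<in> D"
  have "\<forall>\<^sub>F z in at z0. z \<in> D \<and> z \<notin> Z"
    using isolated[OF z0] eventually_at_in_open'[OF D z0] by (rule eventually_conj[rotated])
  then obtain r where r: "r > 0" "\<And>z. z \<noteq> z0 \<Longrightarrow> dist z z0 < r \<Longrightarrow> z \<in> D \<and> z \<notin> Z"
    unfolding eventually_at by blast
  have sub: "ball z0 r - {z0} \<subseteq> D - Z" using r(2) by (auto simp: dist_commute)
  have z0r: "z0 \<in> ball z0 r" using r(1) by simp
  show "\<exists>f'. (?H has_field_derivative f') (at z0)"
  proof (cases "z0 \<in> Z")
    case True
    have "F holomorphic_on (ball z0 r - {z0})" using F sub by (rule holomorphic_on_subset)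
    moreover have "z0 \<in> interior (ball z0 r)" using z0r by simp
    ultimately obtain h where h: "h holomorphic_on ball z0 r" "\<And>z. z \<in> ball z0 r - {z0} \<Longrightarrow> h z = F z"
      using holomorphic_on_extend_bounded bounded[of z0] True z0 by blast
    have "isCont h z0"
      using h(1) z0r by (metis continuous_on_eq_continuous_at holomorphic_on_imp_continuous_on open_ball)
    then have "h \<midarrow>z0\<rightarrow> h z0" by (simp add: isCont_def)
    moreover have "\<forall>\<^sub>F z in at z0. h z = F z"
      unfolding eventually_at using r(1) h(2) by (auto intro!: exI[of _ r] simp: dist_commute)
    ultimately have "F \<midarrow>z0\<rightarrow> h z0" by (rule Lim_transform_eventually)
    then have Lim: "Lim (at z0) F = h z0" by (intro tendsto_Lim) auto
    have "(?H has_field_derivative deriv h z0) (at z0)"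
      by (rule has_field_derivative_transform_within_open[OF holomorphic_derivI[OF h(1) open_ball z0r] open_ball z0r])
        (use h(2) sub Lim True in force)
    then show ?thesis by blast
  next
    case False
    then have "ball z0 r \<subseteq> D - Z" using sub z0 by blast
    then have "F holomorphic_on ball z0 r" using F holomorphic_on_subset by blast
    from holomorphic_derivI[OF this open_ball z0r]
    have "(?H has_field_derivative deriv F z0) (at z0)"
      by (rule has_field_derivative_transform_within_open[OF _ open_ball z0r])
        (use \<open>ball z0 r \<subseteq> D - Z\<close> in auto)
    then show ?thesis by blast
  qed
qed

lemma eq_at_point_by_continuity:
  fixes f h :: "complex \<Rightarrow> 'b::t2_space"
  assumes "isCont f z" "isCont h z" "\<forall>\<^sub>F y in at z. f y = h y"
  shows "f z = h z"
proof -
  have "h \<midarrow>z\<rightarrow> f z"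
    using assms(1,3) by (auto simp: isCont_def intro: Lim_transform_eventually)
  then show ?thesis using assms(2) LIM_unique by (auto simp: isCont_def)
qed

lemma Moebius_rotation_norm:
  fixes a x :: complex
  assumes "x \<noteq> a"
  shows "1 + (cmod ((1 + cnj a * x) / (x - a)))\<^sup>2 = (1 + (cmod a)\<^sup>2) * (1 + (cmod x)\<^sup>2) / (cmod (x - a))\<^sup>2"
proof -
  have "(cmod (x - a))\<^sup>2 + (cmod (1 + cnj a * x))\<^sup>2 = (1 + (cmod a)\<^sup>2) * (1 + (cmod x)\<^sup>2)"
    unfolding cmod_power2 by (simp add: power2_eq_square algebra_simps)
  then show ?thesis using assms by (simp add: norm_divide power_divide field_simps)
qed

text \<open>
  The coordinate around infinity in the atlas of the sphere.
\<close>

definition inv_coord :: "complex option \<Rightarrow> complex" where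
  "inv_coord w = (case w of None \<Rightarrow> 0 | Some z \<Rightarrow> inverse z)"

text \<open>
  A rotation of the sphere that takes \<open>a\<close> to infinity; at \<open>a\<close> itself it has the default value 0.
\<close>

definition sphere_rotation :: "complex \<Rightarrow> complex option \<Rightarrow> complex" where
  "sphere_rotation a w = (case w of None \<Rightarrow> cnj a | Some x \<Rightarrow> (1 + cnj a * x) / (x - a))"

lemma inj_sphere_rotation: "inj_on (sphere_rotation a) (UNIV - {Some a})"
proof (rule inj_onI)
  have nz: "1 + cnj a * a \<noteq> 0"
  proof
    assume "1 + cnj a * a = 0"
    then have "1 + (cmod a)\<^sup>2 = 0"
      by (metis complex_norm_square mult.commute of_real_1 of_real_add of_real_eq_0_iff)
    then show False using zero_le_power2[of "cmod a"] by linarith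
  qed
  have no: "(1 + cnj a * x) / (x - a) \<noteq> cnj a" if "x \<noteq> a" for x
    using that nz by (auto simp: field_simps)
  fix v w assume v: "v \<in> UNIV - {Some a}" and w: "w \<in> UNIV - {Some a}" and eq: "sphere_rotation a v = sphere_rotation a w"
  show "v = w"
  proof (cases v)
    case v': None
    then show ?thesis using w eq no[THEN not_sym] by (cases w) (auto simp: sphere_rotation_def)
  next
    case v': (Some x)
    show ?thesis
    proof (cases w)
      case w': (Some y)
      have "(1 + cnj a * x) * (y - a) = (1 + cnj a * y) * (x - a)"
        using eq v w v' w' by (simp add: sphere_rotation_def frac_eq_eq)
      then have "(1 + cnj a * a) * (y - x) = 0" by (simp add: algebra_simps)
      then show ?thesis using nz v' w' by simp
    qed (use v eq no v' in \<open>auto simp: sphere_rotation_def\<close>)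
  qed
qed

locale meromorphic = riemann X A for X :: "'a topology" and A +
  fixes g :: "'a \<Rightarrow> complex option"
  assumes meromorphic: "meromorphic_function X A g"
begin

lemma g_holomorphic_map: "holomorphic_map X A sphere_topology sphere_atlas g"
  using meromorphic by (simp add: meromorphic_function_def)

lemma openin_g_vimage:
  assumes "openin sphere_topology V"
  shows "openin X {p \<in> topspace X. g p \<in> V}"
  using g_holomorphic_map assms by (auto simp: holomorphic_map_def continuous_map_def)

lemma openin_not_pole: "openin X {p \<in> topspace X. g p \<noteq> None}"
proof -
  have "openin sphere_topology (range Some)" by (simp add: sphere_topology_def)
  from openin_g_vimage[OF this] show ?thesis by (simp add: image_iff)
qed

lemma openin_not_zero: "openin X {p \<in> topspace X. g p \<noteq> Some 0}"
proof -
  have "closedin sphere_topology (Some ` {0})"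
    unfolding sphere_topology_def closedin_Alexandroff_compactification_image_Some by simp
  then have "openin sphere_topology (UNIV - {Some 0})"
    by (simp add: closedin_def sphere_topology_def) (metis UNIV_option_conv)
  from openin_g_vimage[OF this] show ?thesis by simp
qed

lemma the_g_holomorphic:
  assumes "c \<in> A"
  shows "(\<lambda>z. the (g (chart_inv c z))) holomorphic_on (snd c ` {p \<in> fst c. g p \<noteq> None})"
proof -
  have "(range Some, the) \<in> sphere_atlas" by (simp add: sphere_atlas_def)
  then have "(the \<circ> g \<circ> chart_inv c) holomorphic_on (snd c ` {p \<in> fst c. g p \<in> range Some})"
    using g_holomorphic_map assms unfolding holomorphic_map_def by fastforce
  moreover have "{p \<in> fst c. g p \<in> range Some} = {p \<in> fst c. g p \<noteq> None}"
    by (auto simp: image_iff)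
  ultimately show ?thesis by (simp add: o_def)
qed

lemma inv_g_holomorphic:
  assumes "c \<in> A"
  shows "(\<lambda>z. inv_coord (g (chart_inv c z))) holomorphic_on (snd c ` {p \<in> fst c. g p \<noteq> Some 0})"
proof -
  have "(UNIV - {Some 0}, inv_coord) \<in> sphere_atlas" unfolding inv_coord_def by (simp add: sphere_atlas_def)
  then have "(inv_coord \<circ> g \<circ> chart_inv c) holomorphic_on (snd c ` {p \<in> fst c. g p \<in> UNIV - {Some 0}})"
    using g_holomorphic_map assms unfolding holomorphic_map_def by fastforce
  then show ?thesis by (simp add: o_def)
qed

lemma open_not_pole:
  assumes "c \<in> A"
  shows "open (snd c ` {p \<in> fst c. g p \<noteq> None})"
proof -
  have "{p \<in> fst c. g p \<noteq> None} = fst c \<inter> {p \<in> topspace X. g p \<noteq> None}"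
    using chart_topspace[OF assms] by auto
  then show ?thesis using chart(1)[OF assms] openin_not_pole by (intro open_chart_image[OF assms]) auto
qed

lemma open_not_zero:
  assumes "c \<in> A"
  shows "open (snd c ` {p \<in> fst c. g p \<noteq> Some 0})"
proof -
  have "{p \<in> fst c. g p \<noteq> Some 0} = fst c \<inter> {p \<in> topspace X. g p \<noteq> Some 0}"
    using chart_topspace[OF assms] by auto
  then show ?thesis using chart(1)[OF assms] openin_not_zero by (intro open_chart_image[OF assms]) auto
qed

lemma sphere_rotation_holomorphic:
  assumes omit: "Some a \<notin> g ` topspace X" and c: "c \<in> A"
  shows "((sphere_rotation a \<circ> g) \<circ> chart_inv c) holomorphic_on (snd c ` fst c)"
proof -
  let ?D1 = "snd c ` {p \<in> fst c. g p \<noteq> None}" and ?D2 = "snd c ` {p \<in> fst c. g p \<noteq> Some 0}"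
  have ga: "g p \<noteq> Some a" if "p \<in> fst c" for p using omit chart_topspace[OF c that] by force
  have "((sphere_rotation a \<circ> g) \<circ> chart_inv c) holomorphic_on ?D1"
  proof (rule holomorphic_transform)
    show "(\<lambda>z. (1 + cnj a * the (g (chart_inv c z))) / (the (g (chart_inv c z)) - a)) holomorphic_on ?D1"
    proof (intro holomorphic_intros the_g_holomorphic[OF c])
      fix z assume "z \<in> ?D1"
      then show "the (g (chart_inv c z)) - a \<noteq> 0" using ga by (auto simp: chart_inv_chart[OF c])
    qed
  qed (auto simp: sphere_rotation_def chart_inv_chart[OF c])
  moreover have "((sphere_rotation a \<circ> g) \<circ> chart_inv c) holomorphic_on ?D2"
  proof (rule holomorphic_transform)
    have nz: "1 - a * inv_coord (g p) \<noteq> 0" if "p \<in> fst c" "g p \<noteq> Some 0" for p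
      using ga[OF that(1)] that(2) by (cases "g p") (auto simp: inv_coord_def field_simps)
    show "(\<lambda>z. (inv_coord (g (chart_inv c z)) + cnj a) / (1 - a * inv_coord (g (chart_inv c z)))) holomorphic_on ?D2"
    proof (intro holomorphic_intros inv_g_holomorphic[OF c])
      fix z assume "z \<in> ?D2"
      then show "1 - a * inv_coord (g (chart_inv c z)) \<noteq> 0" using nz by (auto simp: chart_inv_chart[OF c])
    qed
    show "(inv_coord (g (chart_inv c z)) + cnj a) / (1 - a * inv_coord (g (chart_inv c z)))
        = ((sphere_rotation a \<circ> g) \<circ> chart_inv c) z" if zD: "z \<in> ?D2" for z
    proof -
      obtain p where p: "p \<in> fst c" "g p \<noteq> Some 0" "z = snd c p" using zD by blast
      show ?thesis
      proof (cases "g p")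
        case (Some x)
        then have "x \<noteq> 0" "x \<noteq> a" using p ga by auto
        then show ?thesis using Some p
          by (simp add: sphere_rotation_def inv_coord_def chart_inv_chart[OF c] field_simps)
      qed (use p in \<open>simp add: sphere_rotation_def inv_coord_def chart_inv_chart[OF c]\<close>)
    qed
  qed
  ultimately have "((sphere_rotation a \<circ> g) \<circ> chart_inv c) holomorphic_on (?D1 \<union> ?D2)"
    using open_not_pole[OF c] open_not_zero[OF c] by (rule holomorphic_on_Un)
  moreover have "snd c ` fst c \<subseteq> ?D1 \<union> ?D2" by (auto simp: image_iff)
  ultimately show ?thesis by (rule holomorphic_on_subset)
qed

end

lemma representation_if_omits_infinity:
  assumes conf: "conformal_surface X A (metric_density m g \<omega>)" and mero: "meromorphic X A g"
    and form: "holomorphic_one_form A \<omega>" and omit: "None \<notin> g ` topspace X"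
  shows "weierstrass_representation X A (metric_density m g \<omega>) (the \<circ> g) \<omega> 1 m"
proof -
  interpret conformal_surface X A "metric_density m g \<omega>" by (rule conf)
  interpret meromorphic X A g by (rule mero)
  have fin: "g p \<noteq> None" if "c \<in> A" "p \<in> fst c" for c p
    using omit chart_topspace[OF that] by (metis image_eqI)
  show ?thesis
  proof
    fix c assume c: "c \<in> A"
    have "{p \<in> fst c. g p \<noteq> None} = fst c" using fin[OF c] by auto
    then show "((the \<circ> g) \<circ> chart_inv c) holomorphic_on (snd c ` fst c)"
      using the_g_holomorphic[OF c] by (simp add: o_def)
    show "\<omega> c holomorphic_on (snd c ` fst c)" using form c by (simp add: holomorphic_one_form_def)
  next
    fix c c' p assume c: "c \<in> A" "c' \<in> A" and p: "p \<in> fst c" "p \<in> fst c'"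
    have "snd c p \<in> snd c ` (fst c \<inter> fst c')" using p by blast
    then have "\<omega> c (snd c p) = \<omega> c' (transition c c' (snd c p)) * deriv (transition c c') (snd c p)"
      using form c unfolding holomorphic_one_form_def by blast
    then show "\<omega> c (snd c p) = \<omega> c' (snd c' p) * deriv (transition c c') (snd c p)"
      by (simp add: transition_chart[OF c(1) p(1)])
  next
    fix c p assume c: "c \<in> A" "p \<in> fst c"
    then show "metric_density m g \<omega> c (snd c p)
        = 1 * (1 + (cmod ((the \<circ> g) p))\<^sup>2) ^ m * (cmod (\<omega> c (snd c p)))\<^sup>2"
      using fin[OF c] by (auto simp: metric_density_def metric_formula_def chart_inv_chart)
  qed simp
qed

text \<open>
  With \<open>G = (1 + cnj a * g) / (g - a)\<close>, the identity for \<open>1 + |G|\<^sup>2\<close> shows that the metric is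
  \<open>\<kappa> (1 + |G|\<^sup>2)\<^sup>m |(g - a)\<^sup>m \<omega>|\<^sup>2\<close> away from the poles of \<open>g\<close>. These poles are isolated, and near them
  \<open>(g - a)\<^sup>m \<omega>\<close> is bounded because the metric density is continuous. So the singularities of this form
  are removable, and its properties at the poles follow by continuity.
\<close>

lemma representation_if_omits_finite_value:
  assumes conf: "conformal_surface X A (metric_density m g \<omega>)" and mero: "meromorphic X A g"
    and form: "holomorphic_one_form A \<omega>" and omit: "Some a \<notin> g ` topspace X"
    and nonconst: "\<not> g constant_on topspace X"
  shows "\<exists>W \<kappa>. weierstrass_representation X A (metric_density m g \<omega>) (sphere_rotation a \<circ> g) W \<kappa> m"
proof -
  interpret conformal_surface X A "metric_density m g \<omega>" by (rule conf)
  interpret meromorphic X A g by (rule mero)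
  let ?G = "sphere_rotation a \<circ> g" and ?\<rho> = "metric_density m g \<omega>"
  define \<kappa> where "\<kappa> = 1 / (1 + (cmod a)\<^sup>2) ^ m"
  have a1: "1 + (cmod a)\<^sup>2 > 0" using zero_le_power2[of "cmod a"] by linarith
  then have \<kappa>: "\<kappa> > 0" by (simp add: \<kappa>_def)
  define Z where "Z c = {z. g (chart_inv c z) = None}" for c
  define F where "F c z = (the (g (chart_inv c z)) - a) ^ m * \<omega> c z" for c z
  define W where "W c z = (if z \<in> Z c then Lim (at z) (F c) else F c z)" for c z
  have ga: "g p \<noteq> Some a" if "p \<in> topspace X" for p using omit that by (metis image_eqI)
  have hol: "(?G \<circ> chart_inv c) holomorphic_on (snd c ` fst c)" if "c \<in> A" for c
    by (rule sphere_rotation_holomorphic[OF omit that])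
  have \<omega>: "\<omega> c holomorphic_on (snd c ` fst c)" if "c \<in> A" for c
    using form that by (simp add: holomorphic_one_form_def)
  have Gnonconst: "\<not> ?G constant_on topspace X"
  proof
    assume "?G constant_on topspace X"
    then obtain b where b: "\<And>p. p \<in> topspace X \<Longrightarrow> sphere_rotation a (g p) = b"
      unfolding constant_on_def by auto
    have "g p = g q" if "p \<in> topspace X" "q \<in> topspace X" for p q
      using inj_onD[OF inj_sphere_rotation[of a], of "g p" "g q"] b that ga by auto
    then show False using nonconst unfolding constant_on_def by metis
  qed
  \<comment> \<open>The poles of \<open>g\<close> are the points where the rotated function takes the value \<open>cnj a\<close>.\<close>
  have isolated: "\<forall>\<^sub>F z in at z0. z \<notin> Z c" if "c \<in> A" "z0 \<in> snd c ` fst c" for c z0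
  proof -
    have "\<forall>\<^sub>F z in at z0. ?G (chart_inv c z) \<noteq> cnj a"
      by (rule nonconstant_isolated_values[OF connected hol Gnonconst that])
    then show ?thesis by eventually_elim (auto simp: Z_def sphere_rotation_def split: option.splits)
  qed
  have near: "\<forall>\<^sub>F z in at z0. z \<in> snd c ` fst c - Z c" if "c \<in> A" "z0 \<in> snd c ` fst c" for c z0
    using isolated[OF that] eventually_at_in_open'[OF chart(2)[OF that(1)] that(2)]
    by eventually_elim blast
  have density_F: "?\<rho> c z = \<kappa> * (1 + (cmod (?G (chart_inv c z)))\<^sup>2) ^ m * (cmod (F c z))\<^sup>2"
    if c: "c \<in> A" and z: "z \<in> snd c ` fst c - Z c" for c z
  proof -
    obtain x where x: "g (chart_inv c z) = Some x" using z by (auto simp: Z_def)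
    have "chart_inv c z \<in> topspace X" using chart_topspace[OF c chart_inv_in[OF c]] z by blast
    then have xa: "x \<noteq> a" using ga x by force
    have "(1 + (cmod (?G (chart_inv c z)))\<^sup>2) ^ m * (cmod (F c z))\<^sup>2
        = ((1 + (cmod a)\<^sup>2) * (1 + (cmod x)\<^sup>2) / (cmod (x - a))\<^sup>2) ^ m * ((cmod (x - a)) ^ 2) ^ m * (cmod (\<omega> c z))\<^sup>2"
      using Moebius_rotation_norm[OF xa] x
      by (simp add: sphere_rotation_def F_def norm_mult norm_power power_mult_distrib mult_ac flip: power_mult)
    also have "\<dots> = (1 + (cmod a)\<^sup>2) ^ m * ((1 + (cmod x)\<^sup>2) ^ m * (cmod (\<omega> c z))\<^sup>2)"
      using xa by (simp add: power_mult_distrib power_divide)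
    finally show ?thesis
      using a1 x by (simp add: \<kappa>_def metric_density_def metric_formula_def mult.assoc)
  qed
  have cont_\<rho>: "isCont (?\<rho> c) z0" if "c \<in> A" "z0 \<in> snd c ` fst c" for c z0
    using density_continuous[OF that(1)] that(2) continuous_on_eq_continuous_at[OF chart(2)[OF that(1)]]
    by blast
  have W_hol: "W c holomorphic_on (snd c ` fst c)" if c: "c \<in> A" for c
    unfolding W_def
  proof (rule holomorphic_fill_isolated_singularities[OF chart(2)[OF c]])
    have "snd c ` fst c - Z c \<subseteq> snd c ` {p \<in> fst c. g p \<noteq> None}"
      by (auto simp: Z_def chart_inv_chart[OF c])
    then have "(\<lambda>z. the (g (chart_inv c z))) holomorphic_on (snd c ` fst c - Z c)"
      using the_g_holomorphic[OF c] holomorphic_on_subset by blast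
    moreover have "\<omega> c holomorphic_on (snd c ` fst c - Z c)" using \<omega>[OF c] by (rule holomorphic_on_subset) auto
    ultimately show "F c holomorphic_on (snd c ` fst c - Z c)"
      unfolding F_def by (intro holomorphic_intros)
    show "\<forall>\<^sub>F z in at z0. z \<notin> Z c" if "z0 \<in> snd c ` fst c" for z0 by (rule isolated[OF c that])
    show "\<exists>B. \<forall>\<^sub>F z in at z0. cmod (F c z) \<le> B" if "z0 \<in> snd c ` fst c \<inter> Z c" for z0
    proof -
      have z0: "z0 \<in> snd c ` fst c" using that by blast
      have "\<forall>\<^sub>F z in at z0. ?\<rho> c z < ?\<rho> c z0 + 1"
        using cont_\<rho>[OF c z0] unfolding isCont_def by (rule order_tendstoD) simp
      with near[OF c z0] have "\<forall>\<^sub>F z in at z0. cmod (F c z) \<le> sqrt ((?\<rho> c z0 + 1) / \<kappa>)"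
      proof eventually_elim
        case (elim z)
        have "\<kappa> * (cmod (F c z))\<^sup>2 \<le> \<kappa> * (1 + (cmod (?G (chart_inv c z)))\<^sup>2) ^ m * (cmod (F c z))\<^sup>2"
          using \<kappa> one_le_power[of "1 + (cmod (?G (chart_inv c z)))\<^sup>2" m]
          by (intro mult_right_mono) (simp_all del: o_apply)
        also have "\<dots> \<le> ?\<rho> c z0 + 1" using density_F[OF c elim(1)] elim(2) by simp
        finally have "(cmod (F c z))\<^sup>2 \<le> (?\<rho> c z0 + 1) / \<kappa>" using \<kappa> by (simp add: field_simps)
        then show ?case by (rule real_le_rsqrt)
      qed
      then show ?thesis by blast
    qed
  qed
  have W_F: "W c z = F c z" if "z \<notin> Z c" for c z using that by (simp add: W_def)
  have cont_hol: "isCont f z0" if "f holomorphic_on U" "open U" "z0 \<in> U" for f :: "complex \<Rightarrow> complex" and U z0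
    using that holomorphic_on_imp_continuous_on continuous_on_eq_continuous_at by blast
  have "weierstrass_representation X A ?\<rho> ?G W \<kappa> m"
  proof
    fix c c' p assume c: "c \<in> A" "c' \<in> A" and p: "p \<in> fst c" "p \<in> fst c'"
    let ?\<tau> = "transition c c'" and ?O = "snd c ` (fst c \<inter> fst c')"
    have O: "open ?O" using c by (intro open_chart_image) (auto simp: chart)
    have pO: "snd c p \<in> ?O" using p by blast
    have \<tau>p: "?\<tau> (snd c p) = snd c' p" by (rule transition_chart[OF c(1) p(1)])
    have \<tau>hol: "?\<tau> holomorphic_on ?O" using riemann_surface c by (simp add: riemann_surface_def)
    have "W c (snd c p) = W c' (?\<tau> (snd c p)) * deriv ?\<tau> (snd c p)"
    proof (rule eq_at_point_by_continuity[where f = "W c" and h = "\<lambda>z. W c' (?\<tau> z) * deriv ?\<tau> z"])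
      show "isCont (W c) (snd c p)" using W_hol[OF c(1)] chart(2)[OF c(1)] by (rule cont_hol) (use p in blast)
      have "isCont (W c') (?\<tau> (snd c p))"
        unfolding \<tau>p using W_hol[OF c(2)] chart(2)[OF c(2)] by (rule cont_hol) (use p in blast)
      with cont_hol[OF \<tau>hol O pO] have "isCont (\<lambda>z. W c' (?\<tau> z)) (snd c p)"
        by (rule isCont_o2)
      moreover have "isCont (deriv ?\<tau>) (snd c p)"
        by (rule cont_hol[OF holomorphic_deriv[OF \<tau>hol O] O pO])
      ultimately show "isCont (\<lambda>z. W c' (?\<tau> z) * deriv ?\<tau> z) (snd c p)"
        by (rule isCont_mult)
      have "\<forall>\<^sub>F z in at (snd c p). z \<notin> Z c" using isolated[OF c(1)] p by blast
      then show "\<forall>\<^sub>F z in at (snd c p). W c z = W c' (?\<tau> z) * deriv ?\<tau> z"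
        using eventually_at_in_open'[OF O pO]
      proof eventually_elim
        case (elim z)
        then obtain q where q: "q \<in> fst c" "q \<in> fst c'" "z = snd c q" by blast
        have \<tau>z: "?\<tau> z = snd c' q" unfolding q(3) by (rule transition_chart[OF c(1) q(1)])
        have "?\<tau> z \<notin> Z c'" using elim(1) q \<tau>z by (simp add: Z_def chart_inv_chart c)
        moreover have "\<omega> c z = \<omega> c' (?\<tau> z) * deriv ?\<tau> z"
          using form c elim(2) unfolding holomorphic_one_form_def by blast
        ultimately show ?case
          using elim(1) q \<tau>z by (simp add: W_F F_def chart_inv_chart c)
      qed
    qed
    then show "W c (snd c p) = W c' (snd c' p) * deriv ?\<tau> (snd c p)" unfolding \<tau>p .
  next
    fix c p assume c: "c \<in> A" and p: "p \<in> fst c"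
    let ?D = "snd c ` fst c"
    have pD: "snd c p \<in> ?D" using p by blast
    have "?\<rho> c (snd c p) = \<kappa> * (1 + (cmod ((?G \<circ> chart_inv c) (snd c p)))\<^sup>2) ^ m * (cmod (W c (snd c p)))\<^sup>2"
    proof (rule eq_at_point_by_continuity[where f = "?\<rho> c"
          and h = "\<lambda>z. \<kappa> * (1 + (cmod ((?G \<circ> chart_inv c) z))\<^sup>2) ^ m * (cmod (W c z))\<^sup>2"])
      show "isCont (?\<rho> c) (snd c p)" by (rule cont_\<rho>[OF c pD])
      have "isCont (?G \<circ> chart_inv c) (snd c p)" by (rule cont_hol[OF hol[OF c] chart(2)[OF c] pD])
      moreover have "isCont (W c) (snd c p)" by (rule cont_hol[OF W_hol[OF c] chart(2)[OF c] pD])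
      ultimately show "isCont (\<lambda>z. \<kappa> * (1 + (cmod ((?G \<circ> chart_inv c) z))\<^sup>2) ^ m * (cmod (W c z))\<^sup>2) (snd c p)"
        by (intro continuous_intros)
      show "\<forall>\<^sub>F z in at (snd c p). ?\<rho> c z = \<kappa> * (1 + (cmod ((?G \<circ> chart_inv c) z))\<^sup>2) ^ m * (cmod (W c z))\<^sup>2"
        using near[OF c pD] by eventually_elim (use density_F[OF c] in \<open>simp add: W_F\<close>)
    qed
    then show "?\<rho> c (snd c p) = \<kappa> * (1 + (cmod (?G p))\<^sup>2) ^ m * (cmod (W c (snd c p)))\<^sup>2"
      using p by (simp add: chart_inv_chart[OF c])
  qed (use hol W_hol \<kappa> in auto)
  then show ?thesis by blast
qed

section \<open>The number of omitted values\<close>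

theorem corollary1p2:
  fixes X :: "'a topology" and A :: "'a chart set"
    and \<omega> :: "'a chart \<Rightarrow> complex \<Rightarrow> complex"
    and g :: "'a \<Rightarrow> complex option"
    and m :: nat
  assumes "m \<ge> 1"
    and "open_riemann_surface X A"
    and "holomorphic_one_form A \<omega>"
    and "meromorphic_function X A g"
    and "conformal_metric A (metric_density m g \<omega>)"
    and "complete_metric X A (metric_density m g \<omega>)"
    and "\<not> g constant_on topspace X"
  shows "finite (UNIV - g ` topspace X) \<and> card (UNIV - g ` topspace X) \<le> m + 2"
proof (rule ccontr)
  let ?\<rho> = "metric_density m g \<omega>"
  let ?E = "UNIV - g ` topspace X"
  assume many: "\<not> ?thesis"
  have "\<exists>E. E \<subseteq> ?E \<and> finite E \<and> card E = m + 3"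
  proof (cases "finite ?E")
    case True
    then have "m + 3 \<le> card ?E" using many by simp
    from obtain_subset_with_card_n[OF this] show ?thesis by metis
  next
    case False
    from infinite_arbitrarily_large[OF this, of "m + 3"] show ?thesis by metis
  qed
  then obtain E where E: "E \<subseteq> ?E" "finite E" "card E = m + 3" by blast
  have conf: "conformal_surface X A ?\<rho>"
    using assms(2,5) by unfold_locales (auto simp: open_riemann_surface_def)
  have mero: "meromorphic X A g"
    using assms(2,4) by unfold_locales (auto simp: open_riemann_surface_def)
  have "\<exists>e\<in>E. \<exists>T W \<kappa>. inj_on T (UNIV - {e}) \<and> weierstrass_representation X A ?\<rho> (T \<circ> g) W \<kappa> m"
  proof (cases "None \<in> E")
    case True
    moreover have "inj_on the (UNIV - {None :: complex option})" by (auto simp: inj_on_def)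
    moreover have "weierstrass_representation X A ?\<rho> (the \<circ> g) \<omega> 1 m"
      using True E(1) by (intro representation_if_omits_infinity conf mero assms) auto
    ultimately show ?thesis by blast
  next
    case False
    have "E \<noteq> {}" using E by auto
    then obtain a where a: "Some a \<in> E" using False by (metis all_not_in_conv not_None_eq)
    moreover have "\<exists>W \<kappa>. weierstrass_representation X A ?\<rho> (sphere_rotation a \<circ> g) W \<kappa> m"
      using a E(1) by (intro representation_if_omits_finite_value conf mero assms) auto
    ultimately show ?thesis using inj_sphere_rotation by blast
  qed
  then obtain e T W \<kappa> where e: "e \<in> E" and T: "inj_on T (UNIV - {e})"
    and rep: "weierstrass_representation X A ?\<rho> (T \<circ> g) W \<kappa> m" by blast
  interpret weierstrass_representation X A ?\<rho> "T \<circ> g" W \<kappa> m by (rule rep)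
  interpret omitting_representation X A ?\<rho> "T \<circ> g" W \<kappa> m "T ` (E - {e})"
  proof
    show "finite (T ` (E - {e}))" using E by simp
    have "card (T ` (E - {e})) = card (E - {e})"
      by (intro card_image inj_on_subset[OF T]) auto
    then show "card (T ` (E - {e})) = m + 2" using E e by simp
    show "(T \<circ> g) p \<notin> T ` (E - {e})" if "p \<in> topspace X" for p
    proof
      assume "(T \<circ> g) p \<in> T ` (E - {e})"
      then obtain x where x: "x \<in> E - {e}" "T (g p) = T x" by auto
      have "g p \<notin> E" using E(1) that by blast
      then have "g p \<noteq> e" using e by auto
      then have "g p = x" using inj_onD[OF T x(2)] x(1) by auto
      then show False using x(1) \<open>g p \<notin> E\<close> by auto
    qed
    show "Metric.mcomplete" using assms(6) by (simp add: complete_metric_def)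
  qed
  have "(T \<circ> g) constant_on topspace X"
    by (rule constant_if_deriv_zero[OF connected G_holomorphic G_deriv_zero])
  then obtain b where b: "\<And>p. p \<in> topspace X \<Longrightarrow> T (g p) = b" unfolding constant_on_def by auto
  have "g p = g q" if "p \<in> topspace X" "q \<in> topspace X" for p q
    using inj_onD[OF T, of "g p" "g q"] b that E(1) e by blast
  then show False using assms(7) unfolding constant_on_def by metis
qed

end
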